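(* Let $M(1)$ be the vertex operator algebra of $d$ free bosons ($d\ge1$) constructed from $\mathfrak h$, let $Q=\mathbb C[E_2,E_4,E_6]$, and fix $a\in\mathfrak h$ with $(a,a)=1$. Let $W$ be the subspace of $M(1)$ spanned by the vectors $a[-1]^{2r}a[-2]^{2s}a[-3]^{2t}\mathbf 1$ for integers $r,s,t\ge0$. Then the linear map $M(1)\to Q$, $v\mapsto(\mathrm{ch}_qM(1))^{-1}Z(v,q)=\eta(q)^dZ(v,q)$, restricts to a linear isomorphism from $W$ onto $Q$.
   Context: Free boson VOA: let $\mathfrak{h}$ be a $d$-dimensional complex vector space with a non-degenerate symmetric bilinear form $(\,,\,)$, and $\hat{\mathfrak h}=\mathfrak h\otimes\mathbb C[t,t^{-1}]\oplus\mathbb CK$ with $[h\otimes t^m,h'\otimes t^n]=m(h,h')\delta_{m+n,0}K$ and $K$ central. Let $M(1)=U(\hat{\mathfrak h})\otimes_{U(\mathfrak h\otimes\mathbb C[t]\oplus\mathbb CK)}\mathbb C$, where $\mathfrak h\otimes\mathbb C[t]$ acts on $\mathbb C$ by $0$ and $K$ by $1$. Write $h(n)$ for the action of $h\otimes t^n$ and $\mathbf 1=1\otimes1$. $M(1)$ is spanned by the vectors $a_1(-n_1)\cdots a_k(-n_k)\mathbf 1$ ($a_i\in\mathfrak h$, $n_i\ge1$), with vertex operators $Y(a_1(-n_1)\cdots a_k(-n_k)\mathbf 1,z)={:}\partial^{(n_1-1)}a_1(z)\cdots\partial^{(n_k-1)}a_k(z){:}$, where $\partial^{(n)}=\frac1{n!}(d/dz)^n$,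 $a(z)=\sum_{n\in\mathbb Z}a(n)z^{-n-1}$ and ${:}\ {:}$ is normal ordering. The Virasoro element is $\omega=\frac12\sum_{i=1}^d h_i(-1)^2\mathbf 1$ for an orthonormal basis $h_1,\dots,h_d$ of $\mathfrak h$; the central charge is $c=d$; the weight-$n$ space $M(1)_n$ is spanned by the vectors $a_1(-n_1)\cdots a_k(-n_k)\mathbf 1$ ($a_i\in\mathfrak h$, $n_i\ge1$) with $\sum n_i=n$. $\mathfrak h$ is identified with $M(1)_1$ via $a\mapsto a(-1)\mathbf 1$. Trace functions: write $Y(v,z)=\sum_n v(n)z^{-n-1}$. For $v$ homogeneous of weight $k$ put $o(v)=v(k-1)$; extend $o$ linearly. Then $Z(v,q)=\mathrm{tr}_{M(1)}\,o(v)q^{L(0)-c/24}$, and $\mathrm{ch}_qM(1)=Z(\mathbf 1,q)=\eta(q)^{-d}$. For every $v\in M(1)$ one has $\eta(q)^dZ(v,q)\in Q$. Bracket modes: for homogeneous $a$ of weight $\mathrm{wt}(a)$, $Y[a,z]=\sum_{n\in\mathbb Z}a[n]z^{-n-1}=Y(a,e^z-1)e^{z\,\mathrm{wt}(a)}$. $\eta(q)=q^{1/24}\prod_{n\ge1}(1-q^n)$. $E_{2k}=\frac{-B_{2k}}{(2k)!}+\frac{2}{(2k-1)!}\sum_{n\ge1}\sigma_{2k-1}(n)q^n$, with $B_{2k}$ Bernoulli numbers and $\sigma_k(n)$ the sum of the $k$-th powers of the divisors of $n$. *)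

theory Defs
  imports "HOL-Analysis.Analysis" "HOL-Library.Poly_Mapping"
    "HOL-Computational_Algebra.Formal_Laurent_Series"
begin

section \<open>Complex vector spaces\<close>

class complex_vec = ab_group_add +
  fixes cscale :: "complex \<Rightarrow> 'a \<Rightarrow> 'a"  (infixr "*\<^sub>C" 75)
  assumes cscale_right_add: "c *\<^sub>C (x + y) = c *\<^sub>C x + c *\<^sub>C y"
    and cscale_left_add: "(b + c) *\<^sub>C x = b *\<^sub>C x + c *\<^sub>C x"
    and cscale_assoc: "b *\<^sub>C c *\<^sub>C x = (b * c) *\<^sub>C x"
    and cscale_unit: "1 *\<^sub>C x = x"

interpretation cvs: vector_space "cscale :: complex \<Rightarrow> 'a \<Rightarrow> 'a::complex_vec"
  by unfold_locales (simp_all add: cscale_right_add cscale_left_add cscale_assoc cscale_unit)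

abbreviation clin :: "('a::complex_vec \<Rightarrow> 'b::complex_vec) \<Rightarrow> bool"
  where "clin \<equiv> Vector_Spaces.linear (*\<^sub>C) (*\<^sub>C)"

instantiation complex :: complex_vec
begin
definition "cscale (c::complex) x = c * x"
instance by standard (simp_all add: cscale_complex_def algebra_simps)
end

instantiation prod :: (complex_vec, complex_vec) complex_vec
begin
definition "c *\<^sub>C p = (c *\<^sub>C fst p, c *\<^sub>C snd p)"
instance
  by standard
    (simp_all add: cscale_prod_def prod_eq_iff cvs.scale_right_distrib cvs.scale_left_distrib)
end

instantiation poly_mapping :: (type, complex_vec) complex_vec
begin
definition "c *\<^sub>C p = Poly_Mapping.map ((*\<^sub>C) c) p"

lemma lookup_cscale [simp]: "Poly_Mapping.lookup (c *\<^sub>C p) k = c *\<^sub>C Poly_Mapping.lookup p k"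
  unfolding cscale_poly_mapping_def by (simp add: Poly_Mapping.map.rep_eq when_def)

instance
  by standard
    (auto intro!: poly_mapping_eqI
      simp: lookup_add cvs.scale_right_distrib cvs.scale_left_distrib)
end

text \<open>The trace of an endomorphism \<open>T\<close> of a finite-dimensional subspace \<open>S\<close>.\<close>

definition trace_on :: "'a::complex_vec set \<Rightarrow> ('a \<Rightarrow> 'a) \<Rightarrow> complex" where
  "trace_on S T =
     (let B = (SOME B. cvs.independent B \<and> cvs.span B = S)
      in \<Sum>b\<in>B. cvs.representation B (T b) b)"

section \<open>The Heisenberg Lie algebra\<close>

text \<open>Finite-dimensional complex vector spaces with a non-degenerate symmetric bilinear form.\<close>

class quad_space = complex_vec +
  fixes form :: "'a \<Rightarrow> 'a \<Rightarrow> complex"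
  assumes form_sym: "form x y = form y x"
    and form_add: "form (x + y) z = form x z + form y z"
    and form_scale: "form (cscale c x) y = c * form x y"
    and form_nondegenerate: "(\<And>y. form x y = 0) \<Longrightarrow> x = 0"
    and finite_dimensional: "\<exists>B. finite B \<and> (\<forall>x. \<exists>c. x = (\<Sum>b\<in>B. cscale (c b) b))"

text \<open>
  The pair \<open>(f, k)\<close> stands for \<open>(\<Sum>n. f(n) \<otimes> t\<^sup>n) + k K\<close>.
\<close>

type_synonym 'h heis = "(int \<Rightarrow>\<^sub>0 'h) \<times> complex"

definition loop :: "'h \<Rightarrow> int \<Rightarrow> 'h::quad_space heis" where
  "loop h n = (Poly_Mapping.single n h, 0)"

definition heis_bracket :: "'h::quad_space heis \<Rightarrow> 'h heis \<Rightarrow> 'h heis" where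
  "heis_bracket x y =
     (0, \<Sum>m\<in>Poly_Mapping.keys (fst x). of_int m *
       form (Poly_Mapping.lookup (fst x) m) (Poly_Mapping.lookup (fst y) (- m)))"

text \<open>
  The subalgebra \<open>\<hh> \<otimes> \<complex>[t] \<oplus> \<complex>K\<close>; its character that is \<open>0\<close> on \<open>\<hh> \<otimes> \<complex>[t]\<close> and
  \<open>1\<close> on \<open>K\<close> is \<open>snd\<close>.
\<close>

definition heis_nonneg :: "'h::quad_space heis set" where
  "heis_nonneg = {x. Poly_Mapping.keys (fst x) \<subseteq> {0..}}"

section \<open>The induced module \<open>M(1)\<close>\<close>

text \<open>
  For a Lie algebra \<open>g\<close> and a character \<open>\<chi>\<close> of a subalgebra \<open>b\<close>, the module
  \<open>U(g) \<otimes>\<^bsub>U(b)\<^esub> \<complex>\<close> is the quotient of the free vector space on words in \<open>g\<close> by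
  multilinearity (giving the tensor algebra), by the two-sided ideal of the relations
  \<open>xy - yx = [x, y]\<close> (giving \<open>U(g)\<close>), and by the left ideal of the \<open>b - \<chi>(b)\<close>.
\<close>

abbreviation word :: "'g list \<Rightarrow> ('g list \<Rightarrow>\<^sub>0 complex)" where
  "word u \<equiv> Poly_Mapping.single u 1"

definition induced_relations :: "('h::quad_space heis list \<Rightarrow>\<^sub>0 complex) set" where
  "induced_relations =
     {word (u @ (x + y) # w) - word (u @ x # w) - word (u @ y # w) | u x y w. True} \<union>
     {word (u @ (c *\<^sub>C x) # w) - c *\<^sub>C word (u @ x # w) | u c x w. True} \<union>
     {word (u @ x # y # w) - word (u @ y # x # w) - word (u @ heis_bracket x y # w) | u x y w. True} \<union>
     {word (u @ [b]) - snd b *\<^sub>C word u | u b. b \<in> heis_nonneg}"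

quotient_type (overloaded) 'h boson = "'h::quad_space heis list \<Rightarrow>\<^sub>0 complex" /
    "\<lambda>p q. p - q \<in> cvs.span induced_relations"
proof (rule equivpI)
  show "reflp (\<lambda>p q :: 'h heis list \<Rightarrow>\<^sub>0 complex. p - q \<in> cvs.span induced_relations)"
    by (simp add: reflp_def cvs.span_zero)
  show "symp (\<lambda>p q :: 'h heis list \<Rightarrow>\<^sub>0 complex. p - q \<in> cvs.span induced_relations)"
    by (metis (mono_tags, lifting) cvs.span_neg minus_diff_eq sympI)
  show "transp (\<lambda>p q :: 'h heis list \<Rightarrow>\<^sub>0 complex. p - q \<in> cvs.span induced_relations)"
  proof (rule transpI)
    fix p q r :: "'h heis list \<Rightarrow>\<^sub>0 complex"
    assume "p - q \<in> cvs.span induced_relations" "q - r \<in> cvs.span induced_relations"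
    from cvs.span_add[OF this] show "p - r \<in> cvs.span induced_relations" by simp
  qed
qed

instantiation boson :: (quad_space) complex_vec
begin

lift_definition zero_boson :: "'a boson" is 0 .

lift_definition plus_boson :: "'a boson \<Rightarrow> 'a boson \<Rightarrow> 'a boson" is "(+)"
  by (metis (no_types, lifting) add_diff_add cvs.span_add)

lift_definition uminus_boson :: "'a boson \<Rightarrow> 'a boson" is uminus
  by (metis (no_types, lifting) cvs.span_neg minus_diff_minus)

lift_definition minus_boson :: "'a boson \<Rightarrow> 'a boson \<Rightarrow> 'a boson" is "(-)"
proof -
  fix p q r s :: "'a heis list \<Rightarrow>\<^sub>0 complex"
  assume "p - q \<in> cvs.span induced_relations" "r - s \<in> cvs.span induced_relations"
  from cvs.span_diff[OF this] show "p - r - (q - s) \<in> cvs.span induced_relations"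
    by (simp add: algebra_simps)
qed

lift_definition cscale_boson :: "complex \<Rightarrow> 'a boson \<Rightarrow> 'a boson" is "(*\<^sub>C)"
  by (metis (no_types, lifting) cvs.scale_right_diff_distrib cvs.span_scale)

instance
proof
  fix x y z :: "'a boson" and b c :: complex
  show "x + y + z = x + (y + z)" by transfer (simp add: algebra_simps cvs.span_zero)
  show "x + y = y + x" by transfer (simp add: algebra_simps cvs.span_zero)
  show "0 + x = x" by transfer (simp add: cvs.span_zero)
  show "- x + x = 0" by transfer (simp add: cvs.span_zero)
  show "x - y = x + - y" by transfer (simp add: cvs.span_zero)
  show "c *\<^sub>C (x + y) = c *\<^sub>C x + c *\<^sub>C y"
    by transfer (simp add: cvs.scale_right_distrib cvs.span_zero)
  show "(b + c) *\<^sub>C x = b *\<^sub>C x + c *\<^sub>C x"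
    by transfer (simp add: cvs.scale_left_distrib cvs.span_zero)
  show "b *\<^sub>C c *\<^sub>C x = (b * c) *\<^sub>C x" by transfer (simp add: cvs.span_zero)
  show "1 *\<^sub>C x = x" by transfer (simp add: cvs.span_zero)
qed

end

lifting_forget poly_mapping.lifting

lift_definition vac :: "'h::quad_space boson" is "word []" .

text \<open>Left multiplication by a letter, extended linearly from words.\<close>

definition lmult :: "'g \<Rightarrow> ('g list \<Rightarrow>\<^sub>0 complex) \<Rightarrow> ('g list \<Rightarrow>\<^sub>0 complex)" where
  "lmult x p = (\<Sum>u\<in>Poly_Mapping.keys p. Poly_Mapping.lookup p u *\<^sub>C word (x # u))"

lemma lmult_superset:
  assumes "finite A" "Poly_Mapping.keys p \<subseteq> A"
  shows "lmult x p = (\<Sum>u\<in>A. Poly_Mapping.lookup p u *\<^sub>C word (x # u))"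
  unfolding lmult_def
  by (rule sum.mono_neutral_left) (use assms in \<open>auto simp: in_keys_iff\<close>)

lemma clin_lmult: "clin (lmult x)"
proof (unfold_locales, goal_cases)
  case (1 p q)
  let ?A = "Poly_Mapping.keys p \<union> Poly_Mapping.keys q \<union> Poly_Mapping.keys (p + q)"
  show ?case
    by (simp add: lmult_superset[of ?A] lookup_add cvs.scale_left_distrib sum.distrib le_supI1)
next
  case (2 c p)
  let ?A = "Poly_Mapping.keys p \<union> Poly_Mapping.keys (c *\<^sub>C p)"
  show ?case
    by (simp add: lmult_superset[of ?A] cvs.scale_sum_right cscale_complex_def)
qed

lemma lmult_word [simp]: "lmult x (word u) = word (x # u)"
  by (simp add: lmult_def)

lemma lmult_induced_relations:
  assumes "r \<in> induced_relations"
  shows "lmult x r \<in> induced_relations"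
proof -
  interpret L: Vector_Spaces.linear "(*\<^sub>C)" "(*\<^sub>C)" "lmult x"
    by (rule clin_lmult)
  from assms consider
      (add) u y z w where
        "r = word (u @ (y + z) # w) - word (u @ y # w) - word (u @ z # w)"
    | (scale) u c y w where
        "r = word (u @ (c *\<^sub>C y) # w) - c *\<^sub>C word (u @ y # w)"
    | (bracket) u y z w where
        "r = word (u @ y # z # w) - word (u @ z # y # w) - word (u @ heis_bracket y z # w)"
    | (nonneg) u b where
        "r = word (u @ [b]) - snd b *\<^sub>C word u" "b \<in> heis_nonneg"
    unfolding induced_relations_def by blast
  then show ?thesis
  proof cases
    case add
    then have "lmult x r =
        word ((x # u) @ (y + z) # w) - word ((x # u) @ y # w) - word ((x # u) @ z # w)"
      by (simp only: L.diff lmult_word append_Cons)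
    then show ?thesis unfolding induced_relations_def by blast
  next
    case scale
    then have "lmult x r = word ((x # u) @ (c *\<^sub>C y) # w) - c *\<^sub>C word ((x # u) @ y # w)"
      by (simp only: L.diff L.scale lmult_word append_Cons)
    then show ?thesis unfolding induced_relations_def by blast
  next
    case bracket
    then have "lmult x r = word ((x # u) @ y # z # w) - word ((x # u) @ z # y # w) -
        word ((x # u) @ heis_bracket y z # w)"
      by (simp only: L.diff lmult_word append_Cons)
    then show ?thesis unfolding induced_relations_def by blast
  next
    case nonneg
    then have "lmult x r = word ((x # u) @ [b]) - snd b *\<^sub>C word (x # u)"
      by (simp only: L.diff L.scale lmult_word append_Cons)
    with nonneg(2) show ?thesis unfolding induced_relations_def by blast
  qed
qed

lemma lmult_span:
  assumes "p \<in> cvs.span induced_relations"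
  shows "lmult x p \<in> cvs.span induced_relations"
proof -
  interpret L: Vector_Spaces.linear "(*\<^sub>C)" "(*\<^sub>C)" "lmult x"
    by (rule clin_lmult)
  have "lmult x ` cvs.span induced_relations = cvs.span (lmult x ` induced_relations)"
    by (rule L.span_image[symmetric])
  also have "\<dots> \<subseteq> cvs.span induced_relations"
    by (intro cvs.span_mono) (auto intro: lmult_induced_relations)
  finally show ?thesis using assms by blast
qed

lift_definition act :: "'h::quad_space heis \<Rightarrow> 'h boson \<Rightarrow> 'h boson" is lmult
proof -
  fix x :: "'h heis" and p q :: "'h heis list \<Rightarrow>\<^sub>0 complex"
  assume "p - q \<in> cvs.span induced_relations"
  then have "lmult x (p - q) \<in> cvs.span induced_relations" by (rule lmult_span)
  moreover have "lmult x (p - q) = lmult x p - lmult x q"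
  proof -
    interpret L: Vector_Spaces.linear "(*\<^sub>C)" "(*\<^sub>C)" "lmult x"
      by (rule clin_lmult)
    show ?thesis by (rule L.diff)
  qed
  ultimately show "lmult x p - lmult x q \<in> cvs.span induced_relations" by simp
qed

text \<open>\<open>hmode h n\<close> is the operator \<open>h(n)\<close>.\<close>

definition hmode :: "'h::quad_space \<Rightarrow> int \<Rightarrow> 'h boson \<Rightarrow> 'h boson" where
  "hmode h n = act (loop h n)"

text \<open>
  The vector \<open>a\<^sub>1(-n\<^sub>1)\<cdots>a\<^sub>k(-n\<^sub>k)\<one>\<close> is encoded by the list of the pairs \<open>(a\<^sub>i, n\<^sub>i)\<close>, where all
  \<open>n\<^sub>i \<ge> 1\<close>.
\<close>

definition admissible :: "('h \<times> nat) list \<Rightarrow> bool" where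
  "admissible xs \<longleftrightarrow> (\<forall>(a, n)\<in>set xs. n \<ge> 1)"

definition fock :: "('h::quad_space \<times> nat) list \<Rightarrow> 'h boson" where
  "fock xs = foldr (\<lambda>(a, n). hmode a (- int n)) xs vac"

definition weight_space :: "nat \<Rightarrow> 'h::quad_space boson set" where
  "weight_space n = cvs.span {fock xs | xs. admissible xs \<and> sum_list (map snd xs) = n}"

section \<open>Vertex operators\<close>

text \<open>
  \<open>:a\<^sub>1(m\<^sub>1)\<cdots>a\<^sub>k(m\<^sub>k):\<close>, with the annihilation operators (\<open>m\<^sub>i \<ge> 0\<close>) moved to the right.
\<close>

definition normal_ordered :: "('h::quad_space \<times> int) list \<Rightarrow> 'h boson \<Rightarrow> 'h boson" where
  "normal_ordered ys =
     foldr (\<lambda>(a, m). hmode a m)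
       (filter (\<lambda>(a, m). m < 0) ys @ filter (\<lambda>(a, m). m \<ge> 0) ys)"

text \<open>
  The coefficient of \<open>z\<^bsup>-n-1\<^esup>\<close> in
  \<open>:\<partial>\<^bsup>(n\<^sub>1-1)\<^esup>a\<^sub>1(z)\<cdots>\<partial>\<^bsup>(n\<^sub>k-1)\<^esup>a\<^sub>k(z): w\<close>. Since
  \<open>\<partial>\<^bsup>(p)\<^esup>a(z) = (\<Sum>m. binom(-m-1, p) a(m) z\<^bsup>-m-1-p\<^esup>)\<close>, the modes
  \<open>a\<^sub>1(m\<^sub>1), \<dots>, a\<^sub>k(m\<^sub>k)\<close> contribute to the power \<open>z\<^bsup>-(m\<^sub>1+n\<^sub>1)-\<cdots>-(m\<^sub>k+n\<^sub>k)\<^esup>\<close>. Only finitely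
  many tuples give a nonzero vector, so that \<^const>\<open>Sum_any\<close> is the intended sum.
\<close>

definition normal_ordered_mode ::
    "('h::quad_space \<times> nat) list \<Rightarrow> int \<Rightarrow> 'h boson \<Rightarrow> 'h boson" where
  "normal_ordered_mode xs n w =
     Sum_any (\<lambda>ms :: int list.
       if length ms = length xs \<and> (\<Sum>i<length xs. ms ! i + int (snd (xs ! i))) = n + 1
       then (\<Prod>i<length xs. of_int (- ms ! i - 1) gchoose (snd (xs ! i) - 1))
              *\<^sub>C normal_ordered (zip (map fst xs) ms) w
       else 0)"

text \<open>
  \<open>vmode v n\<close> is \<open>v(n)\<close>, where \<open>Y(v, z) = (\<Sum>n. v(n) z\<^bsup>-n-1\<^esup>)\<close>: the linear extension of
  the formula for the spanning vectors.
\<close>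

definition vmode :: "'h::quad_space boson \<Rightarrow> int \<Rightarrow> 'h boson \<Rightarrow> 'h boson" where
  "vmode = (THE Y.
     (\<forall>n w. clin (\<lambda>v. Y v n w)) \<and>
     (\<forall>xs. admissible xs \<longrightarrow> (\<forall>n w. Y (fock xs) n w = normal_ordered_mode xs n w)))"

definition zero_mode :: "'h::quad_space boson \<Rightarrow> 'h boson \<Rightarrow> 'h boson" where
  "zero_mode = (THE f.
     (\<forall>w. clin (\<lambda>v. f v w)) \<and>
     (\<forall>k. \<forall>v\<in>weight_space k. f v = vmode v (int k - 1)))"

text \<open>
  The bracket mode \<open>v[n]\<close> of a vector \<open>v\<close> of weight \<open>k\<close>: the coefficient of \<open>z\<^bsup>-n-1\<^esup>\<close> in
  \<open>Y(v, e\<^sup>z - 1) e\<^bsup>kz\<^esup> = (\<Sum>m. v(m) (e\<^sup>z - 1)\<^bsup>-m-1\<^esup> e\<^bsup>kz\<^esup>)\<close>. Powers of \<open>e\<^sup>z - 1\<close> are taken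
  in Laurent series, and on each vector only finitely many \<open>m\<close> contribute.
\<close>

definition bracket_mode ::
    "nat \<Rightarrow> 'h::quad_space boson \<Rightarrow> int \<Rightarrow> 'h boson \<Rightarrow> 'h boson" where
  "bracket_mode k v n w =
     Sum_any (\<lambda>m :: int.
       fls_nth ((fps_to_fls (fps_exp 1 - 1)) powi (- m - 1) * fps_to_fls (fps_exp (of_nat k)))
         (- n - 1) *\<^sub>C vmode v m w)"

text \<open>The same for \<open>a \<in> \<hh>\<close>, identified with \<open>a(-1)\<one> \<in> M(1)\<^sub>1\<close>.\<close>

definition hbracket :: "'h::quad_space \<Rightarrow> int \<Rightarrow> 'h boson \<Rightarrow> 'h boson" where
  "hbracket a = bracket_mode 1 (hmode a (- 1) vac)"

definition W_space :: "'h::quad_space \<Rightarrow> 'h boson set" where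
  "W_space a = cvs.span
     {(hbracket a (- 1) ^^ (2 * r)) ((hbracket a (- 2) ^^ (2 * s))
        ((hbracket a (- 3) ^^ (2 * t)) vac)) | r s t. True}"

section \<open>Trace functions and quasimodular forms\<close>

text \<open>
  All \<open>q\<close>-series are formal Laurent series in \<open>X = q\<^bsup>1/24\<^esup>\<close>, which accommodates
  \<open>\<eta>\<close> and \<open>q\<^bsup>-c/24\<^esup>\<close>.
\<close>

definition q_series :: "complex fps \<Rightarrow> complex fls" where
  "q_series f = fps_to_fls (f oo fps_X ^ 24)"

text \<open>\<open>L(0)\<close> acts on \<^term>\<open>weight_space n\<close> as \<open>n\<close>, and \<open>c = dim \<hh>\<close>.\<close>

definition trace_fun :: "'h::quad_space boson \<Rightarrow> complex fls" where
  "trace_fun v =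
     fls_X_intpow (- int (cvs.dim (UNIV :: 'h set))) *
     q_series (Abs_fps (\<lambda>n. trace_on (weight_space n) (zero_mode v)))"

definition eta :: "complex fls" where
  "eta = fls_X * q_series (prodinf (\<lambda>n. 1 - fps_X ^ (n + 1)))"

definition bernoulli_number :: "nat \<Rightarrow> complex" where
  "bernoulli_number n = fact n * fps_nth (fps_X / (fps_exp 1 - 1)) n"

definition divisor_power_sum :: "nat \<Rightarrow> nat \<Rightarrow> nat" where
  "divisor_power_sum k n = (\<Sum>d | d dvd n. d ^ k)"

text \<open>\<open>eisenstein k\<close> is \<open>E\<^sub>2\<^sub>k\<close>, for \<open>k \<ge> 1\<close>.\<close>

definition eisenstein :: "nat \<Rightarrow> complex fls" where
  "eisenstein k = q_series (Abs_fps (\<lambda>n.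
     if n = 0 then - bernoulli_number (2 * k) / fact (2 * k)
     else 2 / fact (2 * k - 1) * of_nat (divisor_power_sum (2 * k - 1) n)))"

text \<open>The \<open>\<complex>\<close>-algebra \<open>Q = \<complex>[E\<^sub>2, E\<^sub>4, E\<^sub>6]\<close>.\<close>

inductive_set quasimodular :: "complex fls set" where
  const: "fls_const c \<in> quasimodular"
| E2: "eisenstein 1 \<in> quasimodular"
| E4: "eisenstein 2 \<in> quasimodular"
| E6: "eisenstein 3 \<in> quasimodular"
| add: "f \<in> quasimodular \<Longrightarrow> g \<in> quasimodular \<Longrightarrow> f + g \<in> quasimodular"
| mult: "f \<in> quasimodular \<Longrightarrow> g \<in> quasimodular \<Longrightarrow> f * g \<in> quasimodular"

end

theory Submission
  imports Defs
begin

text \<open>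
  Commuting \<open>a(-k)\<close> around the trace gives \<open>(1 - q\<^sup>i)\<close>-denominators and hence Zhu's recursion: the
  trace of \<open>a[-k]v\<close> is a combination of the traces of \<open>a[l]v\<close>, \<open>l \<ge> 1\<close>, whose coefficients are
  Lambert series. For \<open>v\<close> a word in \<open>a[-1], a[-2], a[-3]\<close> this is Wick's theorem, with the
  contractions \<open>E\<^sub>2\<close> of \<open>a[-1], a[-1]\<close>, \<open>3 E\<^sub>4\<close> of \<open>a[-1], a[-3]\<close>, \<open>-6 E\<^sub>4\<close> of \<open>a[-2], a[-2]\<close>,
  \<open>30 E\<^sub>6\<close> of \<open>a[-3], a[-3]\<close>, and \<open>0\<close> otherwise. So \<open>a[-1]\<^bsup>2r\<^esup> a[-2]\<^bsup>2s\<^esup> a[-3]\<^bsup>2t\<^esup> \<one>\<close> is mapped to a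
  nonzero multiple of \<open>E\<^sub>2\<^sup>r E\<^sub>4\<^sup>s E\<^sub>6\<^sup>t\<close> plus terms of lower degree in \<open>E\<^sub>2\<close>, and the theorem follows
  from the algebraic independence of \<open>E\<^sub>2, E\<^sub>4, E\<^sub>6\<close>, which is derived from their transformation
  behaviour under \<open>SL\<^sub>2(\<int>)\<close>. The vertex operators are understood by identifying \<open>M(1)\<close> with a
  polynomial algebra on which the Heisenberg algebra acts by multiplications and derivations.
\<close>

section \<open>The induced module M(1): spanning vectors, polynomial model, and maps out of
  it\<close>

section \<open>Linear maps\<close>

text \<open>The operators Y(v, z) and o(v) and the traces are given by descriptions and choices
  (\<open>THE\<close>, \<open>SOME\<close>) over a quotient of a space of words, so nothing can be
  computed before M(1) is known to have a basis of Fock vectors. Moving annihilation modes to the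
  right gives spanning; the polynomial model gives independence.

  The square-bracket modes matter because they make contractions homogeneous in weight: a[-m] with
  a[-n] yields (-1)^(m+1) (m+n-1)! / ((m-1)! (n-1)!) times E_(m+n), with E_(m+n) read as 0 for odd
  m+n. This is the origin of the constants 1, 3, -6, 30; for the plain modes a(-n), divisor sums of
  different weights mix. Since a[-1] also contracts with a[-3], the comparison with the monomials in
  E_2, E_4, E_6 is only triangular, by degree in E_2.

  A formal relation carries no action of SL_2(Z), so independence is proved for convergent series.
  For E_4 and E_6 the lattice sums converge absolutely. In weight 2 they do not; the resulting
  correction term is what separates E_2 from E_4 and E_6.\<close>

lemma clinI:
  assumes "\<And>x y. f (x + y) = f x + f y" "\<And>c x. f (c *\<^sub>C x) = c *\<^sub>C f x"
  shows "clin f"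
  by unfold_locales (auto simp: assms)

lemma clin_add: "clin f \<Longrightarrow> f (x + y) = f x + f y"
  and clin_scale: "clin f \<Longrightarrow> f (c *\<^sub>C x) = c *\<^sub>C f x"
  and clin_zero: "clin f \<Longrightarrow> f 0 = 0"
  and clin_diff: "clin f \<Longrightarrow> f (x - y) = f x - f y"
  and clin_sum: "clin f \<Longrightarrow> f (sum g A) = (\<Sum>a\<in>A. f (g a))"
proof -
  assume "clin f"
  then interpret L: Vector_Spaces.linear "(*\<^sub>C)" "(*\<^sub>C)" f .
  show "f (x + y) = f x + f y" "f (c *\<^sub>C x) = c *\<^sub>C f x" "f 0 = 0" "f (x - y) = f x - f y"
    "f (sum g A) = (\<Sum>a\<in>A. f (g a))"
    by (rule L.add L.scale L.zero L.diff L.sum)+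
qed

lemma clin_compose: "clin f \<Longrightarrow> clin g \<Longrightarrow> clin (\<lambda>x. f (g x))"
  by (rule clinI) (simp_all add: clin_add clin_scale)

lemma clin_id: "clin (\<lambda>x. x)"
  by (rule clinI) simp_all

lemma clin_eq_zero_on_span:
  assumes "clin f" "\<And>x. x \<in> S \<Longrightarrow> f x = 0" "v \<in> cvs.span S"
  shows "f v = 0"
  using assms(3)
  by (induction rule: cvs.span_induct_alt)
     (simp_all add: clin_zero[OF assms(1)] clin_add[OF assms(1)] clin_scale[OF assms(1)] assms(2))

lemma span_image_subset:
  assumes "clin f" "f ` S \<subseteq> cvs.span T" "v \<in> cvs.span S"
  shows "f v \<in> cvs.span T"
  using assms(3)
proof (induction rule: cvs.span_induct_alt)
  case base
  show ?case by (simp add: clin_zero[OF assms(1)] cvs.span_zero)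
next
  case (step c x y)
  then have "f x \<in> cvs.span T" using assms(2) by blast
  then show ?case using step
    by (simp add: clin_add[OF assms(1)] clin_scale[OF assms(1)] cvs.span_add cvs.span_scale)
qed

text \<open>The finitely supported functions form the free vector space on \<open>'k\<close>; this
  is its universal property.\<close>

definition lin_ext :: "('k \<Rightarrow> 'v::complex_vec) \<Rightarrow> ('k \<Rightarrow>\<^sub>0 complex) \<Rightarrow> 'v" where
  "lin_ext f p = (\<Sum>k\<in>Poly_Mapping.keys p. Poly_Mapping.lookup p k *\<^sub>C f k)"

lemma lin_ext_superset:
  assumes "finite A" "Poly_Mapping.keys p \<subseteq> A"
  shows "lin_ext f p = (\<Sum>k\<in>A. Poly_Mapping.lookup p k *\<^sub>C f k)"
  unfolding lin_ext_def
  by (rule sum.mono_neutral_left) (use assms in \<open>auto simp: in_keys_iff\<close>)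

lemma clin_lin_ext: "clin (lin_ext f)"
proof (rule clinI)
  fix p q :: "'a \<Rightarrow>\<^sub>0 complex"
  let ?A = "Poly_Mapping.keys p \<union> Poly_Mapping.keys q \<union> Poly_Mapping.keys (p + q)"
  show "lin_ext f (p + q) = lin_ext f p + lin_ext f q"
    by (simp add: lin_ext_superset[of ?A] lookup_add cvs.scale_left_distrib sum.distrib le_supI1)
next
  fix c and p :: "'a \<Rightarrow>\<^sub>0 complex"
  let ?A = "Poly_Mapping.keys p \<union> Poly_Mapping.keys (c *\<^sub>C p)"
  show "lin_ext f (c *\<^sub>C p) = c *\<^sub>C lin_ext f p"
    by (simp add: lin_ext_superset[of ?A] cvs.scale_sum_right cscale_complex_def)
qed

lemma lin_ext_single [simp]: "lin_ext f (Poly_Mapping.single k c) = c *\<^sub>C f k"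
  by (cases "c = 0") (simp_all add: lin_ext_def)

lemma poly_mapping_expand:
  "p = (\<Sum>k\<in>Poly_Mapping.keys p. Poly_Mapping.lookup p k *\<^sub>C Poly_Mapping.single k (1::complex))"
proof (rule poly_mapping_eqI)
  fix k
  show "Poly_Mapping.lookup p k = Poly_Mapping.lookup (\<Sum>k\<in>Poly_Mapping.keys p.
      Poly_Mapping.lookup p k *\<^sub>C Poly_Mapping.single k (1::complex)) k"
    by (simp add: lookup_sum lookup_single cscale_complex_def when_def if_distrib
      sum.delta in_keys_iff cong: if_cong)
qed

lemma free_induct [case_names single add scale]:
  assumes "\<And>k. P (Poly_Mapping.single k (1::complex))"
    and "\<And>p q. P p \<Longrightarrow> P q \<Longrightarrow> P (p + q)" "\<And>c p. P p \<Longrightarrow> P (c *\<^sub>C p)"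
  shows "P p"
proof -
  have z: "P 0"
    using assms(3)[OF assms(1), of 0 undefined] by simp
  have "P (\<Sum>k\<in>A. Poly_Mapping.lookup p k *\<^sub>C Poly_Mapping.single k (1::complex))" if "finite A" for A
    using that by induction (simp_all add: assms(1) assms(2) z assms(3)[OF assms(1)])
  then show ?thesis
    using poly_mapping_expand[of p] by (metis finite_keys)
qed

lemma clin_eq_free:
  fixes p :: "'k \<Rightarrow>\<^sub>0 complex"
  assumes "clin f" "clin g" "\<And>k. f (Poly_Mapping.single k 1) = g (Poly_Mapping.single k 1)"
  shows "f p = g p"
  by (induction p rule: free_induct) (simp_all add: assms clin_add[OF assms(1)] clin_add[OF assms(2)]
     clin_scale[OF assms(1)] clin_scale[OF assms(2)])

section \<open>The Heisenberg action on \<open>M(1)\<close>\<close>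

lemma clin_act: "clin (act x)"
proof (rule clinI)
  fix c and v w :: "'a boson"
  show "act x (v + w) = act x v + act x w"
    by transfer (simp add: clin_add[OF clin_lmult] cvs.span_zero)
  show "act x (c *\<^sub>C v) = c *\<^sub>C act x v"
    by transfer (simp add: clin_scale[OF clin_lmult] cvs.span_zero)
qed

lift_definition wordv :: "'h::quad_space heis list \<Rightarrow> 'h boson" is word .

lemma wordv_Nil [simp]: "wordv [] = vac"
  by transfer (simp add: cvs.span_zero)

lemma wordv_Cons [simp]: "wordv (x # u) = act x (wordv u)"
  by transfer (simp add: cvs.span_zero)

lemma boson_word_induct [case_names word add scale]:
  assumes "\<And>u. P (wordv u)"
    and "\<And>v w. P v \<Longrightarrow> P w \<Longrightarrow> P (v + w)" "\<And>c v. P v \<Longrightarrow> P (c *\<^sub>C v)"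
  shows "P v"
proof -
  have "P (abs_boson p)" for p
  proof (induction p rule: free_induct)
    case (single k)
    then show ?case using assms(1)[of k] by (simp add: wordv.abs_eq)
  next
    case (add p q)
    then show ?case using assms(2) by (metis plus_boson.abs_eq)
  next
    case (scale c p)
    then show ?case using assms(3) by (metis cscale_boson.abs_eq)
  qed
  then show ?thesis
    by (rule boson.abs_induct)
qed

lemma boson_act_induct [case_names vac add scale act]:
  assumes "P vac"
    and "\<And>v w. P v \<Longrightarrow> P w \<Longrightarrow> P (v + w)" "\<And>c v. P v \<Longrightarrow> P (c *\<^sub>C v)"
    and "\<And>x v. P v \<Longrightarrow> P (act x v)"
  shows "P v"
proof (induction v rule: boson_word_induct)
  case (word u)
  show ?case by (induction u) (simp_all only: wordv_Nil wordv_Cons assms(1) assms(4))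
next
  case (add v w)
  then show ?case by (rule assms(2))
next
  case (scale c v)
  then show ?case by (rule assms(3))
qed

lemma clin_eq_boson_word:
  assumes "clin f" "clin g" "\<And>u. f (wordv u) = g (wordv u)"
  shows "f v = g v"
  by (induction v rule: boson_word_induct) (simp_all add: assms clin_add[OF assms(1)]
     clin_add[OF assms(2)] clin_scale[OF assms(1)] clin_scale[OF assms(2)])

lemma clin_add_fun: "clin f \<Longrightarrow> clin g \<Longrightarrow> clin (\<lambda>x. f x + g x)"
  by (rule clinI) (simp_all add: clin_add clin_scale cvs.scale_right_distrib)

lemma clin_diff_fun: "clin f \<Longrightarrow> clin g \<Longrightarrow> clin (\<lambda>x. f x - g x)"
  by (rule clinI) (simp_all add: clin_add clin_scale cvs.scale_right_diff_distrib)

lemma clin_scale_fun: "clin f \<Longrightarrow> clin (\<lambda>x. c *\<^sub>C f x)"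
  by (rule clinI) (simp_all add: clin_add clin_scale cvs.scale_right_distrib mult.commute)

lemma clin_zero_fun: "clin (\<lambda>x. 0)"
  by (rule clinI) simp_all

lemma clin_sum_fun: "(\<And>i. i \<in> A \<Longrightarrow> clin (f i)) \<Longrightarrow> clin (\<lambda>x. \<Sum>i\<in>A. f i x)"
  by (induction A rule: infinite_finite_induct) (auto intro: clin_zero_fun clin_add_fun)

lemma relation_add: "word (u @ (x + y) # w) - word (u @ x # w) - word (u @ y # w) \<in> cvs.span induced_relations"
  by (rule cvs.span_base) (unfold induced_relations_def, blast)

lemma relation_scale: "word (u @ (c *\<^sub>C x) # w) - c *\<^sub>C word (u @ x # w) \<in> cvs.span induced_relations"
  by (rule cvs.span_base) (unfold induced_relations_def, blast)

lemma relation_bracket: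
  "word (u @ x # y # w) - word (u @ y # x # w) - word (u @ heis_bracket x y # w) \<in> cvs.span induced_relations"
  by (rule cvs.span_base) (unfold induced_relations_def, blast)

lemma relation_nonneg:
  "b \<in> heis_nonneg \<Longrightarrow> word (u @ [b]) - snd b *\<^sub>C word u \<in> cvs.span induced_relations"
  by (rule cvs.span_base) (unfold induced_relations_def, blast)

lemma act_add_left: "act (x + y) v = act x v + act y v"
proof (rule clin_eq_boson_word[of "act (x + y)" "\<lambda>v. act x v + act y v"])
  fix u
  show "act (x + y) (wordv u) = act x (wordv u) + act y (wordv u)"
    by transfer (use relation_add[of "[]"] in \<open>simp add: diff_diff_add\<close>)
qed (intro clin_act clin_add_fun)+

lemma act_scale_left: "act (c *\<^sub>C x) v = c *\<^sub>C act x v"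
proof (rule clin_eq_boson_word[of "act (c *\<^sub>C x)" "\<lambda>v. c *\<^sub>C act x v"])
  fix u
  show "act (c *\<^sub>C x) (wordv u) = c *\<^sub>C act x (wordv u)"
    by transfer (use relation_scale[of "[]"] in \<open>simp\<close>)
qed (intro clin_act clin_scale_fun)+

lemma act_bracket: "act x (act y v) = act y (act x v) + act (heis_bracket x y) v"
proof (rule clin_eq_boson_word[of "\<lambda>v. act x (act y v)" "\<lambda>v. act y (act x v) + act (heis_bracket x y) v"])
  fix u
  show "act x (act y (wordv u)) = act y (act x (wordv u)) + act (heis_bracket x y) (wordv u)"
    by transfer (use relation_bracket[of "[]"] in \<open>simp add: diff_diff_add\<close>)
qed (intro clin_act clin_add_fun clin_compose[of "act _"])+

lemma act_nonneg_vac: "b \<in> heis_nonneg \<Longrightarrow> act b vac = snd b *\<^sub>C vac"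
  by transfer (use relation_nonneg[of _ "[]"] in simp)

lemma act_zero_left: "act 0 v = 0"
  using act_add_left[of 0 0 v] by simp

text \<open>K commutes with every letter, so the value 1 prescribed on \<open>vac\<close> propagates
  to the whole module.\<close>

lemma act_central: "act (0, k) v = k *\<^sub>C v"
proof (induction v rule: boson_act_induct)
  case vac
  show ?case using act_nonneg_vac[of "(0, k)"] by (simp add: heis_nonneg_def)
next
  case (act x v)
  then show ?case
    using act_bracket[of "(0, k)" x v]
    by (simp add: heis_bracket_def act_zero_left clin_scale[OF clin_act] zero_prod_def[symmetric])
qed (simp_all add: clin_add[OF clin_act] clin_scale[OF clin_act] cvs.scale_right_distrib mult.commute)

section \<open>Modes\<close>

lemma clin_hmode: "clin (hmode h n)"
  unfolding hmode_def by (rule clin_act)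

lemmas hmode_add = clin_add[OF clin_hmode]
  and hmode_scale = clin_scale[OF clin_hmode]
  and hmode_zero = clin_zero[OF clin_hmode]
  and hmode_diff = clin_diff[OF clin_hmode]
  and hmode_sum = clin_sum[OF clin_hmode]

lemma hmode_add_left: "hmode (x + y) n v = hmode x n v + hmode y n v"
  unfolding hmode_def act_add_left[symmetric] by (simp add: loop_def single_add)

lemma hmode_scale_left: "hmode (c *\<^sub>C x) n v = c *\<^sub>C hmode x n v"
proof -
  have "Poly_Mapping.single n (c *\<^sub>C x) = c *\<^sub>C Poly_Mapping.single n x"
    by (rule poly_mapping_eqI) (simp add: lookup_single when_def)
  then show ?thesis
    unfolding hmode_def act_scale_left[symmetric] by (simp add: loop_def cscale_prod_def)
qed

lemma heis_bracket_loop: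
  "heis_bracket (loop h m) (loop h' n) = (0, if m + n = 0 then of_int m * form h h' else 0)"
proof -
  have z: "form 0 h' = 0" "form h 0 = 0" for h h' :: 'a
    using form_scale[of 0 h h'] form_scale[of 0 h' h] form_sym[of h 0] by simp_all
  show ?thesis
    by (cases "h = 0") (auto simp: heis_bracket_def loop_def z lookup_single when_def)
qed

lemma hmode_commute:
  "hmode h m (hmode h' n v) =
     hmode h' n (hmode h m v) + (if m + n = 0 then of_int m * form h h' else 0) *\<^sub>C v"
  unfolding hmode_def using act_bracket[of "loop h m" "loop h' n" v]
  by (simp add: heis_bracket_loop act_central)

lemma hmode_commute': "m + n \<noteq> 0 \<or> m = 0 \<Longrightarrow> hmode h m (hmode h' n v) = hmode h' n (hmode h m v)"
  using hmode_commute[of h m h' n v] by auto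

lemma hmode_nonneg_vac: "n \<ge> 0 \<Longrightarrow> hmode h n vac = 0"
  unfolding hmode_def using act_nonneg_vac[of "loop h n"]
  by (simp add: loop_def heis_nonneg_def)

lemma act_expand:
  "act x v = (\<Sum>n\<in>Poly_Mapping.keys (fst x). hmode (Poly_Mapping.lookup (fst x) n) n v) + snd x *\<^sub>C v"
proof -
  have *: "act (f, 0) v = (\<Sum>n\<in>Poly_Mapping.keys f. hmode (Poly_Mapping.lookup f n) n v)" for f :: "int \<Rightarrow>\<^sub>0 'a"
  proof -
    have "act ((\<Sum>n\<in>A. Poly_Mapping.single n (Poly_Mapping.lookup f n)), 0) v
        = (\<Sum>n\<in>A. hmode (Poly_Mapping.lookup f n) n v)" if "finite A" for A
      using that
    proof induction
      case empty
      then show ?case by (simp add: act_zero_left zero_prod_def[symmetric])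
    next
      case (insert n A)
      then show ?case
        using act_add_left[of "(Poly_Mapping.single n (Poly_Mapping.lookup f n), 0)"
            "(\<Sum>n\<in>A. Poly_Mapping.single n (Poly_Mapping.lookup f n), 0)" v]
        by (simp add: hmode_def loop_def)
    qed
    moreover have "(\<Sum>n\<in>Poly_Mapping.keys f. Poly_Mapping.single n (Poly_Mapping.lookup f n)) = f"
      by (rule poly_mapping_eqI) (simp add: lookup_sum lookup_single when_def sum.delta in_keys_iff)
    ultimately show ?thesis by (metis finite_keys)
  qed
  show ?thesis
    using act_add_left[of "(fst x, 0)" "(0, snd x)" v] by (simp add: * act_central)
qed

lemma boson_hmode_induct [case_names vac add scale hmode]:
  assumes "P vac"
    and "\<And>v w. P v \<Longrightarrow> P w \<Longrightarrow> P (v + w)" "\<And>c v. P v \<Longrightarrow> P (c *\<^sub>C v)"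
    and "\<And>h n v. P v \<Longrightarrow> P (hmode h n v)"
  shows "P v"
proof (induction v rule: boson_act_induct)
  case (act x v)
  have z: "P 0"
    using assms(3)[OF assms(1), of 0] by simp
  have "P (\<Sum>n\<in>A. hmode (Poly_Mapping.lookup (fst x) n) n v)" if "finite A" for A
    using that by induction (simp_all add: assms(2) z assms(4)[OF act])
  then show ?case unfolding act_expand[of x v] by (intro assms(2,3) act) auto
next
  case vac
  show ?case by (rule assms(1))
next
  case (add v w)
  then show ?case by (rule assms(2))
next
  case (scale c v)
  then show ?case by (rule assms(3))
qed

section \<open>Fock vectors\<close>

lemma admissible_Nil [simp]: "admissible []"
  and admissible_Cons [simp]: "admissible ((h, n) # xs) \<longleftrightarrow> n \<ge> 1 \<and> admissible xs"
  and admissible_append [simp]: "admissible (xs @ ys) \<longleftrightarrow> admissible xs \<and> admissible ys"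
  by (auto simp: admissible_def)

lemma fock_Nil [simp]: "fock [] = vac"
  and fock_Cons [simp]: "fock ((h, n) # xs) = hmode h (- int n) (fock xs)"
  by (simp_all add: fock_def)

definition fock_vectors :: "'h::quad_space boson set" where
  "fock_vectors = {fock xs | xs. admissible xs}"

text \<open>The spanning half of a PBW theorem: an annihilation mode moves to the right past the
  creation modes, each commutator is a scalar, and at the end it kills \<open>vac\<close>.\<close>

lemma hmode_fock_span:
  assumes "admissible xs"
  shows "hmode h m (fock xs) \<in> cvs.span fock_vectors"
proof (cases "m < 0")
  case True
  then have "hmode h m (fock xs) = fock ((h, nat (- m)) # xs)" by simp
  moreover have "admissible ((h, nat (- m)) # xs)" using True assms by simp
  ultimately show ?thesis unfolding fock_vectors_def by (blast intro: cvs.span_base)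
next
  case False
  show ?thesis using assms
  proof (induction xs)
    case Nil
    then show ?case using False by (simp add: hmode_nonneg_vac cvs.span_zero)
  next
    case (Cons x xs)
    obtain h' n where x: "x = (h', n)" by force
    have 1: "fock xs \<in> cvs.span fock_vectors"
      using Cons x by (auto simp: fock_vectors_def intro: cvs.span_base)
    have "hmode h' (- int n) v \<in> cvs.span fock_vectors" if "v \<in> cvs.span fock_vectors" for v
    proof (rule span_image_subset[OF clin_hmode _ that], clarify)
      fix v :: "'a boson" assume "v \<in> fock_vectors"
      then obtain ys where "v = fock ys" "admissible ys" unfolding fock_vectors_def by blast
      then have "hmode h' (- int n) v = fock ((h', n) # ys)" "admissible ((h', n) # ys)"
        using Cons.prems x by simp_all
      then show "hmode h' (- int n) v \<in> cvs.span fock_vectors"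
        unfolding fock_vectors_def by (blast intro: cvs.span_base)
    qed
    with Cons 1 show ?case
      unfolding x fock_Cons hmode_commute[of h m] by (auto intro!: cvs.span_add cvs.span_scale simp: x)
  qed
qed

lemma fock_span: "v \<in> cvs.span fock_vectors"
proof (induction v rule: boson_hmode_induct)
  case vac
  have "fock [] \<in> fock_vectors" unfolding fock_vectors_def using admissible_Nil by blast
  then show ?case by (auto intro: cvs.span_base)
next
  case (hmode h n v)
  show ?case
    by (rule span_image_subset[OF clin_hmode _ hmode]) (auto simp: fock_vectors_def hmode_fock_span[unfolded fock_vectors_def])
qed (auto intro: cvs.span_add cvs.span_scale)

lemma boson_induct [case_names vac add scale hmode]:
  assumes "P vac"
    and "\<And>v w. P v \<Longrightarrow> P w \<Longrightarrow> P (v + w)" "\<And>c v. P v \<Longrightarrow> P (c *\<^sub>C v)"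
    and "\<And>h n v. n \<ge> 1 \<Longrightarrow> P v \<Longrightarrow> P (hmode h (- int n) v)"
  shows "P v"
proof -
  have *: "P (fock xs)" if "admissible xs" for xs
    using that by (induction xs) (auto simp: assms(1) intro!: assms(4))
  show ?thesis
    using fock_span[of v]
  proof (induction rule: cvs.span_induct_alt)
    case base
    then show ?case using assms(3)[OF assms(1), of 0] by simp
  next
    case (step c x y)
    then show ?case using * by (auto simp: fock_vectors_def intro!: assms(2,3))
  qed
qed

text \<open>The bracket of h(m) carries the factor m, so h(0) commutes with all modes, and it kills
  \<open>vac\<close>.\<close>

lemma hmode_0: "hmode h 0 v = 0"
  by (induction v rule: boson_induct)
     (simp_all add: hmode_nonneg_vac hmode_add hmode_scale hmode_commute[of h 0] hmode_zero)

lemma boson_fock_induct [case_names fock add scale]: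
  assumes "\<And>xs. admissible xs \<Longrightarrow> P (fock xs)"
    and "\<And>v w. P v \<Longrightarrow> P w \<Longrightarrow> P (v + w)" "\<And>c v. P v \<Longrightarrow> P (c *\<^sub>C v)"
  shows "P v"
  using fock_span[of v]
proof (induction rule: cvs.span_induct_alt)
  case base
  show ?case using assms(3)[OF assms(1)[OF admissible_Nil], of 0] by simp
next
  case (step c x y)
  then show ?case using assms(1) by (auto simp: fock_vectors_def intro!: assms(2,3))
qed

lemma clin_eq_fock:
  assumes "clin f" "clin g" "\<And>xs. admissible xs \<Longrightarrow> f (fock xs) = g (fock xs)"
  shows "f v = g v"
  using clin_eq_zero_on_span[OF clin_diff_fun[OF assms(1,2)] _ fock_span, of v] assms(3)
  by (auto simp: fock_vectors_def)

section \<open>The polynomial model\<close>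

text \<open>
  Polynomials in the variables \<open>x\<^bsub>b,n\<^esub>\<close>, for \<open>b\<close> in a basis of \<open>\<hh>\<close> and \<open>n \<ge> 1\<close>, with the
  monomials encoded as multisets of the pairs \<open>(b, n)\<close>.
\<close>

definition hbasis :: "'h::quad_space set" where
  "hbasis = (SOME B. cvs.independent B \<and> cvs.span B = UNIV)"

lemma hbasis: "cvs.independent (hbasis :: 'h::quad_space set)" "cvs.span (hbasis :: 'h set) = UNIV"
proof -
  obtain B where "B \<subseteq> UNIV" "cvs.independent B" "(UNIV :: 'h set) \<subseteq> cvs.span B" "card B = cvs.dim (UNIV :: 'h set)"
    by (rule cvs.basis_exists)
  then have "\<exists>B :: 'h set. cvs.independent B \<and> cvs.span B = UNIV" by blast
  then have "cvs.independent (hbasis :: 'h set) \<and> cvs.span (hbasis :: 'h set) = UNIV"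
    unfolding hbasis_def by (rule someI_ex)
  then show "cvs.independent (hbasis :: 'h set)" "cvs.span (hbasis :: 'h set) = UNIV" by auto
qed

lemma finite_hbasis [simp]: "finite (hbasis :: 'h::quad_space set)"
proof -
  obtain B :: "'h set" where B: "finite B" "\<forall>x. \<exists>c. x = (\<Sum>b\<in>B. cscale (c b) b)"
    using finite_dimensional by blast
  have "x \<in> cvs.span B" for x :: 'h
  proof -
    obtain c where c: "x = (\<Sum>b\<in>B. cscale (c b) b)" using B(2) by blast
    show ?thesis unfolding c by (intro cvs.span_sum cvs.span_scale cvs.span_base)
  qed
  then show ?thesis
    using cvs.independent_span_bound[OF B(1) hbasis(1)] by blast
qed

lemma card_hbasis: "card (hbasis :: 'h::quad_space set) = cvs.dim (UNIV :: 'h set)"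
  using cvs.dim_eq_card_independent[OF hbasis(1)] cvs.dim_span[of "hbasis :: 'h set"] hbasis(2) by metis

definition coord :: "'h::quad_space \<Rightarrow> 'h \<Rightarrow> complex" where
  "coord = cvs.representation hbasis"

lemma coord_add: "coord (x + y) b = coord x b + coord y b"
  unfolding coord_def by (simp add: cvs.representation_add hbasis)

lemma coord_scale: "coord (c *\<^sub>C x) b = c * coord x b"
  unfolding coord_def by (simp add: cvs.representation_scale hbasis)

lemma coord_basis: "b \<in> hbasis \<Longrightarrow> coord b b' = (if b' = b then 1 else 0)"
  unfolding coord_def by (auto simp add: cvs.representation_basis hbasis)

lemma coord_expand: "(\<Sum>b\<in>hbasis. coord x b *\<^sub>C b) = x"
  unfolding coord_def using cvs.sum_representation_eq[OF hbasis(1), of x hbasis] hbasis(2) finite_hbasis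
  by auto

lemma form_zero [simp]: "form 0 y = 0" "form x 0 = 0"
  using form_scale[of 0 0 y] form_scale[of 0 0 x] form_sym[of x 0] by simp_all

lemma form_add_right: "form z (x + y) = form z x + form z y"
  by (metis form_add form_sym)

lemma form_scale_right: "form y (c *\<^sub>C x) = c * form y x"
  by (metis form_scale form_sym)

lemma form_coord: "(\<Sum>b\<in>hbasis. form h b * coord h' b) = form h h'"
proof -
  have "form h (\<Sum>b\<in>A. coord h' b *\<^sub>C b) = (\<Sum>b\<in>A. form h b * coord h' b)" for A
    by (induction A rule: infinite_finite_induct) (simp_all add: form_add_right form_scale_right)
  then show ?thesis by (metis coord_expand)
qed

type_synonym 'h model = "('h \<times> nat) multiset \<Rightarrow>\<^sub>0 complex"

abbreviation xmon :: "'k multiset \<Rightarrow> ('k multiset \<Rightarrow>\<^sub>0 complex)" where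
  "xmon M \<equiv> Poly_Mapping.single M 1"

definition model_X :: "'k \<Rightarrow> ('k multiset \<Rightarrow>\<^sub>0 complex) \<Rightarrow> ('k multiset \<Rightarrow>\<^sub>0 complex)" where
  "model_X i = lin_ext (\<lambda>M. xmon (add_mset i M))"

definition model_D :: "'k \<Rightarrow> ('k multiset \<Rightarrow>\<^sub>0 complex) \<Rightarrow> ('k multiset \<Rightarrow>\<^sub>0 complex)" where
  "model_D i = lin_ext (\<lambda>M. of_nat (count M i) *\<^sub>C xmon (M - {#i#}))"

lemma clin_model_X: "clin (model_X i)" and clin_model_D: "clin (model_D i)"
  unfolding model_X_def model_D_def by (rule clin_lin_ext)+

lemmas model_X_lin = clin_add[OF clin_model_X] clin_scale[OF clin_model_X] clin_sum[OF clin_model_X]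
lemmas model_D_lin = clin_add[OF clin_model_D] clin_scale[OF clin_model_D] clin_sum[OF clin_model_D]

lemma model_X_mono [simp]: "model_X i (xmon M) = xmon (add_mset i M)"
  by (simp add: model_X_def)

lemma model_D_mono [simp]: "model_D i (xmon M) = of_nat (count M i) *\<^sub>C xmon (M - {#i#})"
  by (simp add: model_D_def)

lemma model_D_one [simp]: "model_D i 1 = 0"
  using model_D_mono[of i "{#}"] by simp

lemma model_X_commute: "model_X i (model_X j p) = model_X j (model_X i p)"
  by (rule clin_eq_free[of "\<lambda>p. model_X i (model_X j p)" "\<lambda>p. model_X j (model_X i p)"])
     (auto intro!: clin_compose[of "model_X _"] clin_model_X simp: add_mset_commute)

lemma model_D_commute: "model_D i (model_D j p) = model_D j (model_D i p)"
proof (rule clin_eq_free[of "\<lambda>p. model_D i (model_D j p)" "\<lambda>p. model_D j (model_D i p)"])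
  fix M
  show "model_D i (model_D j (xmon M)) = model_D j (model_D i (xmon M))"
    by (cases "i = j") (simp_all add: model_D_lin cvs.scale_scale mult.commute add_mset_commute)
qed (auto intro!: clin_compose[of "model_D _"] clin_model_D)

lemma model_D_X: "model_D i (model_X j p) = model_X j (model_D i p) + (if i = j then p else 0)"
proof (rule clin_eq_free[of "\<lambda>p. model_D i (model_X j p)"
      "\<lambda>p. model_X j (model_D i p) + (if i = j then p else 0)"])
  fix M
  show "model_D i (model_X j (xmon M)) = model_X j (model_D i (xmon M)) + (if i = j then xmon M else 0)"
  proof (cases "i = j")
    case True
    then show ?thesis
      by (cases "j \<in># M")
        (simp_all add: model_X_lin cvs.scale_left_distrib add.commute not_in_iff clin_zero[OF clin_model_X])
  next
    case False
    then show ?thesis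
      by (cases "i \<in># M") (simp_all add: model_X_lin not_in_iff clin_zero[OF clin_model_X])
  qed
next
  show "clin (\<lambda>p. model_D i (model_X j p))"
    by (rule clin_compose[OF clin_model_D clin_model_X])
  show "clin (\<lambda>p. model_X j (model_D i p) + (if i = j then p else 0))"
    by (cases "i = j") (simp_all add: clin_add_fun clin_compose[OF clin_model_X clin_model_D] clin_id)
qed

text \<open>Creation modes use the coordinates of h and annihilation modes its pairings with the
  basis vectors. By \<open>form_coord\<close> these two families are dual to each other for any
  basis, which yields the commutator m (h, h').\<close>

definition model_mode :: "'h::quad_space \<Rightarrow> int \<Rightarrow> 'h model \<Rightarrow> 'h model" where
  "model_mode h n p =
     (if n < 0 then \<Sum>b\<in>hbasis. coord h b *\<^sub>C model_X (b, nat (- n)) p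
      else \<Sum>b\<in>hbasis. (of_int n * form h b) *\<^sub>C model_D (b, nat n) p)"

lemma clin_model_mode: "clin (model_mode h n)"
  unfolding model_mode_def
  by (cases "n < 0")
     (auto intro!: clin_sum_fun clin_scale_fun clin_model_X clin_model_D)

lemmas model_mode_lin = clin_add[OF clin_model_mode] clin_scale[OF clin_model_mode]
  clin_sum[OF clin_model_mode]

lemma model_mode_add_left: "model_mode (x + y) n p = model_mode x n p + model_mode y n p"
  by (simp add: model_mode_def coord_add form_add distrib_left cvs.scale_left_distrib sum.distrib)

lemma model_mode_scale_left: "model_mode (c *\<^sub>C x) n p = c *\<^sub>C model_mode x n p"
  by (simp add: model_mode_def coord_scale form_scale cvs.scale_sum_right mult.left_commute)

lemma model_mode_zero_left [simp]: "model_mode 0 n p = 0"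
  using model_mode_scale_left[of 0 0 n p] by simp

lemma model_mode_commute_aux:
  assumes "m \<ge> 0" "n < 0"
  shows "model_mode h m (model_mode h' n p) =
     model_mode h' n (model_mode h m p) + (if m + n = 0 then of_int m * form h h' else 0) *\<^sub>C p"
proof -
  have eq: "((b, nat m) = (b', nat (- n))) \<longleftrightarrow> b = b' \<and> m + n = 0" for b b' :: 'a
    using assms by auto
  have "model_mode h m (model_mode h' n p) = (\<Sum>b\<in>hbasis. \<Sum>b'\<in>hbasis.
      (of_int m * form h b * coord h' b') *\<^sub>C model_D (b, nat m) (model_X (b', nat (- n)) p))"
    using assms by (simp add: model_mode_def model_D_lin cvs.scale_sum_right)
  also have "\<dots> = (\<Sum>b\<in>hbasis. \<Sum>b'\<in>hbasis.
      (of_int m * form h b * coord h' b') *\<^sub>C model_X (b', nat (- n)) (model_D (b, nat m) p)) +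
      (\<Sum>b\<in>hbasis. \<Sum>b'\<in>hbasis. (of_int m * form h b * coord h' b') *\<^sub>C (if b = b' \<and> m + n = 0 then p else 0))"
    unfolding model_D_X eq cvs.scale_right_distrib sum.distrib ..
  also have "(\<Sum>b\<in>hbasis. \<Sum>b'\<in>hbasis. (of_int m * form h b * coord h' b') *\<^sub>C (if b = b' \<and> m + n = 0 then p else 0))
     = (\<Sum>b\<in>hbasis. (if m + n = 0 then (of_int m * (form h b * coord h' b)) *\<^sub>C p else 0))"
  proof (rule sum.cong[OF refl])
    fix b :: 'a assume b: "b \<in> hbasis"
    have "(\<Sum>b'\<in>hbasis. (of_int m * form h b * coord h' b') *\<^sub>C (if b = b' \<and> m + n = 0 then p else 0))
       = (\<Sum>b'\<in>hbasis. if b = b' then (of_int m * form h b * coord h' b') *\<^sub>C (if m + n = 0 then p else 0) else 0)"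
      by (intro sum.cong) auto
    then show "(\<Sum>b'\<in>hbasis. (of_int m * form h b * coord h' b') *\<^sub>C (if b = b' \<and> m + n = 0 then p else 0))
      = (if m + n = 0 then (of_int m * (form h b * coord h' b)) *\<^sub>C p else 0)"
      using b finite_hbasis by (simp add: sum.delta' mult.assoc)
  qed
  also have "\<dots> = (if m + n = 0 then of_int m * form h h' else 0) *\<^sub>C p"
    by (simp add: cvs.scale_sum_left[symmetric] sum_distrib_left[symmetric] form_coord)
  also have "(\<Sum>b\<in>hbasis. \<Sum>b'\<in>hbasis.
      (of_int m * form h b * coord h' b') *\<^sub>C model_X (b', nat (- n)) (model_D (b, nat m) p))
      = model_mode h' n (model_mode h m p)"
    using assms by (subst sum.swap) (simp add: model_mode_def model_X_lin cvs.scale_sum_right mult_ac)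
  finally show ?thesis .
qed

lemma model_mode_commute:
  "model_mode h m (model_mode h' n p) =
     model_mode h' n (model_mode h m p) + (if m + n = 0 then of_int m * form h h' else 0) *\<^sub>C p"
proof -
  consider "m \<ge> 0" "n < 0" | "m < 0" "n \<ge> 0" | "m < 0" "n < 0" | "m \<ge> 0" "n \<ge> 0" by linarith
  then show ?thesis
  proof cases
    case 1
    then show ?thesis by (rule model_mode_commute_aux)
  next
    case 2
    have n: "n = - m" if "m + n = 0" using that by simp
    show ?thesis
      using model_mode_commute_aux[OF 2(2,1), of h' h p]
      by (auto simp: form_sym[of h' h] add.commute[of n m] dest!: n)
  next
    case 3
    then have "model_mode h m (model_mode h' n p) = (\<Sum>b\<in>hbasis. \<Sum>b'\<in>hbasis.
      (coord h b * coord h' b') *\<^sub>C model_X (b, nat (- m)) (model_X (b', nat (- n)) p))"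
      by (simp add: model_mode_def model_X_lin cvs.scale_sum_right)
    also have "\<dots> = model_mode h' n (model_mode h m p)"
      using 3 by (subst sum.swap) (simp add: model_mode_def model_X_lin cvs.scale_sum_right
        mult.commute model_X_commute)
    finally show ?thesis using 3 by simp
  next
    case 4
    then have "model_mode h m (model_mode h' n p) = (\<Sum>b\<in>hbasis. \<Sum>b'\<in>hbasis.
      (of_int m * form h b * (of_int n * form h' b')) *\<^sub>C model_D (b, nat m) (model_D (b', nat n) p))"
      by (simp add: model_mode_def model_D_lin cvs.scale_sum_right)
    also have "\<dots> = (\<Sum>b'\<in>hbasis. \<Sum>b\<in>hbasis.
      (of_int n * form h' b' * (of_int m * form h b)) *\<^sub>C model_D (b', nat n) (model_D (b, nat m) p))"
      by (subst sum.swap) (simp add: mult.commute mult.left_commute model_D_commute)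
    also have "\<dots> = model_mode h' n (model_mode h m p)"
      using 4 by (simp add: model_mode_def model_D_lin cvs.scale_sum_right)
    finally show ?thesis using 4 by auto
  qed
qed

definition model_act :: "'h::quad_space heis \<Rightarrow> 'h model \<Rightarrow> 'h model" where
  "model_act x p =
     (\<Sum>n\<in>Poly_Mapping.keys (fst x). model_mode (Poly_Mapping.lookup (fst x) n) n p) + snd x *\<^sub>C p"

lemma model_act_superset:
  assumes "finite A" "Poly_Mapping.keys (fst x) \<subseteq> A"
  shows "model_act x p = (\<Sum>n\<in>A. model_mode (Poly_Mapping.lookup (fst x) n) n p) + snd x *\<^sub>C p"
  unfolding model_act_def
  by (intro arg_cong2[of _ _ _ _ "(+)"] sum.mono_neutral_left refl)
     (use assms in \<open>auto simp: in_keys_iff\<close>)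

lemma clin_model_act: "clin (model_act x)"
  unfolding model_act_def by (intro clin_add_fun clin_sum_fun clin_scale_fun clin_model_mode clin_id)

lemma model_act_add_left: "model_act (x + y) p = model_act x p + model_act y p"
proof -
  let ?A = "Poly_Mapping.keys (fst x) \<union> Poly_Mapping.keys (fst y) \<union> Poly_Mapping.keys (fst (x + y))"
  show ?thesis
    by (simp add: model_act_superset[of ?A] lookup_add model_mode_add_left sum.distrib
      cvs.scale_left_distrib le_supI1 add_ac)
qed

lemma model_act_scale_left: "model_act (c *\<^sub>C x) p = c *\<^sub>C model_act x p"
proof -
  let ?A = "Poly_Mapping.keys (fst x) \<union> Poly_Mapping.keys (fst (c *\<^sub>C x))"
  show ?thesis
    by (simp add: model_act_superset[of ?A] model_mode_scale_left cscale_prod_def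
      cvs.scale_sum_right cvs.scale_right_distrib cscale_complex_def)
qed

lemma model_act_bracket:
  "model_act x (model_act y p) = model_act y (model_act x p) + model_act (heis_bracket x y) p"
proof -
  let ?K = "Poly_Mapping.keys (fst x)" and ?L = "Poly_Mapping.keys (fst y)"
  let ?f = "\<lambda>m. Poly_Mapping.lookup (fst x) m" and ?g = "\<lambda>n. Poly_Mapping.lookup (fst y) n"
  have 1: "model_act x (model_act y p) = (\<Sum>m\<in>?K. \<Sum>n\<in>?L. model_mode (?f m) m (model_mode (?g n) n p)) +
     snd y *\<^sub>C (\<Sum>m\<in>?K. model_mode (?f m) m p) + snd x *\<^sub>C (\<Sum>n\<in>?L. model_mode (?g n) n p) +
     (snd x * snd y) *\<^sub>C p"
    by (simp add: model_act_def model_mode_lin sum.distrib cvs.scale_right_distrib cvs.scale_sum_right add_ac)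
  have 2: "model_act y (model_act x p) = (\<Sum>n\<in>?L. \<Sum>m\<in>?K. model_mode (?g n) n (model_mode (?f m) m p)) +
     snd x *\<^sub>C (\<Sum>n\<in>?L. model_mode (?g n) n p) + snd y *\<^sub>C (\<Sum>m\<in>?K. model_mode (?f m) m p) +
     (snd y * snd x) *\<^sub>C p"
    by (simp add: model_act_def model_mode_lin sum.distrib cvs.scale_right_distrib cvs.scale_sum_right add_ac)
  have "(\<Sum>m\<in>?K. \<Sum>n\<in>?L. model_mode (?f m) m (model_mode (?g n) n p)) =
     (\<Sum>m\<in>?K. \<Sum>n\<in>?L. model_mode (?g n) n (model_mode (?f m) m p)) +
     (\<Sum>m\<in>?K. \<Sum>n\<in>?L. (if m + n = 0 then of_int m * form (?f m) (?g n) else 0) *\<^sub>C p)"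
    unfolding model_mode_commute[of "?f _" _ "?g _"] sum.distrib ..
  also have "(\<Sum>m\<in>?K. \<Sum>n\<in>?L. (if m + n = 0 then of_int m * form (?f m) (?g n) else 0) *\<^sub>C p) =
     (\<Sum>m\<in>?K. (of_int m * form (?f m) (?g (- m))) *\<^sub>C p)"
  proof (rule sum.cong[OF refl])
    fix m
    have "(\<Sum>n\<in>?L. (if m + n = 0 then of_int m * form (?f m) (?g n) else 0) *\<^sub>C p)
      = (\<Sum>n\<in>?L. if n = - m then (of_int m * form (?f m) (?g n)) *\<^sub>C p else 0)"
      by (intro sum.cong) auto
    also have "\<dots> = (of_int m * form (?f m) (?g (- m))) *\<^sub>C p"
      by (auto simp: sum.delta in_keys_iff)
    finally show "(\<Sum>n\<in>?L. (if m + n = 0 then of_int m * form (?f m) (?g n) else 0) *\<^sub>C p) = \<dots>" .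
  qed
  also have "\<dots> = model_act (heis_bracket x y) p"
    by (simp add: model_act_def heis_bracket_def cvs.scale_sum_left)
  finally show ?thesis
    unfolding 1 2 by (subst sum.swap[of _ ?K]) (simp add: mult.commute algebra_simps)
qed

lemma model_act_nonneg:
  assumes "b \<in> heis_nonneg"
  shows "model_act b (xmon {#}) = snd b *\<^sub>C xmon {#}"
proof -
  have "model_mode (Poly_Mapping.lookup (fst b) n) n (xmon {#}) = 0" if "n \<in> Poly_Mapping.keys (fst b)" for n
    using that assms by (auto simp: heis_nonneg_def model_mode_def)
  then show ?thesis by (simp add: model_act_def)
qed

definition model_word :: "'h::quad_space heis list \<Rightarrow> 'h model" where
  "model_word u = foldr model_act u (xmon {#})"

lemma clin_foldr_model_act: "clin (foldr model_act u)"
proof (induction u)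
  case Nil
  then show ?case by (simp add: clin_id id_def)
next
  case (Cons x u)
  then show ?case using clin_compose[OF clin_model_act[of x] Cons] by (simp add: comp_def)
qed

text \<open>Universal property of the induced module: the model satisfies the bracket relation and
  its vacuum has the prescribed character, so words may be evaluated in the model.\<close>

lemma model_word_relation:
  assumes "r \<in> induced_relations"
  shows "lin_ext model_word r = 0"
proof -
  note lin = clin_diff[OF clin_lin_ext] clin_scale[OF clin_lin_ext]
  note R = clin_diff[OF clin_foldr_model_act, symmetric] clin_scale[OF clin_foldr_model_act, symmetric]
    clin_zero[OF clin_foldr_model_act]
  from assms consider
      (add) u y z w where
        "r = word (u @ (y + z) # w) - word (u @ y # w) - word (u @ z # w)"
    | (scale) u c y w where
        "r = word (u @ (c *\<^sub>C y) # w) - c *\<^sub>C word (u @ y # w)"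
    | (bracket) u y z w where
        "r = word (u @ y # z # w) - word (u @ z # y # w) - word (u @ heis_bracket y z # w)"
    | (nonneg) u b where
        "r = word (u @ [b]) - snd b *\<^sub>C word u" "b \<in> heis_nonneg"
    unfolding induced_relations_def by blast
  then show ?thesis
  proof cases
    case bracket
    then show ?thesis
      using model_act_bracket[of y z "foldr model_act w (xmon {#})"]
      by (simp add: lin model_word_def R)
  next
    case add
    then show ?thesis
      by (simp add: lin model_word_def R model_act_add_left)
  next
    case scale
    then show ?thesis
      by (simp add: lin model_word_def R model_act_scale_left)
  next
    case nonneg
    then show ?thesis
      using model_act_nonneg[OF nonneg(2)] by (simp add: lin model_word_def R)
  qed
qed

lift_definition model_of :: "'h::quad_space boson \<Rightarrow> 'h model" is "lin_ext model_word"
proof -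
  fix p q :: "'h heis list \<Rightarrow>\<^sub>0 complex"
  assume "p - q \<in> cvs.span induced_relations"
  then have "lin_ext model_word (p - q) = 0"
    using clin_eq_zero_on_span[OF clin_lin_ext, of induced_relations model_word "p - q"]
      model_word_relation by blast
  then show "lin_ext model_word p = lin_ext model_word q"
    by (simp add: clin_diff[OF clin_lin_ext])
qed

lemma clin_model_of: "clin model_of"
  by (rule clinI; transfer) (simp_all add: clin_add[OF clin_lin_ext] clin_scale[OF clin_lin_ext])

lemma model_of_vac: "model_of vac = xmon {#}"
  by transfer (simp add: model_word_def)

lemma model_of_wordv: "model_of (wordv u) = model_word u"
  by transfer simp

lemma model_of_act: "model_of (act x v) = model_act x (model_of v)"
proof (rule clin_eq_boson_word[of "\<lambda>v. model_of (act x v)" "\<lambda>v. model_act x (model_of v)"])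
  fix u
  show "model_of (act x (wordv u)) = model_act x (model_of (wordv u))"
    using model_of_wordv[of "x # u"] by (simp add: model_of_wordv model_word_def)
qed (rule clin_compose[OF clin_model_of clin_act] clin_compose[OF clin_model_act clin_model_of])+

lemma model_of_hmode: "model_of (hmode h n v) = model_mode h n (model_of v)"
  by (cases "h = 0") (simp_all add: hmode_def model_of_act loop_def model_act_def)

text \<open>The independence half of PBW: Fock vectors over basis elements go to monomials, which
  are independent by construction.\<close>

lemma model_of_fock:
  "admissible xs \<Longrightarrow> fst ` set xs \<subseteq> hbasis \<Longrightarrow> model_of (fock xs) = xmon (mset xs)"
proof (induction xs)
  case Nil
  then show ?case by (simp add: model_of_vac)
next
  case (Cons x xs)
  obtain b n where x: "x = (b, n)" by force
  with Cons.prems have b: "b \<in> hbasis" "n \<ge> 1" by auto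
  have "model_of (fock (x # xs)) = model_mode b (- int n) (xmon (mset xs))"
    using Cons x by (simp add: model_of_hmode)
  also have "\<dots> = (\<Sum>b'\<in>hbasis. coord b b' *\<^sub>C xmon (add_mset (b', n) (mset xs)))"
    using b by (simp add: model_mode_def)
  also have "\<dots> = (\<Sum>b'\<in>hbasis. if b' = b then xmon (add_mset (b', n) (mset xs)) else 0)"
    by (intro sum.cong refl) (use b in \<open>simp add: coord_basis\<close>)
  finally show ?case using b finite_hbasis by (simp add: x sum.delta)
qed

section \<open>Linear maps defined on Fock vectors\<close>

text \<open>Adjacent transpositions at the head, together with congruence under \<open>Cons\<close>,
  generate all permutations. This serves both Fock vectors and normally ordered products.\<close>

lemma perm_invariant:
  assumes swap: "\<And>x y xs. F (x # y # xs) = F (y # x # xs)"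
    and cong: "\<And>x xs ys. F xs = F ys \<Longrightarrow> F (x # xs) = F (x # ys)"
    and "mset xs = mset ys"
  shows "F xs = F ys"
  using assms(3)
proof (induction xs arbitrary: ys)
  case (Cons x xs)
  have "x \<in> set ys" using Cons.prems by (metis list.set_intros(1) set_mset_mset)
  then obtain us vs where ys: "ys = us @ x # vs" by (meson split_list)
  have mv: "F (us @ x # vs) = F (x # us @ vs)" for us
  proof (induction us)
    case (Cons u us)
    show ?case using cong[OF Cons, of u] swap[of u x "us @ vs"] by simp
  qed simp
  have "mset xs = mset (us @ vs)" using Cons.prems ys by simp
  from cong[OF Cons.IH[OF this], of x] show ?case using mv ys by simp
qed simp

lemma fock_perm:
  assumes "admissible xs" "mset xs = mset ys"
  shows "fock xs = fock ys"
proof -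
  define F where "F xs = (if admissible xs then fock xs else 0)" for xs :: "('a \<times> nat) list"
  have "F xs = F ys"
  proof (rule perm_invariant[OF _ _ assms(2)])
    fix x y :: "'a \<times> nat" and xs
    obtain h n h' n' where "x = (h, n)" "y = (h', n')" by (metis surj_pair)
    then show "F (x # y # xs) = F (y # x # xs)"
      by (auto simp: F_def hmode_commute[of h "- int n"])
  next
    fix x :: "'a \<times> nat" and xs ys assume *: "F xs = F ys"
    obtain h n where "x = (h, n)" by force
    then show "F (x # xs) = F (x # ys)"
      using * by (auto simp: F_def hmode_zero split: if_splits)
  qed
  moreover have "admissible ys"
    using assms by (metis admissible_def set_mset_mset)
  ultimately show ?thesis using assms by (simp add: F_def)
qed

text \<open>M(1) behaves as a symmetric algebra: a symmetric function of lists that is linear in the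
  first entry, hence in all, factors through \<open>fock\<close>. This supplies the existence part
  for the descriptions that define \<open>vmode\<close> and \<open>zero_mode\<close>.\<close>

lemma fock_lift:
  fixes F :: "('h::quad_space \<times> nat) list \<Rightarrow> 'v::complex_vec"
  assumes perm: "\<And>xs ys. admissible xs \<Longrightarrow> mset xs = mset ys \<Longrightarrow> F xs = F ys"
    and add: "\<And>x y n xs. n \<ge> 1 \<Longrightarrow> admissible xs \<Longrightarrow> F ((x + y, n) # xs) = F ((x, n) # xs) + F ((y, n) # xs)"
    and scale: "\<And>c x n xs. n \<ge> 1 \<Longrightarrow> admissible xs \<Longrightarrow> F ((c *\<^sub>C x, n) # xs) = c *\<^sub>C F ((x, n) # xs)"
  obtains L where "clin L" "\<And>xs. admissible xs \<Longrightarrow> L (fock xs) = F xs"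
proof
  define L where "L v = lin_ext (\<lambda>M. F (SOME xs. mset xs = M)) (model_of v)" for v
  show L: "clin L"
    unfolding L_def by (rule clin_compose[OF clin_lin_ext clin_model_of])
  have basis: "L (fock xs) = F xs" if "admissible xs" "fst ` set xs \<subseteq> hbasis" for xs
  proof -
    define ys where "ys = (SOME ys. mset ys = mset xs)"
    have "mset ys = mset xs" unfolding ys_def by (rule someI) (rule refl)
    then have "F ys = F xs" using perm[OF that(1)] by metis
    then show ?thesis using that by (simp add: L_def model_of_fock ys_def)
  qed
  have Fsum: "F ((\<Sum>b\<in>A. c b *\<^sub>C b, n) # xs) = (\<Sum>b\<in>A. c b *\<^sub>C F ((b, n) # xs))"
    if "n \<ge> 1" "admissible xs" "finite A" for A c n xs
    using that(3)
  proof induction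
    case empty
    show ?case using scale[of n xs 0 0] that by simp
  qed (use that in \<open>simp add: add scale\<close>)
  have focksum: "fock ((\<Sum>b\<in>A. c b *\<^sub>C b, n) # xs) = (\<Sum>b\<in>A. c b *\<^sub>C fock ((b, n) # xs))"
    if "finite A" for A n xs and c :: "'h \<Rightarrow> complex"
    using that
  proof induction
    case empty
    show ?case using hmode_scale_left[of 0 0] by simp
  qed (simp add: hmode_add_left hmode_scale_left)
  \<comment> \<open>Only \<open>ys\<close> is known to consist of basis vectors. The head of
    \<open>xs\<close> is expanded in the basis, and each resulting entry is moved over to
    \<open>ys\<close>, so that the induction runs on the shorter prefix.\<close>
  have gen: "L (fock (xs @ ys)) = F (xs @ ys)"
    if "admissible xs" "admissible ys" "fst ` set ys \<subseteq> hbasis" for xs ys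
    using that
  proof (induction xs arbitrary: ys)
    case Nil
    then show ?case by (simp add: basis)
  next
    case (Cons x xs)
    obtain h n where x: "x = (h, n)" by force
    have n: "n \<ge> 1" "admissible (xs @ ys)" using Cons.prems x by auto
    have step: "L (fock ((b, n) # xs @ ys)) = F ((b, n) # xs @ ys)" if "b \<in> hbasis" for b
    proof -
      have "L (fock (xs @ (b, n) # ys)) = F (xs @ (b, n) # ys)"
        using Cons that n by (intro Cons.IH) (auto simp: x)
      moreover have "fock (xs @ (b, n) # ys) = fock ((b, n) # xs @ ys)"
        using n by (intro fock_perm) auto
      moreover have "F (xs @ (b, n) # ys) = F ((b, n) # xs @ ys)"
        using n by (intro perm) auto
      ultimately show ?thesis by simp
    qed
    have "L (fock ((\<Sum>b\<in>hbasis. coord h b *\<^sub>C b, n) # xs @ ys)) = F ((\<Sum>b\<in>hbasis. coord h b *\<^sub>C b, n) # xs @ ys)"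
      unfolding focksum[OF finite_hbasis] Fsum[OF n finite_hbasis] clin_sum[OF L] clin_scale[OF L]
      by (simp add: step del: fock_Cons)
    then show ?case by (simp add: coord_expand x)
  qed
  show "L (fock xs) = F xs" if "admissible xs" for xs
    using gen[OF that, of "[]"] by simp
qed

section \<open>Vertex operators, their commutators with the Heisenberg modes, and the weight
  grading\<close>

section \<open>Normally ordered products\<close>

text \<open>The operator \<open>:h(j) F:\<close>.\<close>

definition nmode :: "'h::quad_space \<Rightarrow> int \<Rightarrow> ('h boson \<Rightarrow> 'h boson) \<Rightarrow> 'h boson \<Rightarrow> 'h boson" where
  "nmode h j F w = (if j < 0 then hmode h j (F w) else F (hmode h j w))"

lemma normal_ordered_Nil: "normal_ordered [] w = w"
  by (simp add: normal_ordered_def)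

lemma clin_foldr_hmode: "clin (foldr (\<lambda>(a, m). hmode a m) ys)"
proof (induction ys)
  case Nil
  then show ?case by (simp add: clin_id id_def)
next
  case (Cons y ys)
  then show ?case using clin_compose[OF clin_hmode[of "fst y" "snd y"] Cons]
    by (simp add: comp_def case_prod_beta)
qed

lemma foldr_hmode_commute:
  assumes "\<forall>(a, m)\<in>set ys. m \<ge> 0" "j \<ge> 0"
  shows "foldr (\<lambda>(a, m). hmode a m) ys (hmode h j w) = hmode h j (foldr (\<lambda>(a, m). hmode a m) ys w)"
  using assms
proof (induction ys)
  case (Cons y ys)
  obtain a m where "y = (a, m)" by force
  then show ?case using Cons by (auto simp: hmode_commute'[of m j])
qed simp

lemma normal_ordered_Cons: "normal_ordered ((h, j) # ys) w = nmode h j (normal_ordered ys) w"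
proof (cases "j < 0")
  case False
  let ?P = "filter (\<lambda>(a, m). m \<ge> 0) ys" and ?f = "foldr (\<lambda>(a, m). hmode a m)"
  have "?f ?P (hmode h j w) = hmode h j (?f ?P w)"
    using False by (intro foldr_hmode_commute) auto
  then show ?thesis using False by (simp add: normal_ordered_def nmode_def)
qed (simp add: normal_ordered_def nmode_def)

lemma clin_normal_ordered: "clin (normal_ordered ys)"
  unfolding normal_ordered_def by (rule clin_foldr_hmode)

text \<open>If j and j' have the same kind, the two modes commute: their indices add up to 0 only
  when both are 0, and then the commutator vanishes. If the kinds differ, both sides are the same
  composition.\<close>

lemma nmode_swap: "clin F \<Longrightarrow> nmode h j (nmode h' j' F) w = nmode h' j' (nmode h j F) w"
  by (auto simp: nmode_def hmode_commute'[of j j' h h'])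

lemma nmode_add_left: "clin F \<Longrightarrow> nmode (x + y) j F w = nmode x j F w + nmode y j F w"
  by (simp add: nmode_def hmode_add_left clin_add)

lemma nmode_scale_left: "clin F \<Longrightarrow> nmode (c *\<^sub>C x) j F w = c *\<^sub>C nmode x j F w"
  by (simp add: nmode_def hmode_scale_left clin_scale)

text \<open>The bound is uniform in h, so that a single K truncates the sums over all modes of a
  product.\<close>

definition vanishes_above :: "int \<Rightarrow> 'h::quad_space boson \<Rightarrow> bool" where
  "vanishes_above K w \<longleftrightarrow> (\<forall>h m. m > K \<longrightarrow> hmode h m w = 0)"

lemma vanishes_above_mono: "vanishes_above K w \<Longrightarrow> K \<le> K' \<Longrightarrow> vanishes_above K' w"
  by (auto simp: vanishes_above_def)

lemma vanishes_above_hmode: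
  assumes "vanishes_above K w" "0 \<le> K" "- n \<le> K"
  shows "vanishes_above K (hmode h n w)"
  using assms by (auto simp: vanishes_above_def hmode_commute[of _ _ h n] hmode_zero)

lemma ex_vanishes_above: "\<exists>K\<ge>0. vanishes_above K w"
proof (induction w rule: boson_hmode_induct)
  case vac
  show ?case by (rule exI[of _ 0]) (auto simp: vanishes_above_def hmode_nonneg_vac)
next
  case (add v w)
  then obtain K L where K: "K \<ge> 0" "vanishes_above K v" "L \<ge> 0" "vanishes_above L w" by blast
  have "vanishes_above (max K L) v" "vanishes_above (max K L) w"
    using K by (auto intro: vanishes_above_mono)
  then have "vanishes_above (max K L) (v + w)"
    by (auto simp: vanishes_above_def hmode_add)
  then show ?case using K(1) by (intro exI[of _ "max K L"]) auto
next
  case (scale c v)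
  then show ?case by (auto simp: vanishes_above_def hmode_scale)
next
  case (hmode h n v)
  then obtain K where K: "K \<ge> 0" "vanishes_above K v" by blast
  have "vanishes_above (max K (- n)) (hmode h n v)"
    using K by (intro vanishes_above_hmode vanishes_above_mono[OF K(2)]) auto
  then show ?case using K(1) by (intro exI[of _ "max K (- n)"]) auto
qed

lemma normal_ordered_vanish:
  assumes "vanishes_above K w" "K \<ge> 0" "\<exists>m\<in>snd ` set ys. m > K"
  shows "normal_ordered ys w = 0"
  using assms
proof (induction ys arbitrary: w)
  case (Cons y ys)
  obtain h j where y: "y = (h, j)" by force
  show ?case
  proof (cases "j > K")
    case True
    then show ?thesis using Cons.prems
      by (simp add: y normal_ordered_Cons nmode_def vanishes_above_def clin_zero[OF clin_normal_ordered])
  next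
    case False
    then have "\<exists>m\<in>snd ` set ys. m > K" using Cons.prems y by auto
    then show ?thesis
      using Cons.IH[of w] Cons.IH[of "hmode h j w"] Cons.prems vanishes_above_hmode[of K w j h]
      by (auto simp: y normal_ordered_Cons nmode_def hmode_zero)
  qed
qed simp

section \<open>Modes of normally ordered products\<close>

text \<open>\<open>np_coeff n m\<close> is the coefficient of \<open>a(m)\<close> in \<open>\<partial>\<^bsup>(n-1)\<^esup>a(z)\<close>.\<close>

definition np_coeff :: "nat \<Rightarrow> int \<Rightarrow> complex" where
  "np_coeff n m = of_int (- m - 1) gchoose (n - 1)"

definition np_term :: "('h::quad_space \<times> nat) list \<Rightarrow> int \<Rightarrow> 'h boson \<Rightarrow> int list \<Rightarrow> 'h boson" where
  "np_term xs n w ms =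
     (if length ms = length xs \<and> (\<Sum>i<length xs. ms ! i + int (snd (xs ! i))) = n + 1
       then (\<Prod>i<length xs. of_int (- ms ! i - 1) gchoose (snd (xs ! i) - 1))
              *\<^sub>C normal_ordered (zip (map fst xs) ms) w
       else 0)"

lemma normal_ordered_mode_eq: "normal_ordered_mode xs n w = Sum_any (np_term xs n w)"
  unfolding normal_ordered_mode_def np_term_def ..

lemma np_term_Nil: "np_term [] n w ms = (if ms = [] \<and> n = - 1 then w else 0)"
  by (auto simp: np_term_def normal_ordered_Nil)

text \<open>The first factor is split off, so that a normally ordered product becomes an iterated
  :h(z) F(z): and can be treated by induction on the list.\<close>

lemma np_term_Cons:
  "np_term ((h, k) # xs) n w (j # ms) =
     np_coeff k j *\<^sub>C nmode h j (\<lambda>w. np_term xs (n - j - int k) w ms) w"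
proof -
  have s: "(\<Sum>i<length ((h, k) # xs). (j # ms) ! i + int (snd (((h, k) # xs) ! i))) =
      j + int k + (\<Sum>i<length xs. ms ! i + int (snd (xs ! i)))"
    by (simp only: length_Cons sum.lessThan_Suc_shift) simp
  have p: "(\<Prod>i<length ((h, k) # xs). of_int (- (j # ms) ! i - 1) gchoose (snd (((h, k) # xs) ! i) - 1)) =
      np_coeff k j * (\<Prod>i<length xs. of_int (- ms ! i - 1) gchoose (snd (xs ! i) - 1) :: complex)"
    by (simp only: length_Cons prod.lessThan_Suc_shift) (simp add: np_coeff_def)
  have c: "j + int k + S = n + 1 \<longleftrightarrow> S = n - j - int k + 1" for S by auto
  show ?thesis
    unfolding np_term_def s p c
    by (auto simp: normal_ordered_Cons nmode_def hmode_scale hmode_zero)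
qed

lemma clin_np_term: "clin (\<lambda>w. np_term xs n w ms)"
  by (rule clinI) (simp_all add: np_term_def clin_add[OF clin_normal_ordered]
     clin_scale[OF clin_normal_ordered] cvs.scale_right_distrib mult.commute)

definition int_lists :: "nat \<Rightarrow> int \<Rightarrow> int list set" where
  "int_lists l L = {ms. set ms \<subseteq> {-L..L} \<and> length ms = l}"

lemma finite_int_lists [simp]: "finite (int_lists l L)"
  unfolding int_lists_def by (rule finite_lists_length_eq) simp

lemma int_lists_0: "int_lists 0 L = {[]}"
  by (auto simp: int_lists_def)

lemma sum_int_lists_Suc: "sum f (int_lists (Suc l) L) = (\<Sum>j\<in>{-L..L}. \<Sum>ms\<in>int_lists l L. f (j # ms))"
proof -
  have "int_lists (Suc l) L = (\<lambda>(j, ms). j # ms) ` ({-L..L} \<times> int_lists l L)"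
    by (auto simp: int_lists_def length_Suc_conv image_iff)
  then have "sum f (int_lists (Suc l) L) = (\<Sum>(j, ms)\<in>{-L..L} \<times> int_lists l L. f (j # ms))"
    by (simp only: sum.reindex inj_on_def) (subst sum.reindex, auto simp: inj_on_def case_prod_beta)
  then show ?thesis by (simp add: sum.cartesian_product)
qed

definition np_bound :: "('h \<times> nat) list \<Rightarrow> int \<Rightarrow> int \<Rightarrow> int" where
  "np_bound xs n K = \<bar>n\<bar> + 1 + (\<Sum>x\<leftarrow>xs. int (snd x)) + int (length xs) * K"

text \<open>An index above K makes an annihilation mode kill w. Since the indices have a prescribed
  sum, the common upper bound also bounds each of them from below.\<close>

lemma np_term_support:
  assumes K: "vanishes_above K w" "K \<ge> 0" and L: "L \<ge> np_bound xs n K" and ne: "np_term xs n w ms \<noteq> 0"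
  shows "ms \<in> int_lists (length xs) L"
proof -
  from ne have len: "length ms = length xs"
    and eq: "(\<Sum>i<length xs. ms ! i + int (snd (xs ! i))) = n + 1"
    and no: "normal_ordered (zip (map fst xs) ms) w \<noteq> 0"
    by (auto simp: np_term_def split: if_splits)
  have le: "ms ! i \<le> K" if "i < length xs" for i
  proof (rule ccontr)
    assume "\<not> ms ! i \<le> K"
    moreover have "ms ! i \<in> snd ` set (zip (map fst xs) ms)"
    proof -
      have "zip (map fst xs) ms ! i \<in> set (zip (map fst xs) ms)"
        using that len by (intro nth_mem) simp
      then have "snd (zip (map fst xs) ms ! i) \<in> snd ` set (zip (map fst xs) ms)" by (rule imageI)
      then show ?thesis using that len by simp
    qed
    ultimately show False
      using normal_ordered_vanish[OF K, of "zip (map fst xs) ms"] no by force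
  qed
  define S where "S = (\<Sum>x\<leftarrow>xs. int (snd x))"
  have S: "S = (\<Sum>i<length xs. int (snd (xs ! i)))"
    unfolding S_def by (simp add: sum_list_sum_nth atLeast0LessThan)
  have S0: "S \<ge> 0" unfolding S by (intro sum_nonneg) simp
  have sm: "(\<Sum>i<length xs. ms ! i) = n + 1 - S" using eq by (simp add: sum.distrib S)
  have "- L \<le> ms ! i \<and> ms ! i \<le> L" if i: "i < length xs" for i
  proof
    have "(\<Sum>i<length xs. ms ! i) = ms ! i + (\<Sum>i\<in>{..<length xs} - {i}. ms ! i)"
      using i by (subst sum.remove[of _ i]) auto
    also have "(\<Sum>i\<in>{..<length xs} - {i}. ms ! i) \<le> (\<Sum>i\<in>{..<length xs} - {i}. K)"
      using le by (intro sum_mono) auto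
    also have "\<dots> = int (length xs - 1) * K" using i by simp
    also have "\<dots> \<le> int (length xs) * K" using K(2) by (intro mult_right_mono) auto
    finally have "n + 1 - S - int (length xs) * K \<le> ms ! i" using sm by linarith
    moreover have "\<bar>n\<bar> + 1 + S + int (length xs) * K \<le> L"
      using L by (simp add: np_bound_def S_def)
    ultimately show "- L \<le> ms ! i" by linarith
    have "1 * K \<le> int (length xs) * K"
      using i K(2) by (intro mult_right_mono) auto
    then show "ms ! i \<le> L"
      using le[OF i] L S0 by (simp add: np_bound_def S_def)
  qed
  then show ?thesis using len by (auto simp: int_lists_def in_set_conv_nth)
qed

lemma normal_ordered_mode_sum:
  assumes "vanishes_above K w" "K \<ge> 0" "L \<ge> np_bound xs n K"
  shows "normal_ordered_mode xs n w = (\<Sum>ms\<in>int_lists (length xs) L. np_term xs n w ms)"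
  unfolding normal_ordered_mode_eq
  by (rule Sum_any.expand_superset) (use np_term_support[OF assms] in auto)

lemma normal_ordered_mode_swap: "normal_ordered_mode (x # y # xs) = normal_ordered_mode (y # x # xs)"
proof (intro ext)
  fix n w
  obtain h k h' k' where xy: "x = (h, k)" "y = (h', k')" by (metis surj_pair)
  \<comment> \<open>Exchanging the first two indices compensates the exchange of the first two
    factors; as an involution it reindexes the sum over all lists.\<close>
  define s :: "int list \<Rightarrow> int list"
    where "s ms = (case ms of j # j' # ms \<Rightarrow> j' # j # ms | _ \<Rightarrow> ms)" for ms
  have ss: "s (s ms) = ms" for ms
    by (auto simp: s_def split: list.splits)
  have eq: "np_term (x # y # xs) n w (s ms) = np_term (y # x # xs) n w ms" for ms
  proof (cases "\<exists>j j' ms'. ms = j # j' # ms'")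
    case True
    then obtain j j' ms' where ms: "ms = j # j' # ms'" by blast
    define F where "F = (\<lambda>w. np_term xs (n - j - j' - int k - int k') w ms')"
    have F: "clin F" unfolding F_def by (rule clin_np_term)
    have sc: "nmode h j (\<lambda>w. c *\<^sub>C G w) w = c *\<^sub>C nmode h j G w" for h j c G w
      by (simp add: nmode_def hmode_scale)
    have F1: "(\<lambda>w. np_term xs (n - j - int k' - j' - int k) w ms') = F"
      "(\<lambda>w. np_term xs (n - j' - int k - j - int k') w ms') = F"
      by (simp_all add: F_def algebra_simps)
    show ?thesis
      unfolding ms s_def xy by (simp add: np_term_Cons F1 sc nmode_swap[OF F, of h j'] mult.commute)
  next
    case False
    then have "s ms = ms" "length ms < 2"
      by (auto simp: s_def split: list.splits) (metis One_nat_def Suc_1 length_Cons less_2_cases_iff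
        less_Suc_eq_0_disj list.exhaust list.size(3) not_less_eq)
    then show ?thesis by (simp add: np_term_def)
  qed
  have bij: "bij s" using ss by (metis involuntory_imp_bij)
  show "normal_ordered_mode (x # y # xs) n w = normal_ordered_mode (y # x # xs) n w"
    unfolding normal_ordered_mode_eq
    by (rule Sum_any.reindex_cong[of s]) (use bij eq in \<open>auto simp: bij_def fun_eq_iff\<close>)
qed

lemma clin_normal_ordered_mode: "clin (normal_ordered_mode xs n)"
proof (rule clinI)
  fix v w :: "'a boson" and c
  obtain K K' where K: "K \<ge> 0" "vanishes_above K v" "K' \<ge> 0" "vanishes_above K' w"
    using ex_vanishes_above by metis
  define M where "M = max K K'"
  have M: "vanishes_above M v" "vanishes_above M w" "M \<ge> 0"
    using K by (auto simp: M_def intro: vanishes_above_mono)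
  then have M': "vanishes_above M (v + w)" "vanishes_above M (c *\<^sub>C v)"
    by (auto simp: vanishes_above_def hmode_add hmode_scale)
  note sums = normal_ordered_mode_sum[OF M(1,3) order_refl] normal_ordered_mode_sum[OF M(2,3) order_refl]
    normal_ordered_mode_sum[OF M'(1) M(3) order_refl] normal_ordered_mode_sum[OF M'(2) M(3) order_refl]
  show "normal_ordered_mode xs n (v + w) = normal_ordered_mode xs n v + normal_ordered_mode xs n w"
    by (simp add: sums clin_add[OF clin_np_term] sum.distrib)
  show "normal_ordered_mode xs n (c *\<^sub>C v) = c *\<^sub>C normal_ordered_mode xs n v"
    by (simp add: sums clin_scale[OF clin_np_term] cvs.scale_sum_right)
qed

text \<open>Formulated for all large truncations L instead of as an infinite sum: finitely many such
  identities can then be combined by passing to a common L.\<close>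

lemma normal_ordered_mode_Cons:
  "\<forall>\<^sub>F L in at_top. normal_ordered_mode ((h, k) # xs) n w =
     (\<Sum>j\<in>{-L..L::int}. np_coeff k j *\<^sub>C nmode h j (normal_ordered_mode xs (n - j - int k)) w)"
proof -
  obtain K where K: "K \<ge> 0" "vanishes_above K w" using ex_vanishes_above by blast
  let ?B = "np_bound ((h, k) # xs) n K"
  \<comment> \<open>The inner product has mode number n - j - k with \<bar>j\<bar> up to L, so its
    index box has to be larger than the outer one and to grow with L.\<close>
  let ?M = "\<lambda>L. 2 * L + ?B"
  have B0: "?B \<ge> 0"
    using K(1) unfolding np_bound_def by (intro add_nonneg_nonneg sum_list_nonneg mult_nonneg_nonneg) auto
  have "normal_ordered_mode ((h, k) # xs) n w =
     (\<Sum>j\<in>{-L..L::int}. np_coeff k j *\<^sub>C nmode h j (normal_ordered_mode xs (n - j - int k)) w)"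
    if L: "L \<ge> ?B" for L
  proof -
    have L0: "L \<ge> 0" using L B0 by linarith
    have inner: "normal_ordered_mode xs (n - j - int k) v =
        (\<Sum>ms\<in>int_lists (length xs) (?M L). np_term xs (n - j - int k) v ms)"
      if "vanishes_above K v" "j \<in> {-L..L}" for v j
    proof (rule normal_ordered_mode_sum[OF that(1) K(1)])
      have "\<bar>n - j - int k\<bar> \<le> \<bar>n\<bar> + L + int k" using that by auto
      then show "np_bound xs (n - j - int k) K \<le> ?M L"
        using K(1) L0 by (simp add: np_bound_def distrib_right)
    qed
    have nm: "nmode h j (normal_ordered_mode xs (n - j - int k)) w =
        (\<Sum>ms\<in>int_lists (length xs) (?M L). nmode h j (\<lambda>w. np_term xs (n - j - int k) w ms) w)"
      if "j \<in> {-L..L}" for j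
      using inner[OF K(2) that] inner[OF vanishes_above_hmode[OF K(2,1)] that, of j h] K(1)
      by (auto simp: nmode_def hmode_sum)
    have sub: "int_lists (Suc (length xs)) L \<subseteq> int_lists (Suc (length xs)) (?M L)"
      using L0 B0 by (auto simp: int_lists_def)
    have "normal_ordered_mode ((h, k) # xs) n w =
        (\<Sum>ms\<in>int_lists (Suc (length xs)) (?M L). np_term ((h, k) # xs) n w ms)"
      using normal_ordered_mode_sum[OF K(2,1), of "(h, k) # xs" n "?M L"] L0 by simp
    also have "\<dots> = (\<Sum>j\<in>{-?M L..?M L}. \<Sum>ms\<in>int_lists (length xs) (?M L). np_term ((h, k) # xs) n w (j # ms))"
      by (rule sum_int_lists_Suc)
    also have "\<dots> = (\<Sum>j\<in>{-L..L}. \<Sum>ms\<in>int_lists (length xs) (?M L). np_term ((h, k) # xs) n w (j # ms))"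
    proof (rule sum.mono_neutral_right)
      show "\<forall>j\<in>{-?M L..?M L} - {-L..L}. (\<Sum>ms\<in>int_lists (length xs) (?M L). np_term ((h, k) # xs) n w (j # ms)) = 0"
      proof (intro ballI sum.neutral)
        fix j ms assume "j \<in> {-?M L..?M L} - {-L..L}"
        then have "j # ms \<notin> int_lists (length ((h, k) # xs)) L" by (auto simp: int_lists_def)
        then show "np_term ((h, k) # xs) n w (j # ms) = 0"
          using np_term_support[OF K(2,1) L] by blast
      qed
    qed (use L0 B0 in auto)
    also have "\<dots> = (\<Sum>j\<in>{-L..L}. np_coeff k j *\<^sub>C nmode h j (normal_ordered_mode xs (n - j - int k)) w)"
      by (intro sum.cong refl) (simp add: np_term_Cons nm cvs.scale_sum_right)
    finally show ?thesis .
  qed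
  then show ?thesis unfolding eventually_at_top_linorder by blast
qed

lemma normal_ordered_mode_Nil: "normal_ordered_mode [] n w = (if n = - 1 then w else 0)"
proof -
  obtain K where K: "K \<ge> 0" "vanishes_above K w" using ex_vanishes_above by blast
  show ?thesis
    using normal_ordered_mode_sum[OF K(2,1) order_refl, of "[]" n] by (simp add: int_lists_0 np_term_Nil)
qed

lemma normal_ordered_mode_cong:
  assumes "normal_ordered_mode xs = normal_ordered_mode ys"
  shows "normal_ordered_mode (x # xs) = normal_ordered_mode (x # ys)"
proof (intro ext)
  fix n w
  obtain h k where x: "x = (h, k)" by force
  have "\<forall>\<^sub>F L::int in at_top. normal_ordered_mode (x # xs) n w = normal_ordered_mode (x # ys) n w"
    using normal_ordered_mode_Cons[of h k xs n w] normal_ordered_mode_Cons[of h k ys n w]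
    by eventually_elim (simp add: x assms)
  then show "normal_ordered_mode (x # xs) n w = normal_ordered_mode (x # ys) n w" by simp
qed

lemma normal_ordered_mode_perm: "mset xs = mset ys \<Longrightarrow> normal_ordered_mode xs = normal_ordered_mode ys"
  by (rule perm_invariant[where F = normal_ordered_mode]) (rule normal_ordered_mode_swap normal_ordered_mode_cong; assumption?)+

lemma normal_ordered_mode_add:
  "normal_ordered_mode ((x + y, k) # xs) n w =
     normal_ordered_mode ((x, k) # xs) n w + normal_ordered_mode ((y, k) # xs) n w"
proof -
  have "\<forall>\<^sub>F L::int in at_top. ?thesis"
    using normal_ordered_mode_Cons[of "x + y" k xs n w] normal_ordered_mode_Cons[of x k xs n w]
      normal_ordered_mode_Cons[of y k xs n w]
    by eventually_elim
       (simp add: nmode_add_left clin_normal_ordered_mode cvs.scale_right_distrib sum.distrib)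
  then show ?thesis by simp
qed

lemma normal_ordered_mode_scale:
  "normal_ordered_mode ((c *\<^sub>C x, k) # xs) n w = c *\<^sub>C normal_ordered_mode ((x, k) # xs) n w"
proof -
  have "\<forall>\<^sub>F L::int in at_top. ?thesis"
    using normal_ordered_mode_Cons[of "c *\<^sub>C x" k xs n w] normal_ordered_mode_Cons[of x k xs n w]
    by eventually_elim
       (simp add: nmode_scale_left clin_normal_ordered_mode cvs.scale_sum_right mult.commute)
  then show ?thesis by simp
qed

section \<open>Vertex operators\<close>

text \<open>The definite description is legitimate: \<open>fock_lift\<close> gives existence, and
  linearity in v together with the spanning Fock vectors gives uniqueness.\<close>

lemma vmode_spec:
  "(\<forall>n w. clin (\<lambda>v :: 'h::quad_space boson. vmode v n w)) \<and>
   (\<forall>xs. admissible xs \<longrightarrow> (\<forall>n w. vmode (fock xs :: 'h boson) n w = normal_ordered_mode xs n w))"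
proof -
  let ?P = "\<lambda>Y :: 'h boson \<Rightarrow> int \<Rightarrow> 'h boson \<Rightarrow> 'h boson. (\<forall>n w. clin (\<lambda>v. Y v n w)) \<and>
     (\<forall>xs. admissible xs \<longrightarrow> (\<forall>n w. Y (fock xs) n w = normal_ordered_mode xs n w))"
  have "\<exists>L. clin L \<and> (\<forall>xs. admissible xs \<longrightarrow> L (fock xs) = normal_ordered_mode xs n w)"
    for n and w :: "'h boson"
    by (rule fock_lift[of "\<lambda>xs. normal_ordered_mode xs n w"])
       (auto simp: normal_ordered_mode_add normal_ordered_mode_scale dest: normal_ordered_mode_perm)
  then obtain L where "\<And>n w. clin (L n w :: 'h boson \<Rightarrow> 'h boson)"
    "\<And>n w xs. admissible xs \<Longrightarrow> L n w (fock xs) = normal_ordered_mode xs n w" by metis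
  then have L: "?P (\<lambda>v n w. L n w v)" by auto
  have uniq: "Y = Y'" if "?P Y" "?P Y'" for Y Y'
  proof (intro ext)
    fix v n w
    show "Y v n w = Y' v n w"
      by (rule clin_eq_fock[of "\<lambda>v. Y v n w" "\<lambda>v. Y' v n w"]) (use that in auto)
  qed
  have "?P (THE Y. ?P Y)"
    by (rule theI[of ?P, OF L]) (rule uniq[OF _ L])
  then show ?thesis unfolding vmode_def .
qed

lemma clin_vmode_left: "clin (\<lambda>v. vmode v n w)"
  and vmode_fock: "admissible xs \<Longrightarrow> vmode (fock xs) n = normal_ordered_mode xs n"
  using vmode_spec by (auto simp: fun_eq_iff)

lemma clin_vmode: "clin (vmode v n)"
proof (induction v rule: boson_fock_induct)
  case (fock xs)
  then show ?case by (simp add: vmode_fock clin_normal_ordered_mode)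
next
  case (add v w)
  then show ?case using clin_add_fun[OF add] by (simp add: clin_add[OF clin_vmode_left, abs_def])
next
  case (scale c v)
  then show ?case using clin_scale_fun[OF scale, of c] by (simp add: clin_scale[OF clin_vmode_left])
qed

lemma vmode_vac: "vmode vac n w = (if n = - 1 then w else 0)"
  using fun_cong[OF vmode_fock[of "[]" n], of w] by (simp add: normal_ordered_mode_Nil)

lemma vmode_hmode:
  assumes "k \<ge> 1"
  shows "\<forall>\<^sub>F L in at_top. vmode (hmode h (- int k) v) n w =
     (\<Sum>j\<in>{-L..L::int}. np_coeff k j *\<^sub>C nmode h j (vmode v (n - j - int k)) w)"
proof (induction v rule: boson_fock_induct)
  case (fock xs)
  then show ?case
    using normal_ordered_mode_Cons[of h k xs n w] vmode_fock[of "(h, k) # xs" n] assms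
    by (simp add: vmode_fock)
next
  case (add u v)
  have *: "nmode h j (vmode (u + v) i) w = nmode h j (vmode u i) w + nmode h j (vmode v i) w" for j i
    by (simp add: nmode_def clin_add[OF clin_vmode_left] hmode_add)
  have **: "vmode (hmode h (- int k) (u + v)) n w =
      vmode (hmode h (- int k) u) n w + vmode (hmode h (- int k) v) n w"
    by (simp add: clin_add[OF clin_vmode_left] hmode_add)
  from add show ?case
    by eventually_elim
       (simp add: * ** cvs.scale_right_distrib sum.distrib)
next
  case (scale c v)
  have *: "nmode h j (vmode (c *\<^sub>C v) i) w = c *\<^sub>C nmode h j (vmode v i) w" for j i
    by (simp add: nmode_def clin_scale[OF clin_vmode_left] hmode_scale)
  have **: "vmode (hmode h (- int k) (c *\<^sub>C v)) n w = c *\<^sub>C vmode (hmode h (- int k) v) n w"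
    by (simp add: clin_scale[OF clin_vmode_left] hmode_scale)
  from scale show ?case
    by eventually_elim
       (simp add: * ** cvs.scale_sum_right mult.commute)
qed

lemma vmode_hmode_vac: "vmode (hmode h (- 1) vac) m w = hmode h m w"
proof -
  have "\<forall>\<^sub>F L::int in at_top. \<bar>m\<bar> \<le> L"
    by (rule eventually_ge_at_top)
  then have "\<forall>\<^sub>F L::int in at_top. ?thesis"
    using vmode_hmode[of 1 h vac m w, OF order_refl]
  proof eventually_elim
    case (elim L)
    have "np_coeff 1 j *\<^sub>C nmode h j (vmode vac (m - j - int 1)) w = (if j = m then hmode h m w else 0)" for j
      by (simp add: np_coeff_def nmode_def vmode_vac hmode_zero)
    then show ?case using elim by (auto simp: sum.delta)
  qed
  then show ?thesis by simp
qed

lemma hmode_nmode: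
  assumes "clin F"
  shows "hmode h j (nmode h' i F w) = nmode h' i F (hmode h j w) +
    nmode h' i (\<lambda>w. hmode h j (F w) - F (hmode h j w)) w +
    (if j + i = 0 then of_int j * form h h' else 0) *\<^sub>C F w"
  using hmode_commute[of h j h' i "F w"] hmode_commute[of h j h' i w]
  by (simp add: nmode_def hmode_diff clin_add[OF assms] clin_scale[OF assms])

text \<open>Here \<open>np_coeff k (- j)\<close> is binom(j-1, k-1). Absorption turns the central
  term from [h(j), h'(-j)] into the term l = k of the commutator formula.\<close>

lemma gbinomial_int_absorb:
  assumes "k \<ge> 1"
  shows "of_int j * np_coeff k (- j) = of_nat k * (of_int j gchoose k)"
proof -
  obtain k' where "k = Suc k'" using assms by (cases k) auto
  then show ?thesis using gbinomial_absorption[of k' "of_int j :: complex"] by (simp add: np_coeff_def)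
qed

text \<open>
  Since \<open>h(l)v = 0\<close> for large \<open>l\<close>, the sum over \<open>l\<close> is finite; quantifying over all large
  bounds \<open>L\<close> lets bounds for different vectors be combined.
\<close>

lemma vmode_commutator:
  "\<forall>\<^sub>F L in sequentially. \<forall>j n w. hmode h j (vmode v n w) = vmode v n (hmode h j w) +
     (\<Sum>l\<le>L. (of_int j gchoose l) *\<^sub>C vmode (hmode h (int l) v) (n + j - int l) w)"
proof (induction v rule: boson_induct)
  case vac
  show ?case
    by (simp add: vmode_vac hmode_nonneg_vac clin_zero[OF clin_vmode_left] hmode_zero)
next
  case (add u v)
  then show ?case
    by eventually_elim
      (simp add: hmode_add clin_add[OF clin_vmode_left] cvs.scale_right_distrib sum.distrib add_ac)
next
  case (scale c v)
  then show ?case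
    by eventually_elim
      (simp add: hmode_scale clin_scale[OF clin_vmode_left] cvs.scale_right_distrib cvs.scale_sum_right mult.commute)
next
  case (hmode h' k v)
  \<comment> \<open>The bound must reach k, because h(k) h'(-k) v acquires the new summand k (h, h')
    v.\<close>
  from hmode.IH eventually_ge_at_top[of k] show ?case
  proof eventually_elim
    case (elim L)
    show ?case
    proof (intro allI)
      fix j n w
      let ?c = "np_coeff k" and ?n = "\<lambda>i. n - i - int k"
      have big: "\<forall>\<^sub>F M::int in at_top. \<bar>j\<bar> \<le> M" by (rule eventually_ge_at_top)
      have ev: "\<forall>\<^sub>F M in at_top. \<forall>l\<in>{..L}. vmode (hmode h' (- int k) (hmode h (int l) v)) (n + j - int l) w =
         (\<Sum>i\<in>{-M..M}. ?c i *\<^sub>C nmode h' i (vmode (hmode h (int l) v) (n + j - int l - i - int k)) w)"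
        by (intro eventually_ball_finite ballI vmode_hmode) (use hmode.hyps in auto)
      note ev2 = vmode_hmode[OF hmode.hyps(1), of h' v n w]
        vmode_hmode[OF hmode.hyps(1), of h' v n "hmode h j w"]
      have "\<forall>\<^sub>F M::int in at_top. hmode h j (vmode (hmode h' (- int k) v) n w) =
          vmode (hmode h' (- int k) v) n (hmode h j w) +
          (\<Sum>l\<le>L. (of_int j gchoose l) *\<^sub>C vmode (hmode h (int l) (hmode h' (- int k) v)) (n + j - int l) w)"
        using big ev ev2
      proof eventually_elim
        case (elim M)
        have comm: "hmode h j (vmode v m w) - vmode v m (hmode h j w) =
            (\<Sum>l\<le>L. (of_int j gchoose l) *\<^sub>C vmode (hmode h (int l) v) (m + j - int l) w)" for m w
          using \<open>\<forall>j n w. _ j n w\<close> by simp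
        have nm: "nmode h' i (\<lambda>w. hmode h j (vmode v (?n i) w) - vmode v (?n i) (hmode h j w)) w =
          (\<Sum>l\<le>L. (of_int j gchoose l) *\<^sub>C nmode h' i (vmode (hmode h (int l) v) (n + j - int l - i - int k)) w)" for i
        proof -
          have e: "?n i + j - int l = n + j - int l - i - int k" for l by simp
          show ?thesis unfolding comm e by (simp add: nmode_def hmode_sum hmode_scale)
        qed
        have delta: "(\<Sum>i\<in>{-M..M}. ?c i *\<^sub>C (if j + i = 0 then of_int j * form h h' else 0) *\<^sub>C vmode v (?n i) w)
           = (of_nat k * form h h' * (of_int j gchoose k)) *\<^sub>C vmode v (n + j - int k) w"
        proof -
          have "(\<Sum>i\<in>{-M..M}. ?c i *\<^sub>C (if j + i = 0 then of_int j * form h h' else 0) *\<^sub>C vmode v (?n i) w)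
            = (\<Sum>i\<in>{-M..M}. if i = - j then (?c (- j) * of_int j * form h h') *\<^sub>C vmode v (n + j - int k) w else 0)"
            by (intro sum.cong) auto
          also have "\<dots> = (?c (- j) * of_int j * form h h') *\<^sub>C vmode v (n + j - int k) w"
            using \<open>\<bar>j\<bar> \<le> M\<close> by (subst sum.delta) auto
          also have "?c (- j) * of_int j * form h h' = of_nat k * form h h' * (of_int j gchoose k)"
            using gbinomial_int_absorb[OF hmode.hyps(1), of j] by (simp add: mult_ac)
          finally show ?thesis .
        qed
        have "hmode h j (vmode (hmode h' (- int k) v) n w) =
          (\<Sum>i\<in>{-M..M}. ?c i *\<^sub>C hmode h j (nmode h' i (vmode v (?n i)) w))"
          by (simp add: elim hmode_sum hmode_scale)
        also have "\<dots> = (\<Sum>i\<in>{-M..M}. ?c i *\<^sub>C nmode h' i (vmode v (?n i)) (hmode h j w)) +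
           (\<Sum>i\<in>{-M..M}. \<Sum>l\<le>L. (of_int j gchoose l) *\<^sub>C ?c i *\<^sub>C
              nmode h' i (vmode (hmode h (int l) v) (n + j - int l - i - int k)) w) +
           (of_nat k * form h h' * (of_int j gchoose k)) *\<^sub>C vmode v (n + j - int k) w"
          unfolding delta[symmetric] hmode_nmode[OF clin_vmode] nm
          by (simp add: cvs.scale_right_distrib sum.distrib cvs.scale_sum_right mult.commute)
        also have "(\<Sum>i\<in>{-M..M}. ?c i *\<^sub>C nmode h' i (vmode v (?n i)) (hmode h j w)) =
            vmode (hmode h' (- int k) v) n (hmode h j w)"
          using elim by simp
        also have "(\<Sum>i\<in>{-M..M}. \<Sum>l\<le>L. (of_int j gchoose l) *\<^sub>C ?c i *\<^sub>C
              nmode h' i (vmode (hmode h (int l) v) (n + j - int l - i - int k)) w) =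
            (\<Sum>l\<le>L. (of_int j gchoose l) *\<^sub>C vmode (hmode h' (- int k) (hmode h (int l) v)) (n + j - int l) w)"
          by (subst sum.swap) (simp add: elim cvs.scale_sum_right)
        finally have 1: "hmode h j (vmode (hmode h' (- int k) v) n w) =
            vmode (hmode h' (- int k) v) n (hmode h j w) +
            ((\<Sum>l\<le>L. (of_int j gchoose l) *\<^sub>C vmode (hmode h' (- int k) (hmode h (int l) v)) (n + j - int l) w)
            + (of_nat k * form h h' * (of_int j gchoose k)) *\<^sub>C vmode v (n + j - int k) w)"
          by (simp add: add.assoc)
        \<comment> \<open>Inside the argument, h(l) fails to commute with h'(-k) only for l = k, and
          the extra term is the one found in \<open>delta\<close>.\<close>
        have "(\<Sum>l\<le>L. (of_int j gchoose l) *\<^sub>C vmode (hmode h (int l) (hmode h' (- int k) v)) (n + j - int l) w)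
          = (\<Sum>l\<le>L. (of_int j gchoose l) *\<^sub>C vmode (hmode h' (- int k) (hmode h (int l) v)) (n + j - int l) w
             + (if l = k then (of_nat k * form h h' * (of_int j gchoose k)) *\<^sub>C vmode v (n + j - int k) w else 0))"
          by (intro sum.cong refl)
            (auto simp: hmode_commute[of h "int _" h'] clin_add[OF clin_vmode_left]
              clin_scale[OF clin_vmode_left] cvs.scale_right_distrib mult.commute)
        also have "\<dots> = (\<Sum>l\<le>L. (of_int j gchoose l) *\<^sub>C vmode (hmode h' (- int k) (hmode h (int l) v)) (n + j - int l) w)
             + (of_nat k * form h h' * (of_int j gchoose k)) *\<^sub>C vmode v (n + j - int k) w"
          using \<open>k \<le> L\<close> by (simp add: sum.distrib)
        finally show ?case using 1 by simp
      qed
      then show "hmode h j (vmode (hmode h' (- int k) v) n w) =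
          vmode (hmode h' (- int k) v) n (hmode h j w) +
          (\<Sum>l\<le>L. (of_int j gchoose l) *\<^sub>C vmode (hmode h (int l) (hmode h' (- int k) v)) (n + j - int l) w)"
        by simp
    qed
  qed
qed

section \<open>The weight grading\<close>

definition fock_weight :: "('h \<times> nat) list \<Rightarrow> nat" where
  "fock_weight xs = sum_list (map snd xs)"

lemma fock_weight_simps [simp]:
  "fock_weight [] = 0" "fock_weight ((h, n) # xs) = n + fock_weight xs"
  "fock_weight (xs @ ys) = fock_weight xs + fock_weight ys"
  by (simp_all add: fock_weight_def)

text \<open>Integer weights, with zero spaces below 0, let a mode of index m shift the weight by -m
  without side conditions; vanishing of modes on low weights is then automatic.\<close>

definition wspace :: "int \<Rightarrow> 'h::quad_space boson set" where
  "wspace z = (if z < 0 then {0} else weight_space (nat z))"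

lemma wspace_int [simp]: "wspace (int n) = weight_space n"
  by (simp add: wspace_def)

lemma wspace_neg: "z < 0 \<Longrightarrow> v \<in> wspace z \<longleftrightarrow> v = 0"
  by (simp add: wspace_def)

lemma subspace_wspace: "cvs.subspace (wspace z)"
  by (simp add: wspace_def weight_space_def)

lemmas wspace_zero [simp] = cvs.subspace_0[OF subspace_wspace]
  and wspace_add = cvs.subspace_add[OF subspace_wspace]
  and wspace_scale = cvs.subspace_scale[OF subspace_wspace]
  and wspace_sum = cvs.subspace_sum[OF subspace_wspace]

lemma fock_in_wspace: "admissible xs \<Longrightarrow> z = int (fock_weight xs) \<Longrightarrow> fock xs \<in> wspace z"
  by (auto simp: weight_space_def fock_weight_def intro!: cvs.span_base)

lemma vac_in_wspace: "vac \<in> wspace 0"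
  using fock_in_wspace[of "[]" 0] by simp

lemma wspace_induct [consumes 1, case_names fock zero add scale]:
  assumes "v \<in> wspace z"
    and fock: "\<And>xs. admissible xs \<Longrightarrow> int (fock_weight xs) = z \<Longrightarrow> P (fock xs)"
    and zero: "P 0" and add: "\<And>v w. P v \<Longrightarrow> P w \<Longrightarrow> P (v + w)" and scale: "\<And>c v. P v \<Longrightarrow> P (c *\<^sub>C v)"
  shows "P v"
proof (cases "z < 0")
  case True
  then show ?thesis using assms(1) zero by (simp add: wspace_neg)
next
  case False
  then have "v \<in> cvs.span {fock xs | xs. admissible xs \<and> sum_list (map snd xs) = nat z}"
    using assms(1) by (simp add: wspace_def weight_space_def)
  then show ?thesis
  proof (induction rule: cvs.span_induct_alt)
    case base
    show ?case by (rule zero)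
  next
    case (step c x y)
    then have "P x" using False by (auto simp: fock_weight_def intro!: fock)
    then show ?case using step.IH by (intro add scale)
  qed
qed

lemma hmode_neg_wspace:
  assumes "v \<in> wspace z" "n \<ge> 1"
  shows "hmode h (- int n) v \<in> wspace (z + int n)"
  using assms(1)
proof (induction rule: wspace_induct)
  case (fock xs)
  then show ?case using fock_in_wspace[of "(h, n) # xs" "z + int n"] assms(2) by simp
qed (auto simp: hmode_add hmode_scale hmode_zero intro: wspace_add wspace_scale)

lemma hmode_wspace:
  assumes "v \<in> wspace z" "z' = z - m"
  shows "hmode h m v \<in> wspace z'"
proof (cases "m < 0")
  case True
  then show ?thesis using hmode_neg_wspace[OF assms(1), of "nat (- m)" h] assms(2) by simp
next
  case False
  have *: "admissible xs \<Longrightarrow> hmode h m (fock xs) \<in> wspace (int (fock_weight xs) - m)" for xs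
  proof (induction xs)
    case Nil
    then show ?case using False by (simp add: hmode_nonneg_vac)
  next
    case (Cons x xs)
    obtain h' n where x: "x = (h', n)" by force
    with Cons.prems have n: "n \<ge> 1" "admissible xs" by auto
    have 1: "hmode h' (- int n) (hmode h m (fock xs)) \<in> wspace (int (fock_weight (x # xs)) - m)"
      using hmode_neg_wspace[OF Cons.IH[OF n(2)] n(1), of h'] by (simp add: x algebra_simps)
    have "(if m + - int n = 0 then of_int m * form h h' else 0) *\<^sub>C fock xs
        \<in> wspace (int (fock_weight (x # xs)) - m)"
      using n by (auto simp: x simp del: wspace_int intro!: wspace_scale fock_in_wspace)
    then show ?case using wspace_add[OF 1] unfolding x fock_Cons hmode_commute[of h m] by simp
  qed
  show ?thesis using assms(1)
    by (induction rule: wspace_induct)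
       (auto simp: hmode_add hmode_scale hmode_zero assms(2) * intro: wspace_add wspace_scale)
qed

lemma vmode_wspace:
  assumes "v \<in> wspace k" "w \<in> wspace z" "z' = z + k - 1 - n"
  shows "vmode v n w \<in> wspace z'"
proof -
  have *: "admissible xs \<Longrightarrow> w \<in> wspace z \<Longrightarrow> vmode (fock xs) n w \<in> wspace (z + int (fock_weight xs) - 1 - n)"
    for xs w z n
  proof (induction xs arbitrary: n w z)
    case Nil
    then show ?case by (simp add: vmode_vac)
  next
    case (Cons x xs)
    obtain h k where x: "x = (h, k)" by force
    with Cons.prems have k: "k \<ge> 1" "admissible xs" by auto
    obtain L :: int where L: "vmode (hmode h (- int k) (fock xs)) n w =
       (\<Sum>j\<in>{-L..L}. np_coeff k j *\<^sub>C nmode h j (vmode (fock xs) (n - j - int k)) w)"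
      using vmode_hmode[OF k(1), of h "fock xs" n w] unfolding eventually_at_top_linorder by blast
    have "nmode h j (vmode (fock xs) (n - j - int k)) w \<in> wspace (z + int (fock_weight (x # xs)) - 1 - n)" for j
    proof (cases "j < 0")
      case True
      have "vmode (fock xs) (n - j - int k) w \<in> wspace (z + int (fock_weight xs) - 1 - (n - j - int k))"
        using Cons k by blast
      then show ?thesis using True
        by (simp add: nmode_def) (rule hmode_wspace, auto simp: x)
    next
      case False
      have "vmode (fock xs) (n - j - int k) (hmode h j w) \<in> wspace ((z - j) + int (fock_weight xs) - 1 - (n - j - int k))"
        using Cons k hmode_wspace[OF Cons.prems(2) refl] by blast
      then show ?thesis using False by (simp add: nmode_def x algebra_simps)
    qed
    then show ?case unfolding x fock_Cons L by (intro wspace_sum wspace_scale) (simp add: x)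
  qed
  show ?thesis using assms(1)
    by (induction rule: wspace_induct)
       (auto simp: clin_add[OF clin_vmode_left] clin_scale[OF clin_vmode_left]
          clin_zero[OF clin_vmode_left] assms * intro: wspace_add wspace_scale)
qed

section \<open>The operators \<open>o(v)\<close>\<close>

text \<open>On lists the weight is available, so the index \<open>fock_weight xs - 1\<close> may
  vary with the list. The resulting function is still symmetric and multilinear, and
  \<open>fock_lift\<close> applies to all weights at once.\<close>

lemma zero_mode_spec:
  "(\<forall>w. clin (\<lambda>v :: 'h::quad_space boson. zero_mode v w)) \<and>
   (\<forall>k. \<forall>v\<in>weight_space k. zero_mode (v :: 'h boson) = vmode v (int k - 1))"
proof -
  let ?P = "\<lambda>f :: 'h boson \<Rightarrow> 'h boson \<Rightarrow> 'h boson. (\<forall>w. clin (\<lambda>v. f v w)) \<and>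
     (\<forall>k. \<forall>v\<in>weight_space k. f v = vmode v (int k - 1))"
  have wt: "fock_weight xs = fock_weight ys" if "mset xs = mset ys" for xs ys :: "('h \<times> nat) list"
    unfolding fock_weight_def using that by (metis mset_map sum_mset_sum_list)
  have pw: "normal_ordered_mode xs (int (fock_weight xs) - 1) w = normal_ordered_mode ys (int (fock_weight ys) - 1) w"
    if "mset xs = mset ys" for xs ys and w :: "'h boson"
    using normal_ordered_mode_perm[OF that] wt[OF that] by simp
  have "\<exists>L. clin L \<and> (\<forall>xs. admissible xs \<longrightarrow> L (fock xs) = normal_ordered_mode xs (int (fock_weight xs) - 1) w)"
    for w :: "'h boson"
    by (rule fock_lift[of "\<lambda>xs. normal_ordered_mode xs (int (fock_weight xs) - 1) w"])
       (auto simp: normal_ordered_mode_add normal_ordered_mode_scale intro!: pw)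
  then obtain L where L: "\<And>w. clin (L w :: 'h boson \<Rightarrow> 'h boson)"
    "\<And>w xs. admissible xs \<Longrightarrow> L w (fock xs) = normal_ordered_mode xs (int (fock_weight xs) - 1) w" by metis
  have "L w v = vmode v (int k - 1) w" if "v \<in> wspace (int k)" for v w k
    using that
    by (induction rule: wspace_induct)
       (simp_all add: L(2) vmode_fock clin_zero[OF L(1)] clin_add[OF L(1)] clin_scale[OF L(1)]
         clin_zero[OF clin_vmode_left] clin_add[OF clin_vmode_left] clin_scale[OF clin_vmode_left])
  then have P: "?P (\<lambda>v w. L w v)" using L(1) by (auto simp: fun_eq_iff)
  have uniq: "f = f'" if "?P f" "?P f'" for f f'
  proof (intro ext)
    fix v w
    show "f v w = f' v w"
    proof (rule clin_eq_fock[of "\<lambda>v. f v w" "\<lambda>v. f' v w"])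
      fix xs :: "('h \<times> nat) list" assume "admissible xs"
      then have "fock xs \<in> weight_space (fock_weight xs)" using fock_in_wspace by fastforce
      then show "f (fock xs) w = f' (fock xs) w" using that by simp
    qed (use that in auto)
  qed
  have "?P (THE f. ?P f)"
    by (rule theI[of ?P, OF P]) (rule uniq[OF _ P])
  then show ?thesis unfolding zero_mode_def .
qed

lemma clin_zero_mode_left: "clin (\<lambda>v. zero_mode v w)"
  and zero_mode_weight_space: "v \<in> weight_space k \<Longrightarrow> zero_mode v = vmode v (int k - 1)"
  using zero_mode_spec by auto

lemma zero_mode_wspace:
  assumes "v \<in> wspace k"
  shows "zero_mode v = vmode v (k - 1)"
proof (cases "k < 0")
  case True
  then show ?thesis using assms
    by (auto simp: wspace_neg fun_eq_iff clin_zero[OF clin_zero_mode_left] clin_zero[OF clin_vmode_left])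
next
  case False
  then show ?thesis using zero_mode_weight_space[of v "nat k"] assms by (simp add: wspace_def)
qed

lemma boson_wspace_induct [case_names homogeneous add]:
  assumes "\<And>v k. v \<in> wspace k \<Longrightarrow> P v" "\<And>v w. P v \<Longrightarrow> P w \<Longrightarrow> P (v + w)"
  shows "P v"
  using fock_span[of v]
proof (induction rule: cvs.span_induct_alt)
  case base
  show ?case using assms(1)[OF wspace_zero] .
next
  case (step c x y)
  then obtain xs where "x = fock xs" "admissible xs" by (auto simp: fock_vectors_def)
  then have "c *\<^sub>C x \<in> wspace (int (fock_weight xs))" by (auto simp del: wspace_int intro!: wspace_scale fock_in_wspace)
  then show ?case using step.IH assms by blast
qed

lemma zero_mode_preserves: "w \<in> wspace z \<Longrightarrow> zero_mode v w \<in> wspace z"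
proof (induction v rule: boson_wspace_induct)
  case (homogeneous v k)
  then show ?case by (auto simp: zero_mode_wspace intro: vmode_wspace)
qed (simp add: clin_add[OF clin_zero_mode_left] wspace_add)

section \<open>Graded traces, the recursion for trace functions, and the character of M(1)\<close>

section \<open>Traces\<close>

definition fin_dim :: "'v::complex_vec set \<Rightarrow> bool" where
  "fin_dim S \<longleftrightarrow> cvs.subspace S \<and> (\<exists>F. finite F \<and> S \<subseteq> cvs.span F)"

definition basis_of :: "'v::complex_vec set \<Rightarrow> 'v set" where
  "basis_of S = (SOME B. cvs.independent B \<and> cvs.span B = S)"

lemma basis_of:
  assumes "fin_dim S"
  shows "cvs.independent (basis_of S)" "cvs.span (basis_of S) = S" "finite (basis_of S)"
proof -
  have sub: "cvs.subspace S" using assms by (simp add: fin_dim_def)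
  obtain B where B: "B \<subseteq> S" "cvs.independent B" "S \<subseteq> cvs.span B"
    by (rule cvs.maximal_independent_subset)
  then have "cvs.span B = S" using cvs.span_minimal[OF B(1) sub] by blast
  then have "\<exists>B. cvs.independent B \<and> cvs.span B = S" using B by blast
  then have *: "cvs.independent (basis_of S) \<and> cvs.span (basis_of S) = S"
    unfolding basis_of_def by (rule someI_ex)
  then show "cvs.independent (basis_of S)" "cvs.span (basis_of S) = S" by auto
  obtain F where F: "finite F" "S \<subseteq> cvs.span F" using assms by (auto simp: fin_dim_def)
  have "basis_of S \<subseteq> cvs.span F" using * F(2) cvs.span_superset by blast
  then show "finite (basis_of S)" using cvs.independent_span_bound[OF F(1)] * by blast
qed

lemma trace_on_eq: "trace_on S T = (\<Sum>b\<in>basis_of S. cvs.representation (basis_of S) (T b) b)"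
  unfolding trace_on_def basis_of_def Let_def ..

lemma basis_of_subset: "fin_dim S \<Longrightarrow> b \<in> basis_of S \<Longrightarrow> b \<in> S"
  using basis_of(2) cvs.span_base by blast

lemma trace_on_cong:
  assumes "fin_dim S" "\<And>v. v \<in> S \<Longrightarrow> T v = U v"
  shows "trace_on S T = trace_on S U"
  unfolding trace_on_eq using assms by (intro sum.cong refl) (auto dest: basis_of_subset)

lemma trace_on_add:
  assumes "fin_dim S" "\<And>v. v \<in> S \<Longrightarrow> T v \<in> S" "\<And>v. v \<in> S \<Longrightarrow> U v \<in> S"
  shows "trace_on S (\<lambda>v. T v + U v) = trace_on S T + trace_on S U"
proof -
  have "cvs.representation (basis_of S) (T b + U b) b =
      cvs.representation (basis_of S) (T b) b + cvs.representation (basis_of S) (U b) b"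
    if "b \<in> basis_of S" for b
    using basis_of[OF assms(1)] assms(2,3)[OF basis_of_subset[OF assms(1) that]]
    by (simp add: cvs.representation_add)
  then show ?thesis unfolding trace_on_eq by (simp add: sum.distrib)
qed

lemma trace_on_scale:
  assumes "fin_dim S" "\<And>v. v \<in> S \<Longrightarrow> T v \<in> S"
  shows "trace_on S (\<lambda>v. c *\<^sub>C T v) = c * trace_on S T"
proof -
  have "cvs.representation (basis_of S) (c *\<^sub>C T b) b = c * cvs.representation (basis_of S) (T b) b"
    if "b \<in> basis_of S" for b
    using basis_of[OF assms(1)] assms(2)[OF basis_of_subset[OF assms(1) that]]
    by (simp add: cvs.representation_scale)
  then show ?thesis unfolding trace_on_eq by (simp add: sum_distrib_left)
qed

lemma trace_on_zero: "trace_on S (\<lambda>v. 0) = 0"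
  by (simp add: trace_on_eq cvs.representation_zero)

lemma trace_on_sum:
  assumes "fin_dim S" "\<And>i v. i \<in> I \<Longrightarrow> v \<in> S \<Longrightarrow> T i v \<in> S"
  shows "trace_on S (\<lambda>v. \<Sum>i\<in>I. T i v) = (\<Sum>i\<in>I. trace_on S (T i))"
  using assms(2)
proof (induction I rule: infinite_finite_induct)
  case (insert i I)
  have "cvs.subspace S" using assms(1) by (simp add: fin_dim_def)
  then show ?case using insert
    by (simp add: trace_on_add[OF assms(1)] cvs.subspace_sum)
qed (simp_all add: trace_on_zero)

text \<open>Cyclicity of the trace for maps between two different spaces, as required by modes that
  change the weight.\<close>

lemma trace_on_commute:
  assumes S: "fin_dim S" and S': "fin_dim S'"
    and A: "clin A" "\<And>v. v \<in> S \<Longrightarrow> A v \<in> S'" and C: "clin C" "\<And>v. v \<in> S' \<Longrightarrow> C v \<in> S"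
  shows "trace_on S (\<lambda>v. C (A v)) = trace_on S' (\<lambda>v. A (C v))"
proof -
  let ?B = "basis_of S" and ?B' = "basis_of S'"
  note b = basis_of[OF S] basis_of_subset[OF S] and b' = basis_of[OF S'] basis_of_subset[OF S']
  have 1: "cvs.representation ?B (C v) x = (\<Sum>y\<in>?B'. cvs.representation ?B' v y * cvs.representation ?B (C y) x)"
    if "v \<in> S'" for v x
  proof -
    have "v = (\<Sum>y\<in>?B'. cvs.representation ?B' v y *\<^sub>C y)"
      using b' that by (intro cvs.sum_representation_eq[symmetric]) auto
    then have "C v = (\<Sum>y\<in>?B'. cvs.representation ?B' v y *\<^sub>C C y)"
      using C(1) by (metis (no_types, lifting) clin_scale clin_sum sum.cong)
    moreover have "C y \<in> cvs.span ?B" if "y \<in> ?B'" for y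
      using C(2) b b' that by blast
    ultimately show ?thesis using b(1)
      by (simp add: cvs.representation_sum cvs.span_scale cvs.representation_scale)
  qed
  have 2: "cvs.representation ?B' (A v) x = (\<Sum>y\<in>?B. cvs.representation ?B v y * cvs.representation ?B' (A y) x)"
    if "v \<in> S" for v x
  proof -
    have "v = (\<Sum>y\<in>?B. cvs.representation ?B v y *\<^sub>C y)"
      using b that by (intro cvs.sum_representation_eq[symmetric]) auto
    then have "A v = (\<Sum>y\<in>?B. cvs.representation ?B v y *\<^sub>C A y)"
      using A(1) by (metis (no_types, lifting) clin_scale clin_sum sum.cong)
    moreover have "A y \<in> cvs.span ?B'" if "y \<in> ?B" for y
      using A(2) b b' that by blast
    ultimately show ?thesis using b'(1)
      by (simp add: cvs.representation_sum cvs.span_scale cvs.representation_scale)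
  qed
  have "trace_on S (\<lambda>v. C (A v)) = (\<Sum>x\<in>?B. \<Sum>y\<in>?B'. cvs.representation ?B' (A x) y * cvs.representation ?B (C y) x)"
    unfolding trace_on_eq by (intro sum.cong refl 1 A b)
  also have "\<dots> = (\<Sum>y\<in>?B'. \<Sum>x\<in>?B. cvs.representation ?B (C y) x * cvs.representation ?B' (A x) y)"
    by (subst sum.swap) (simp add: mult.commute)
  also have "\<dots> = trace_on S' (\<lambda>v. A (C v))"
    unfolding trace_on_eq by (intro sum.cong refl 2[symmetric] C b')
  finally show ?thesis .
qed

lemma trace_on_id:
  assumes "fin_dim S"
  shows "trace_on S (\<lambda>v. v) = of_nat (cvs.dim S)"
proof -
  note b = basis_of[OF assms]
  have "trace_on S (\<lambda>v. v) = (\<Sum>x\<in>basis_of S. 1)"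
    unfolding trace_on_eq using b by (intro sum.cong refl) (simp add: cvs.representation_basis)
  also have "\<dots> = of_nat (card (basis_of S))" by simp
  also have "card (basis_of S) = cvs.dim S"
    using cvs.dim_eq_card_independent[OF b(1)] b(2) cvs.dim_span by metis
  finally show ?thesis .
qed

section \<open>A basis of each weight space\<close>

definition mset_weight :: "('h \<times> nat) multiset \<Rightarrow> nat" where
  "mset_weight M = sum_mset (image_mset snd M)"

definition weight_msets :: "nat \<Rightarrow> ('h::quad_space \<times> nat) multiset set" where
  "weight_msets n = {M. set_mset M \<subseteq> hbasis \<times> {1..} \<and> mset_weight M = n}"

definition fock_mset :: "('h::quad_space \<times> nat) multiset \<Rightarrow> 'h boson" where
  "fock_mset M = fock (SOME xs. mset xs = M)"

lemma mset_weight_simps [simp]: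
  "mset_weight {#} = 0" "mset_weight (add_mset (h, n) M) = n + mset_weight M"
  "mset_weight (M + N) = mset_weight M + mset_weight N"
  by (simp_all add: mset_weight_def)

lemma mset_weight_mset: "mset_weight (mset xs) = fock_weight xs"
  by (simp add: mset_weight_def fock_weight_def sum_mset_sum_list mset_map[symmetric] del: mset_map)

lemma fock_mset_mset:
  assumes "admissible xs"
  shows "fock_mset (mset xs) = fock xs"
proof -
  have "mset (SOME ys. mset ys = mset xs) = mset xs" by (rule someI) (rule refl)
  from fock_perm[OF assms this[symmetric]] show ?thesis unfolding fock_mset_def by (rule sym)
qed

lemma weight_msetsE:
  assumes "M \<in> weight_msets n"
  obtains xs where "M = mset xs" "admissible xs" "fst ` set xs \<subseteq> hbasis" "fock_weight xs = n"
proof -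
  obtain xs where xs: "M = mset xs" by (metis ex_mset)
  show ?thesis
  proof (rule that[OF xs])
    show "fock_weight xs = n" "fst ` set xs \<subseteq> hbasis"
      using assms by (auto simp: weight_msets_def xs mset_weight_mset)
    show "admissible xs"
      using assms by (auto simp: weight_msets_def xs admissible_def)
  qed
qed

lemma mset_in_weight_msets:
  "admissible xs \<Longrightarrow> fst ` set xs \<subseteq> hbasis \<Longrightarrow> mset xs \<in> weight_msets (fock_weight xs)"
  by (auto simp: weight_msets_def admissible_def mset_weight_mset)

lemma model_of_fock_mset: "M \<in> weight_msets n \<Longrightarrow> model_of (fock_mset M) = xmon M"
  by (erule weight_msetsE) (simp add: fock_mset_mset model_of_fock)

lemma finite_weight_msets: "finite (weight_msets n :: ('h::quad_space \<times> nat) multiset set)"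
proof (rule finite_subset)
  show "weight_msets n \<subseteq> mset ` {xs. set xs \<subseteq> (hbasis :: 'h set) \<times> {1..n} \<and> length xs \<le> n}"
  proof
    fix M :: "('h \<times> nat) multiset" assume "M \<in> weight_msets n"
    then obtain xs where xs: "M = mset xs" "admissible xs" "fst ` set xs \<subseteq> hbasis" "fock_weight xs = n"
      by (rule weight_msetsE)
    have "admissible ys \<Longrightarrow> length ys \<le> fock_weight ys" for ys :: "('h \<times> nat) list"
      by (induction ys) auto
    from this[OF xs(2)] have "length xs \<le> n" using xs(4) by simp
    moreover have "snd x \<le> n" if "x \<in> set xs" for x
      using that xs(4) member_le_sum_list[of "snd x" "map snd xs"] by (auto simp: fock_weight_def)
    ultimately show "M \<in> mset ` {xs. set xs \<subseteq> (hbasis :: 'h set) \<times> {1..n} \<and> length xs \<le> n}"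
      using xs(2,3) unfolding xs(1) by (intro imageI) (auto simp: admissible_def)
  qed
  show "finite (mset ` {xs. set xs \<subseteq> (hbasis :: 'h set) \<times> {1..n} \<and> length xs \<le> n})"
    by (intro finite_imageI finite_lists_length_le) simp
qed

lemma weight_space_span:
  "weight_space n = cvs.span (fock_mset ` (weight_msets n :: ('h::quad_space \<times> nat) multiset set))"
proof
  have gen: "fock (xs @ ys) \<in> cvs.span (fock_mset ` weight_msets (fock_weight (xs @ ys)))"
    if "admissible xs" "admissible ys" "fst ` set ys \<subseteq> hbasis" for xs ys :: "('h \<times> nat) list"
    using that
  proof (induction xs arbitrary: ys)
    case Nil
    then have "fock_mset (mset ys) \<in> fock_mset ` weight_msets (fock_weight ys)"
      by (intro imageI mset_in_weight_msets)
    then show ?case using Nil by (auto simp: fock_mset_mset intro: cvs.span_base)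
  next
    case (Cons x xs)
    obtain h n where x: "x = (h, n)" by force
    have n: "n \<ge> 1" "admissible (xs @ ys)" using Cons.prems x by auto
    have "hmode b (- int n) (fock (xs @ ys)) \<in> cvs.span (fock_mset ` weight_msets (fock_weight ((x # xs) @ ys)))"
      if "b \<in> hbasis" for b
    proof -
      have "fock (xs @ (b, n) # ys) \<in> cvs.span (fock_mset ` weight_msets (fock_weight (xs @ (b, n) # ys)))"
        using Cons that n by (intro Cons.IH) (auto simp: x)
      moreover have "fock (xs @ (b, n) # ys) = fock ((b, n) # xs @ ys)"
        using n by (intro fock_perm) auto
      ultimately show ?thesis by (simp add: x add_ac)
    qed
    moreover have "hmode h (- int n) v = (\<Sum>b\<in>hbasis. coord h b *\<^sub>C hmode b (- int n) v)" for v
    proof -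
      have "hmode (\<Sum>b\<in>A. coord h b *\<^sub>C b) m v = (\<Sum>b\<in>A. coord h b *\<^sub>C hmode b m v)" if "finite A" for A m
        using that
      proof induction
        case empty
        show ?case using hmode_scale_left[of 0 0] by simp
      qed (simp add: hmode_add_left hmode_scale_left)
      from this[OF finite_hbasis, of "- int n"] show ?thesis by (simp add: coord_expand)
    qed
    ultimately show ?case by (auto simp: x intro!: cvs.span_sum cvs.span_scale)
  qed
  show "weight_space n \<subseteq> cvs.span (fock_mset ` (weight_msets n :: ('h \<times> nat) multiset set))"
    unfolding weight_space_def
  proof (rule cvs.span_minimal[OF _ cvs.subspace_span], clarify)
    fix xs :: "('h \<times> nat) list" assume "admissible xs" "n = sum_list (map snd xs)"
    then show "fock xs \<in> cvs.span (fock_mset ` weight_msets (sum_list (map snd xs)))"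
      using gen[of xs "[]"] by (simp add: fock_weight_def)
  qed
  show "cvs.span (fock_mset ` (weight_msets n :: ('h \<times> nat) multiset set)) \<subseteq> weight_space n"
  proof (rule cvs.span_minimal)
    show "fock_mset ` (weight_msets n :: ('h \<times> nat) multiset set) \<subseteq> weight_space n"
    proof clarify
      fix M :: "('h \<times> nat) multiset" assume "M \<in> weight_msets n"
      then obtain xs where "M = mset xs" "admissible xs" "fock_weight xs = n"
        by (elim weight_msetsE) blast
      then show "fock_mset M \<in> weight_space n"
        using fock_in_wspace[of xs "int n"] by (simp add: fock_mset_mset)
    qed
  qed (simp add: weight_space_def)
qed

lemma fin_dim_wspace: "fin_dim (wspace z)"
  unfolding fin_dim_def
proof
  show "\<exists>F. finite F \<and> wspace z \<subseteq> cvs.span F"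
  proof (cases "z < 0")
    case True
    then show ?thesis by (intro exI[of _ "{}"]) (auto simp: wspace_def)
  next
    case False
    then show ?thesis
      by (intro exI[of _ "fock_mset ` weight_msets (nat z)"])
         (auto simp: wspace_def weight_space_span finite_weight_msets)
  qed
qed (rule subspace_wspace)

text \<open>Independence is read off in the polynomial model, where the vectors become distinct
  monomials.\<close>

lemma dim_weight_space:
  "cvs.dim (weight_space n :: 'h::quad_space boson set) =
     card (weight_msets n :: ('h \<times> nat) multiset set)"
proof -
  let ?W = "weight_msets n :: ('h \<times> nat) multiset set"
  have inj: "inj_on fock_mset ?W"
  proof (rule inj_onI)
    fix M N assume "M \<in> ?W" "N \<in> ?W" "fock_mset M = fock_mset N"
    then have "xmon M = xmon N"
      using model_of_fock_mset[of M n] model_of_fock_mset[of N n] by (simp only:)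
    then have "Poly_Mapping.lookup (xmon M) M = Poly_Mapping.lookup (xmon N) M" by (simp only:)
    then show "M = N" by (simp add: lookup_single when_def split: if_splits)
  qed
  have "cvs.independent (fock_mset ` ?W)"
  proof (rule cvs.independent_if_scalars_zero)
    show "finite (fock_mset ` ?W)" by (simp add: finite_weight_msets)
    fix f v assume s: "(\<Sum>x\<in>fock_mset ` ?W. f x *\<^sub>C x) = 0" and "v \<in> fock_mset ` ?W"
    then obtain N where N: "N \<in> ?W" "v = fock_mset N" by blast
    have "0 = model_of (\<Sum>x\<in>fock_mset ` ?W. f x *\<^sub>C x)" by (simp add: s clin_zero[OF clin_model_of])
    also have "\<dots> = (\<Sum>M\<in>?W. f (fock_mset M) *\<^sub>C xmon M)"
      by (simp add: sum.reindex[OF inj] clin_sum[OF clin_model_of] clin_scale[OF clin_model_of] model_of_fock_mset)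
    finally have eq: "(\<Sum>M\<in>?W. f (fock_mset M) *\<^sub>C xmon M) = 0" by (rule sym)
    have "0 = Poly_Mapping.lookup (\<Sum>M\<in>?W. f (fock_mset M) *\<^sub>C xmon M) N"
      unfolding eq by simp
    also have "\<dots> = (\<Sum>M\<in>?W. if M = N then f (fock_mset N) else 0)"
      by (auto simp: lookup_sum lookup_single when_def cscale_complex_def intro!: sum.cong)
    also have "\<dots> = f v" using N by (simp add: finite_weight_msets)
    finally show "f v = 0" by simp
  qed
  from cvs.dim_eq_card_independent[OF this] show ?thesis
    by (simp only: weight_space_span cvs.dim_span card_image[OF inj])
qed

section \<open>Trace functions\<close>

definition ztrace :: "'h::quad_space boson \<Rightarrow> complex fps" where
  "ztrace v = Abs_fps (\<lambda>n. trace_on (weight_space n) (zero_mode v))"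

lemma ztrace_nth: "fps_nth (ztrace v) n = trace_on (wspace (int n)) (zero_mode v)"
  by (simp add: ztrace_def)

lemma ztrace_add: "ztrace (u + v) = ztrace u + ztrace v"
proof (rule fps_ext)
  fix n
  have "zero_mode (u + v) = (\<lambda>w. zero_mode u w + zero_mode v w)"
    by (simp add: fun_eq_iff clin_add[OF clin_zero_mode_left])
  then show "fps_nth (ztrace (u + v)) n = fps_nth (ztrace u + ztrace v) n"
    by (simp add: ztrace_nth trace_on_add[OF fin_dim_wspace] zero_mode_preserves del: wspace_int)
qed

lemma ztrace_scale: "ztrace (c *\<^sub>C v) = fps_const c * ztrace v"
proof (rule fps_ext)
  fix n
  have "zero_mode (c *\<^sub>C v) = (\<lambda>w. c *\<^sub>C zero_mode v w)"
    by (simp add: fun_eq_iff clin_scale[OF clin_zero_mode_left])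
  then show "fps_nth (ztrace (c *\<^sub>C v)) n = fps_nth (fps_const c * ztrace v) n"
    by (simp add: ztrace_nth trace_on_scale[OF fin_dim_wspace] zero_mode_preserves del: wspace_int)
qed

lemma ztrace_zero: "ztrace 0 = 0"
  using ztrace_scale[of 0 0] by simp

lemma ztrace_vac_nth: "fps_nth (ztrace (vac :: 'h::quad_space boson)) n = of_nat (card (weight_msets n :: ('h \<times> nat) multiset set))"
proof -
  have "zero_mode vac = (\<lambda>v :: 'h boson. v)"
    using zero_mode_wspace[OF vac_in_wspace] by (simp add: fun_eq_iff vmode_vac)
  moreover have "trace_on (weight_space n) (\<lambda>v :: 'h boson. v) = of_nat (cvs.dim (weight_space n :: 'h boson set))"
    using trace_on_id[OF fin_dim_wspace[of "int n"]] by simp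
  ultimately show ?thesis by (simp add: ztrace_nth dim_weight_space)
qed

section \<open>Lambert series\<close>

text \<open>The series \<open>q\<^sup>i / (1 - q\<^sup>i)\<close>.\<close>

definition lambert :: "nat \<Rightarrow> complex fps" where
  "lambert i = Abs_fps (\<lambda>n. if n \<noteq> 0 \<and> i dvd n then 1 else 0)"

lemma fps_X_power_mult_nth': "fps_nth (fps_X ^ i * f) n = (if n < i then 0 else fps_nth f (n - i))"
  for f :: "complex fps"
  by (simp add: fps_X_power_mult_nth)

lemma lambert_mult:
  assumes "i \<ge> 1"
  shows "(1 - fps_X ^ i) * lambert i = fps_X ^ i"
proof (rule fps_ext)
  fix n
  show "fps_nth ((1 - fps_X ^ i) * lambert i) n = fps_nth (fps_X ^ i) n"
    using assms dvd_minus_self[of i n]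
    by (auto simp: left_diff_distrib fps_X_power_mult_nth' lambert_def dest: dvd_imp_le)
qed

lemma one_minus_X_power_nz: "i \<ge> 1 \<Longrightarrow> (1 - fps_X ^ i :: complex fps) \<noteq> 0"
proof
  assume i: "i \<ge> 1" and "(1 - fps_X ^ i :: complex fps) = 0"
  then have "fps_nth (1 - fps_X ^ i :: complex fps) 0 = 0" by (simp only: fps_zero_nth)
  then show False using i by simp
qed

text \<open>The recursion is the coefficientwise form of (1 - q^i) F = q^i S. Both the traces of
  normally ordered modes and the counts of parts in the character satisfy it.\<close>

lemma lambert_unique:
  assumes "i \<ge> 1" "\<And>n. fps_nth F n = (if n < i then 0 else fps_nth F (n - i) + fps_nth S (n - i))"
  shows "F = lambert i * S"
proof -
  have "F = fps_X ^ i * (F + S)"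
  proof (rule fps_ext)
    fix n
    show "fps_nth F n = fps_nth (fps_X ^ i * (F + S)) n"
      unfolding fps_X_power_mult_nth' by (subst assms(2)) simp
  qed
  then have "(1 - fps_X ^ i) * F = fps_X ^ i * S" by (simp add: algebra_simps)
  also have "\<dots> = (1 - fps_X ^ i) * (lambert i * S)"
    using lambert_mult[OF assms(1)] by (simp add: mult.assoc[symmetric])
  finally show ?thesis using one_minus_X_power_nz[OF assms(1)] by simp
qed

text \<open>The Lambert series \<Sum> c(i) q^i / (1 - q^i), with its coefficients already collected
  as divisor sums.\<close>

definition divisor_series :: "(nat \<Rightarrow> complex) \<Rightarrow> complex fps" where
  "divisor_series c = Abs_fps (\<lambda>n. if n = 0 then 0 else \<Sum>i | i dvd n. c i)"

lemma divisor_series_mult_nth: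
  assumes "n \<le> K"
  shows "(\<Sum>i=1..K. c i * fps_nth (lambert i * \<phi>) n) = fps_nth (divisor_series c * \<phi>) n"
proof -
  have eq: "(\<Sum>i=1..K. c i * fps_nth (lambert i) a) = fps_nth (divisor_series c) a" if "a \<le> K" for a
  proof (cases "a = 0")
    case False
    have "(\<Sum>i=1..K. c i * fps_nth (lambert i) a) = (\<Sum>i=1..K. if i dvd a then c i else 0)"
      using False by (intro sum.cong) (auto simp: lambert_def)
    also have "\<dots> = (\<Sum>i\<in>{1..K} \<inter> {i. i dvd a}. c i)"
      by (simp add: sum.inter_restrict)
    also have "{1..K} \<inter> {i. i dvd a} = {i. i dvd a}"
    proof -
      have "1 \<le> i \<and> i \<le> K" if "i dvd a" for i
        using dvd_imp_le[OF that] dvd_pos_nat[OF _ that] False \<open>a \<le> K\<close> by auto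
      then show ?thesis by auto
    qed
    finally show ?thesis using False by (simp add: divisor_series_def)
  qed (simp add: divisor_series_def lambert_def)
  have "(\<Sum>i=1..K. c i * fps_nth (lambert i * \<phi>) n) =
      (\<Sum>i=1..K. \<Sum>a=0..n. c i * fps_nth (lambert i) a * fps_nth \<phi> (n - a))"
    by (simp add: fps_mult_nth sum_distrib_left mult.assoc)
  also have "\<dots> = (\<Sum>a=0..n. \<Sum>i=1..K. c i * fps_nth (lambert i) a * fps_nth \<phi> (n - a))"
    by (rule sum.swap)
  also have "\<dots> = (\<Sum>a=0..n. (\<Sum>i=1..K. c i * fps_nth (lambert i) a) * fps_nth \<phi> (n - a))"
    by (simp add: sum_distrib_right)
  also have "\<dots> = fps_nth (divisor_series c * \<phi>) n"
    unfolding fps_mult_nth by (rule sum.cong[OF refl], subst eq) (use assms in auto)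
  finally show ?thesis .
qed

lemma divisor_series_scale: "divisor_series (\<lambda>i. a * c i) = fps_const a * divisor_series c"
  by (rule fps_ext) (simp add: divisor_series_def sum_distrib_left)

lemma divisor_series_add: "divisor_series (\<lambda>i. b i + c i) = divisor_series b + divisor_series c"
  by (rule fps_ext) (simp add: divisor_series_def sum.distrib)

section \<open>The recursion for trace functions\<close>

text \<open>The binomials come from the commutator of h(i) or h(-i) with v, the factors
  \<open>np_coeff\<close> from the expansion of the field of h(-k). Negative modes enter with the
  opposite sign because their normal ordering is the reverse one.\<close>

definition trace_coeff :: "nat \<Rightarrow> nat \<Rightarrow> complex fps" where
  "trace_coeff k l = divisor_series (\<lambda>i. np_coeff k (int i) * (of_int (int i) gchoose l)
      - np_coeff k (- int i) * (of_int (- int i) gchoose l))"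

lemma nmode_wspace:
  assumes "\<And>z w. w \<in> wspace z \<Longrightarrow> X w \<in> wspace (z + i)" "w \<in> wspace z"
  shows "nmode h i X w \<in> wspace z"
  using hmode_wspace[OF assms(1)[OF assms(2)], of z i h] assms(1)[OF hmode_wspace[OF assms(2) refl], of h i]
  by (simp add: nmode_def)

context
  fixes h :: "'h::quad_space" and v :: "'h boson" and m :: int and L :: nat
  assumes v: "v \<in> wspace m"
    and comm: "\<And>j n w. hmode h j (vmode v n w) = vmode v n (hmode h j w) +
       (\<Sum>l\<le>L. (of_int j gchoose l) *\<^sub>C vmode (hmode h (int l) v) (n + j - int l) w)"
begin

text \<open>The mode of v that raises weights by i; combined with h(i), which lowers them by i, it
  preserves each weight space.\<close>

private definition X :: "int \<Rightarrow> 'h boson \<Rightarrow> 'h boson" where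
  "X i = vmode v (m - 1 - i)"

private lemma X_wspace: "w \<in> wspace z \<Longrightarrow> z' = z + i \<Longrightarrow> X i w \<in> wspace z'"
  unfolding X_def by (rule vmode_wspace[OF v]) auto

private lemma clin_X: "clin (X i)"
  unfolding X_def by (rule clin_vmode)

private definition tau :: "int \<Rightarrow> int \<Rightarrow> complex" where
  "tau i z = trace_on (wspace z) (nmode h i (X i))"

text \<open>The graded trace of the commutator of h(i) with \<open>X i\<close>, a combination of the
  operators o(h(l)v).\<close>

private definition S :: "int \<Rightarrow> complex fps" where
  "S i = (\<Sum>l\<le>L. fps_const (of_int i gchoose l) * ztrace (hmode h (int l) v))"

private lemma X_commutator:
  "hmode h i (X i w) = X i (hmode h i w) + (\<Sum>l\<le>L. (of_int i gchoose l) *\<^sub>C zero_mode (hmode h (int l) v) w)"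
proof -
  have "zero_mode (hmode h (int l) v) = vmode (hmode h (int l) v) (m - 1 - i + i - int l)" for l
    using zero_mode_wspace[OF hmode_wspace[OF v refl], of h "int l"] by (simp add: algebra_simps)
  then show ?thesis unfolding X_def comm[of i] by simp
qed

private lemma S_nth:
  "trace_on (wspace (int n)) (\<lambda>w. \<Sum>l\<le>L. (of_int i gchoose l) *\<^sub>C zero_mode (hmode h (int l) v) w) = fps_nth (S i) n"
proof -
  have "trace_on (wspace (int n)) (\<lambda>w. \<Sum>l\<le>L. (of_int i gchoose l) *\<^sub>C zero_mode (hmode h (int l) v) w)
     = (\<Sum>l\<le>L. trace_on (wspace (int n)) (\<lambda>w. (of_int i gchoose l) *\<^sub>C zero_mode (hmode h (int l) v) w))"
    by (rule trace_on_sum[OF fin_dim_wspace]) (intro wspace_scale zero_mode_preserves)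
  also have "\<dots> = fps_nth (S i) n"
    by (simp add: S_def fps_sum_nth ztrace_nth trace_on_scale[OF fin_dim_wspace] zero_mode_preserves del: wspace_int)
  finally show ?thesis .
qed

private lemma S_preserves:
  "w \<in> wspace z \<Longrightarrow> (\<Sum>l\<le>L. (of_int i gchoose l) *\<^sub>C zero_mode (hmode h (int l) v) w) \<in> wspace z"
  by (intro wspace_sum wspace_scale zero_mode_preserves)

text \<open>Cyclicity moves \<open>X i\<close> h(i) on weight n to h(i) \<open>X i\<close> on weight
  n - i; restoring the normal order costs the commutator, whose trace is \<open>S i\<close>.\<close>

private lemma tau_pos:
  assumes "i > 0" "n \<ge> nat i"
  shows "tau i (int n) = tau i (int (n - nat i)) + fps_nth (S i) (n - nat i)"
proof -
  let ?z = "int n" and ?z' = "int (n - nat i)"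
  have z': "?z' = ?z - i" using assms by (simp add: of_nat_diff)
  have "tau i ?z = trace_on (wspace ?z) (\<lambda>w. X i (hmode h i w))"
    using assms by (simp add: tau_def nmode_def[abs_def])
  also have "\<dots> = trace_on (wspace ?z') (\<lambda>w. hmode h i (X i w))"
    by (rule trace_on_commute[OF fin_dim_wspace fin_dim_wspace clin_hmode _ clin_X])
       (auto simp: z' intro: hmode_wspace X_wspace simp del: wspace_int)
  also have "\<dots> = trace_on (wspace ?z') (\<lambda>w. nmode h i (X i) w +
      (\<Sum>l\<le>L. (of_int i gchoose l) *\<^sub>C zero_mode (hmode h (int l) v) w))"
    unfolding X_commutator using assms by (simp add: nmode_def)
  also have "\<dots> = tau i ?z' + fps_nth (S i) (n - nat i)"
    unfolding tau_def S_nth[symmetric]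
    by (rule trace_on_add[OF fin_dim_wspace]) (auto intro: nmode_wspace X_wspace S_preserves simp del: wspace_int)
  finally show ?thesis .
qed

text \<open>For i < 0 the normal order is h(i) \<open>X i\<close>, so the same argument runs
  backwards and the commutator appears with a minus sign.\<close>

private lemma tau_neg:
  assumes "i < 0" "n \<ge> nat (- i)"
  shows "tau i (int n) = tau i (int (n - nat (- i))) + fps_nth (- S i) (n - nat (- i))"
proof -
  let ?z = "int n" and ?z' = "int (n - nat (- i))"
  have z': "?z' = ?z + i" using assms by (simp add: of_nat_diff)
  have "tau i ?z = trace_on (wspace ?z) (\<lambda>w. hmode h i (X i w))"
    using assms by (simp add: tau_def nmode_def[abs_def])
  also have "\<dots> = trace_on (wspace ?z') (\<lambda>w. X i (hmode h i w))"
    by (rule trace_on_commute[OF fin_dim_wspace fin_dim_wspace clin_X _ clin_hmode])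
       (auto simp: z' intro: hmode_wspace X_wspace simp del: wspace_int)
  finally have 1: "tau i ?z = trace_on (wspace ?z') (\<lambda>w. X i (hmode h i w))" .
  have "tau i ?z' = trace_on (wspace ?z') (\<lambda>w. hmode h i (X i w))"
    using assms by (simp add: tau_def nmode_def[abs_def])
  also have "\<dots> = trace_on (wspace ?z') (\<lambda>w. X i (hmode h i w)) + fps_nth (S i) (n - nat (- i))"
    unfolding S_nth[symmetric] X_commutator
    by (rule trace_on_add[OF fin_dim_wspace])
       (auto intro: X_wspace[OF hmode_wspace] S_preserves simp del: wspace_int)
  finally show ?thesis using 1 by simp
qed

private lemma tau_small: "int n < \<bar>i\<bar> \<Longrightarrow> tau i (int n) = 0"
proof -
  assume n: "int n < \<bar>i\<bar>"
  have "nmode h i (X i) w = 0" if "w \<in> wspace (int n)" for w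
  proof (cases "i < 0")
    case True
    have "X i w \<in> wspace (int n + i)" by (rule X_wspace[OF that refl])
    then have "X i w = 0" using True n by (simp add: wspace_neg)
    then show ?thesis using True by (simp add: nmode_def hmode_zero)
  next
    case False
    have "hmode h i w \<in> wspace (int n - i)" by (rule hmode_wspace[OF that refl])
    then have "hmode h i w = 0" using False n by (simp add: wspace_neg)
    then show ?thesis using False by (simp add: nmode_def clin_zero[OF clin_X])
  qed
  then have "tau i (int n) = trace_on (wspace (int n)) (\<lambda>w :: 'h boson. 0)"
    using trace_on_cong[OF fin_dim_wspace, of "int n" "nmode h i (X i)" "\<lambda>w. 0"]
    unfolding tau_def by blast
  then show ?thesis by (simp only: trace_on_zero)
qed

private lemma tau_zero: "tau 0 z = 0"
proof -
  have "nmode h 0 (X 0) = (\<lambda>w. 0)" by (simp add: nmode_def[abs_def] hmode_0 clin_zero[OF clin_X])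
  then show ?thesis by (simp add: tau_def trace_on_zero)
qed

private lemma tau_lambert:
  assumes "i \<ge> 1"
  shows "tau (int i) (int n) = fps_nth (lambert i * S (int i)) n"
    and "tau (- int i) (int n) = fps_nth (lambert i * (- S (- int i))) n"
proof -
  have "Abs_fps (\<lambda>n. tau (int i) (int n)) = lambert i * S (int i)"
    by (rule lambert_unique[OF assms]) (use tau_pos[of "int i"] tau_small[of _ "int i"] assms in auto)
  then show "tau (int i) (int n) = fps_nth (lambert i * S (int i)) n"
    by (metis fps_nth_Abs_fps)
  have "Abs_fps (\<lambda>n. tau (- int i) (int n)) = lambert i * (- S (- int i))"
    by (rule lambert_unique[OF assms]) (use tau_neg[of "- int i"] tau_small[of _ "- int i"] assms in auto)
  then show "tau (- int i) (int n) = fps_nth (lambert i * (- S (- int i))) n"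
    by (metis fps_nth_Abs_fps)
qed

private lemma zero_mode_hmode:
  assumes k: "k \<ge> 1" and w: "w \<in> wspace (int n)"
  shows "zero_mode (hmode h (- int k) v) w = (\<Sum>i\<in>{- int n..int n}. np_coeff k i *\<^sub>C nmode h i (X i) w)"
proof -
  have hv: "hmode h (- int k) v \<in> wspace (m + int k)" by (rule hmode_wspace[OF v]) simp
  have X: "vmode v (m + int k - 1 - i - int k) = X i" for i by (simp add: X_def algebra_simps)
  have "\<forall>\<^sub>F M::int in at_top. int n \<le> M" by (rule eventually_ge_at_top)
  then have "\<forall>\<^sub>F M::int in at_top. ?thesis"
    using vmode_hmode[OF k, of h v "m + int k - 1" w]
  proof eventually_elim
    case (elim M)
    have "zero_mode (hmode h (- int k) v) w = (\<Sum>i\<in>{-M..M}. np_coeff k i *\<^sub>C nmode h i (X i) w)"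
      using elim(2) unfolding X by (simp add: zero_mode_wspace[OF hv])
    also have "\<dots> = (\<Sum>i\<in>{- int n..int n}. np_coeff k i *\<^sub>C nmode h i (X i) w)"
    proof (rule sum.mono_neutral_right)
      show "\<forall>i\<in>{-M..M} - {- int n..int n}. np_coeff k i *\<^sub>C nmode h i (X i) w = 0"
      proof
        fix i assume i: "i \<in> {-M..M} - {- int n..int n}"
        have "X i w \<in> wspace (int n + i)" by (rule X_wspace[OF w refl])
        moreover have "hmode h i w \<in> wspace (int n - i)" by (rule hmode_wspace[OF w refl])
        ultimately show "np_coeff k i *\<^sub>C nmode h i (X i) w = 0"
          using i by (auto simp: nmode_def wspace_neg hmode_zero clin_zero[OF clin_X])
      qed
    qed (use elim in auto)
    finally show ?case .
  qed
  then show ?thesis by simp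
qed

lemma ztrace_hmode_aux:
  assumes k: "k \<ge> 1"
  shows "ztrace (hmode h (- int k) v) = (\<Sum>l\<le>L. trace_coeff k l * ztrace (hmode h (int l) v))"
proof (rule fps_ext)
  fix n
  let ?\<phi> = "\<lambda>l. ztrace (hmode h (int l) v)"
  let ?c = "\<lambda>l i. np_coeff k (int i) * (of_int (int i) gchoose l) - np_coeff k (- int i) * (of_int (- int i) gchoose l)"
  have pres: "nmode h i (X i) w \<in> wspace (int n)" if "w \<in> wspace (int n)" for i w
    by (rule nmode_wspace[OF _ that]) (rule X_wspace, auto)
  have "fps_nth (ztrace (hmode h (- int k) v)) n =
      trace_on (wspace (int n)) (\<lambda>w. \<Sum>i\<in>{- int n..int n}. np_coeff k i *\<^sub>C nmode h i (X i) w)"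
    unfolding ztrace_nth by (rule trace_on_cong[OF fin_dim_wspace zero_mode_hmode[OF k]])
  also have "\<dots> = (\<Sum>i\<in>{- int n..int n}. trace_on (wspace (int n)) (\<lambda>w. np_coeff k i *\<^sub>C nmode h i (X i) w))"
    by (rule trace_on_sum[OF fin_dim_wspace]) (intro wspace_scale pres)
  also have "\<dots> = (\<Sum>i\<in>{- int n..int n}. np_coeff k i * tau i (int n))"
    by (intro sum.cong refl) (simp add: tau_def trace_on_scale[OF fin_dim_wspace] pres del: wspace_int)
  \<comment> \<open>The index 0, for which 1 / (1 - q^i) would make no sense, drops out because h(0)
    = 0.\<close>
  also have "\<dots> = (\<Sum>i=1..n. np_coeff k (int i) * tau (int i) (int n) + np_coeff k (- int i) * tau (- int i) (int n))"
  proof -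
    have "{- int n..int n} = insert 0 (int ` {1..n} \<union> (\<lambda>i. - int i) ` {1..n})"
    proof (intro set_eqI iffI)
      fix i assume "i \<in> {- int n..int n}"
      then have "i = 0 \<or> i = int (nat i) \<and> nat i \<in> {1..n} \<or> i = - int (nat (- i)) \<and> nat (- i) \<in> {1..n}" by auto
      then show "i \<in> insert 0 (int ` {1..n} \<union> (\<lambda>i. - int i) ` {1..n})" by blast
    qed auto
    moreover have "(\<Sum>i\<in>insert 0 (int ` {1..n} \<union> (\<lambda>i. - int i) ` {1..n}). np_coeff k i * tau i (int n)) =
       (\<Sum>i\<in>int ` {1..n} \<union> (\<lambda>i. - int i) ` {1..n}. np_coeff k i * tau i (int n))"
      by (subst sum.insert) (auto simp: tau_zero)
    moreover have "\<dots> = (\<Sum>i\<in>int ` {1..n}. np_coeff k i * tau i (int n)) +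
       (\<Sum>i\<in>(\<lambda>i. - int i) ` {1..n}. np_coeff k i * tau i (int n))"
      by (rule sum.union_disjoint) auto
    moreover have "(\<Sum>i\<in>int ` {1..n}. np_coeff k i * tau i (int n)) = (\<Sum>i=1..n. np_coeff k (int i) * tau (int i) (int n))"
      by (subst sum.reindex) (auto simp: inj_on_def)
    moreover have "(\<Sum>i\<in>(\<lambda>i. - int i) ` {1..n}. np_coeff k i * tau i (int n)) =
        (\<Sum>i=1..n. np_coeff k (- int i) * tau (- int i) (int n))"
      by (subst sum.reindex) (auto simp: inj_on_def)
    ultimately show ?thesis by (simp add: sum.distrib)
  qed
  also have "\<dots> = (\<Sum>i=1..n. \<Sum>l\<le>L. ?c l i * fps_nth (lambert i * ?\<phi> l) n)"
  proof (rule sum.cong[OF refl])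
    fix i assume "i \<in> {1..n}"
    then have i: "i \<ge> 1" by simp
    have "fps_nth (lambert i * S j) n = (\<Sum>l\<le>L. (of_int j gchoose l) * fps_nth (lambert i * ?\<phi> l) n)" for j
      by (simp add: S_def sum_distrib_left fps_sum_nth mult.left_commute[of "lambert i"])
    then show "np_coeff k (int i) * tau (int i) (int n) + np_coeff k (- int i) * tau (- int i) (int n) =
       (\<Sum>l\<le>L. ?c l i * fps_nth (lambert i * ?\<phi> l) n)"
      unfolding tau_lambert[OF i]
      by (simp add: left_diff_distrib sum_subtractf sum_distrib_left mult.assoc)
  qed
  also have "\<dots> = (\<Sum>l\<le>L. \<Sum>i=1..n. ?c l i * fps_nth (lambert i * ?\<phi> l) n)"
    by (rule sum.swap)
  also have "\<dots> = (\<Sum>l\<le>L. fps_nth (trace_coeff k l * ?\<phi> l) n)"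
    unfolding trace_coeff_def by (intro sum.cong refl divisor_series_mult_nth) simp
  also have "\<dots> = fps_nth (\<Sum>l\<le>L. trace_coeff k l * ?\<phi> l) n"
    by (simp add: fps_sum_nth)
  finally show "fps_nth (ztrace (hmode h (- int k) v)) n = \<dots>" .
qed

end

text \<open>Every vector is a finite sum of homogeneous ones, and the validity for all large L lets
  their identities be added.\<close>

lemma ztrace_hmode:
  assumes "k \<ge> 1"
  shows "\<forall>\<^sub>F L in sequentially. ztrace (hmode h (- int k) v) = (\<Sum>l\<le>L. trace_coeff k l * ztrace (hmode h (int l) v))"
proof (induction v rule: boson_wspace_induct)
  case (homogeneous v m)
  show ?case
    using vmode_commutator[of h v]
    by eventually_elim (rule ztrace_hmode_aux[OF homogeneous _ assms], blast)
next
  case (add v w)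
  then show ?case
    by eventually_elim (simp add: hmode_add ztrace_add distrib_left sum.distrib)
qed

section \<open>The character\<close>

lemma sum_image_mset_count:
  fixes f :: "'a \<Rightarrow> nat"
  assumes "finite A" "set_mset M \<subseteq> A"
  shows "sum_mset (image_mset f M) = (\<Sum>i\<in>A. f i * count M i)"
  using assms(2)
proof (induction M)
  case (add x M)
  have "(\<Sum>i\<in>A. f i * count (add_mset x M) i) = (\<Sum>i\<in>A. f i * count M i + (if i = x then f i else 0))"
    by (intro sum.cong) auto
  with add assms(1) show ?case by (simp add: sum.distrib)
qed simp

text \<open>Coefficient n of q d/dq counts the basis multisets of weight n with their weight, that
  is, all occurrences of all parts. Removing one copy of the part (b, s) shows that its occurrences
  have generating series q^s / (1 - q^s) times the character.\<close>

lemma ztrace_vac_deriv: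
  "fps_X * fps_deriv (ztrace (vac :: 'h::quad_space boson)) =
     of_nat (card (hbasis :: 'h set)) * divisor_series of_nat * ztrace (vac :: 'h boson)"
proof (rule fps_ext)
  fix n
  let ?A = "\<lambda>n. weight_msets n :: ('h \<times> nat) multiset set" and ?T = "ztrace (vac :: 'h boson)"
  let ?U = "\<lambda>i. Abs_fps (\<lambda>n. \<Sum>M\<in>?A n. of_nat (count M i)) :: complex fps"
  have U: "?U (b, s) = lambert s * ?T" if b: "b \<in> hbasis" "s \<ge> 1" for b s
  proof (rule lambert_unique[OF b(2)])
    fix n
    let ?i = "(b, s)"
    have "(\<Sum>M\<in>?A n. of_nat (count M ?i)) = (\<Sum>M\<in>{M\<in>?A n. ?i \<in># M}. of_nat (count M ?i) :: complex)"
      by (rule sum.mono_neutral_right) (auto simp: finite_weight_msets not_in_iff)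
    also have "\<dots> = (if n < s then 0 else \<Sum>M\<in>?A (n - s). of_nat (count M ?i) + 1)"
    proof (cases "n < s")
      case True
      have "?i \<notin># M" if "M \<in> ?A n" for M
      proof
        assume "?i \<in># M"
        then obtain N where "M = add_mset ?i N" by (metis insert_DiffM)
        then show False using that True by (auto simp: weight_msets_def)
      qed
      then have "{M\<in>?A n. ?i \<in># M} = {}" by auto
      then show ?thesis using True by (simp only: sum.empty if_True)
    next
      case False
      have "(\<Sum>M\<in>{M\<in>?A n. ?i \<in># M}. of_nat (count M ?i)) = (\<Sum>M\<in>?A (n - s). of_nat (count (add_mset ?i M) ?i) :: complex)"
      proof (rule sum.reindex_bij_witness[of _ "add_mset ?i" "\<lambda>M. M - {#?i#}"])
        fix M assume "M \<in> {M\<in>?A n. ?i \<in># M}"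
        then obtain N where N: "M = add_mset ?i N" and M: "M \<in> ?A n" by (auto dest: multi_member_split)
        then show "M - {#?i#} \<in> ?A (n - s)" by (auto simp: weight_msets_def)
        show "add_mset ?i (M - {#?i#}) = M" using N by simp
        show "of_nat (count (add_mset ?i (M - {#?i#})) ?i) = (of_nat (count M ?i) :: complex)" using N by simp
      next
        fix M assume "M \<in> ?A (n - s)"
        then show "add_mset ?i M \<in> {M\<in>?A n. ?i \<in># M}" using b False by (auto simp: weight_msets_def)
      qed simp
      then show ?thesis using False by (simp add: add.commute)
    qed
    finally show "fps_nth (?U ?i) n = (if n < s then 0 else fps_nth (?U ?i) (n - s) + fps_nth ?T (n - s))"
      by (simp add: sum.distrib ztrace_vac_nth)
  qed
  have wt: "mset_weight M = (\<Sum>i\<in>hbasis \<times> {1..n}. snd i * count M i)" if "M \<in> ?A n" for M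
  proof -
    have "snd i \<le> n" if i: "i \<in># M" for i
    proof -
      obtain N where "M = add_mset i N" using i by (metis insert_DiffM)
      then show ?thesis using \<open>M \<in> ?A n\<close> by (cases i) (auto simp: weight_msets_def)
    qed
    then have sub: "set_mset M \<subseteq> hbasis \<times> {1..n}" using that by (auto simp: weight_msets_def)
    show ?thesis unfolding mset_weight_def by (rule sum_image_mset_count[OF _ sub]) simp
  qed
  have "fps_nth (fps_X * fps_deriv ?T) n = of_nat n * fps_nth ?T n"
    by (cases n) auto
  also have "\<dots> = (\<Sum>M\<in>?A n. of_nat (mset_weight M))"
    by (simp add: ztrace_vac_nth weight_msets_def)
  also have "\<dots> = (\<Sum>M\<in>?A n. \<Sum>i\<in>hbasis \<times> {1..n}. of_nat (snd i) * of_nat (count M i))"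
    by (intro sum.cong refl) (simp add: wt)
  also have "\<dots> = (\<Sum>i\<in>hbasis \<times> {1..n}. of_nat (snd i) * fps_nth (?U i) n)"
    by (subst sum.swap) (simp add: sum_distrib_left)
  also have "\<dots> = (\<Sum>i\<in>(hbasis :: 'h set) \<times> {1..n}. of_nat (snd i) * fps_nth (lambert (snd i) * ?T) n)"
    by (intro sum.cong refl) (use U in \<open>auto simp del: fps_nth_Abs_fps\<close>)
  also have "\<dots> = (\<Sum>b\<in>(hbasis :: 'h set). \<Sum>s=1..n. of_nat s * fps_nth (lambert s * ?T) n)"
    unfolding sum.cartesian_product by (simp add: case_prod_beta)
  also have "\<dots> = fps_nth (of_nat (card (hbasis :: 'h set)) * divisor_series of_nat * ?T) n"
    by (simp add: divisor_series_mult_nth[of n n of_nat ?T, simplified] mult.assoc fps_of_nat[symmetric])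
  finally show "fps_nth (fps_X * fps_deriv ?T) n = \<dots>" .
qed

lemma ztrace_vac_0: "fps_nth (ztrace (vac :: 'h::quad_space boson)) 0 = 1"
proof -
  have "M = {#}" if "M \<in> weight_msets 0" for M :: "('h \<times> nat) multiset"
  proof (cases M)
    case (add x N)
    then show ?thesis using that by (cases x) (auto simp: weight_msets_def)
  qed simp
  then have "weight_msets 0 = {{#} :: ('h \<times> nat) multiset}" by (auto simp: weight_msets_def)
  then show ?thesis by (simp add: ztrace_vac_nth)
qed

definition euler_product :: "complex fps" where
  "euler_product = prodinf (\<lambda>n. 1 - fps_X ^ (n + 1))"

text \<open>Factors beyond the k-th leave coefficient k unchanged, so the partial products converge
  in the topology of formal power series.\<close>

lemma euler_product_nth:
  assumes "k \<le> K"
  shows "fps_nth euler_product k = fps_nth (\<Prod>n<K. 1 - fps_X ^ (n + 1)) k"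
proof -
  let ?f = "\<lambda>n. 1 - fps_X ^ (n + 1) :: complex fps"
  have step: "fps_nth (\<Prod>n<K. ?f n) k = fps_nth (\<Prod>n<k. ?f n) k" if "k \<le> K" for k K
    using that
  proof (induction K rule: dec_induct)
    case (step K)
    have "fps_nth ((\<Prod>n<K. ?f n) * fps_X ^ (K + 1)) k = 0"
      using step by (subst mult.commute) (simp only: fps_X_power_mult_nth', simp)
    then show ?case using step by (simp add: right_diff_distrib)
  qed simp
  define P where "P = Abs_fps (\<lambda>k. fps_nth (\<Prod>n<k. ?f n) k)"
  have "(\<lambda>n. \<Prod>i\<le>n. ?f i) \<longlonglongrightarrow> P"
  proof (rule tendsto_fpsI)
    fix k
    show "\<forall>\<^sub>F n in sequentially. fps_nth (\<Prod>i\<le>n. ?f i) k = fps_nth P k"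
      using eventually_ge_at_top[of k]
    proof eventually_elim
      case (elim n)
      then show ?case using step[of k "Suc n"] by (simp only: lessThan_Suc_atMost P_def fps_nth_Abs_fps)
    qed
  qed
  \<comment> \<open>A convergent infinite product in the sense of \<open>has_prod\<close> must have
    a nonzero limit; the constant term is 1.\<close>
  moreover have "P \<noteq> 0"
  proof
    assume "P = 0"
    then have "fps_nth P 0 = 0" by simp
    then show False by (simp add: P_def)
  qed
  ultimately have "?f has_prod P" by (simp add: has_prod_def raw_has_prod_def)
  then have P: "euler_product = P" unfolding euler_product_def by (rule has_prod_unique[symmetric])
  show ?thesis unfolding P using step[OF assms] by (simp only: P_def fps_nth_Abs_fps)
qed

text \<open>Logarithmic derivative: each factor 1 - q^n contributes -n q^n / (1 - q^n).\<close>

lemma euler_product_deriv: "fps_X * fps_deriv euler_product = - divisor_series of_nat * euler_product"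
proof (rule fps_ext)
  fix k
  let ?f = "\<lambda>n. 1 - fps_X ^ n :: complex fps"
  define P where "P = (\<lambda>K. \<Prod>n=1..K. ?f n)"
  have Pk: "fps_nth euler_product a = fps_nth (P K) a" if "a \<le> K" for a K
    unfolding P_def euler_product_nth[OF that] using prod.shift_bounds_cl_Suc_ivl[of ?f 0]
    by (simp add: prod.atLeast1_atMost_eq)
  have D1: "fps_X * fps_deriv (?f n) = - (of_nat n * lambert n) * ?f n" if n: "n \<ge> 1" for n
  proof -
    have "fps_X * fps_deriv (?f n) = - of_nat n * (fps_X * fps_X ^ (n - 1))"
      by (simp add: fps_deriv_power mult_ac fps_of_nat)
    also have "fps_X * fps_X ^ (n - 1) = (fps_X ^ n :: complex fps)"
      using n by (cases n) auto
    also have "- of_nat n * fps_X ^ n = - (of_nat n * lambert n) * ?f n"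
      by (subst lambert_mult[OF n, symmetric]) (simp only: mult_minus_left mult_minus_right mult_ac)
    finally show ?thesis .
  qed
  have D: "fps_X * fps_deriv (P K) = - (\<Sum>n=1..K. of_nat n * lambert n) * P K" for K
  proof (induction K)
    case (Suc K)
    have PS: "P (Suc K) = P K * ?f (Suc K)" by (simp add: P_def)
    have "fps_X * fps_deriv (P (Suc K)) = (fps_X * fps_deriv (P K)) * ?f (Suc K) + P K * (fps_X * fps_deriv (?f (Suc K)))"
      unfolding PS by (simp only: fps_deriv_mult) (simp add: algebra_simps)
    also have "\<dots> = - (\<Sum>n=1..Suc K. of_nat n * lambert n) * P (Suc K)"
    proof -
      have "1 \<le> Suc K" by simp
      note D1 = D1[OF this]
      have alg: "- s * p * f + p * (- m * f) = - (s + m) * (p * f)" for s p f m :: "complex fps"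
        by (simp add: algebra_simps)
      have "(\<Sum>n=1..Suc K. of_nat n * lambert n) = (\<Sum>n=1..K. of_nat n * lambert n) + of_nat (Suc K) * lambert (Suc K)"
        by simp
      then show ?thesis unfolding Suc D1 PS by (simp only: alg)
    qed
    finally show ?case .
  qed (simp add: P_def)
  have "fps_nth (fps_X * fps_deriv euler_product) k = of_nat k * fps_nth euler_product k"
    by (cases k) auto
  also have "\<dots> = of_nat k * fps_nth (P k) k" by (simp add: Pk)
  also have "\<dots> = fps_nth (fps_X * fps_deriv (P k)) k" by (cases k) auto
  also have "\<dots> = - (\<Sum>n=1..k. of_nat n * fps_nth (lambert n * P k) k)"
    unfolding D by (simp add: sum_distrib_right fps_sum_nth mult.assoc fps_of_nat[symmetric])
  also have "\<dots> = - fps_nth (divisor_series of_nat * P k) k"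
    by (simp add: divisor_series_mult_nth[of k k of_nat "P k", simplified])
  also have "\<dots> = - fps_nth (divisor_series of_nat * euler_product) k"
    by (auto simp: fps_mult_nth Pk[of _ k] intro!: sum.cong)
  finally show "fps_nth (fps_X * fps_deriv euler_product) k = fps_nth (- divisor_series of_nat * euler_product) k"
    by simp
qed

text \<open>The logarithmic derivatives of the two factors are opposite, so the product is constant,
  and its constant term is 1. Thus the product expansion of the character follows without expanding
  over the d bosons.\<close>

lemma euler_product_ztrace_vac:
  "euler_product ^ cvs.dim (UNIV :: 'h::quad_space set) * ztrace (vac :: 'h boson) = 1"
proof -
  let ?d = "cvs.dim (UNIV :: 'h set)" and ?T = "ztrace (vac :: 'h boson)" and ?S = "divisor_series of_nat"
  have PD: "fps_X * fps_deriv (euler_product ^ d) = - of_nat d * ?S * euler_product ^ d" for d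
  proof (induction d)
    case (Suc d)
    have "fps_X * fps_deriv (euler_product ^ Suc d) =
       (fps_X * fps_deriv euler_product) * euler_product ^ d + euler_product * (fps_X * fps_deriv (euler_product ^ d))"
      by (simp add: algebra_simps)
    also have "\<dots> = - of_nat (Suc d) * ?S * euler_product ^ Suc d"
      unfolding Suc euler_product_deriv by (simp add: algebra_simps)
    finally show ?case .
  qed simp
  let ?F = "euler_product ^ ?d * ?T"
  have "fps_X * fps_deriv ?F = (fps_X * fps_deriv (euler_product ^ ?d)) * ?T + euler_product ^ ?d * (fps_X * fps_deriv ?T)"
    by (simp add: algebra_simps)
  also have "\<dots> = 0" unfolding PD ztrace_vac_deriv card_hbasis by (simp add: algebra_simps)
  finally have "fps_deriv ?F = 0" by (simp only: mult_eq_0_iff) simp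
  then have "?F = fps_const (fps_nth ?F 0)" by (simp only: fps_deriv_eq_0_iff)
  moreover have "fps_nth ?F 0 = 1"
    using euler_product_nth[of 0 0] by (simp add: fps_power_zeroth ztrace_vac_0)
  ultimately show ?thesis by simp
qed

section \<open>Eisenstein series as functions on the upper half plane, their transformation laws,
  and their algebraic independence\<close>

section \<open>The Lipschitz formula\<close>

text \<open>The polylogarithm of order -k. For k = 0 the convention 0^0 = 1 gives constant term 1
  and hence the sum 1 / (1 - q).\<close>

definition power_series :: "nat \<Rightarrow> complex fps" where
  "power_series k = Abs_fps (\<lambda>n. of_nat n ^ k)"

lemma power_series_Suc: "power_series (Suc k) = fps_X * fps_deriv (power_series k)"
proof (rule fps_ext)
  fix n
  show "fps_nth (power_series (Suc k)) n = fps_nth (fps_X * fps_deriv (power_series k)) n"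
    by (cases n) (auto simp: power_series_def)
qed

lemma conv_radius_power_series: "fps_conv_radius (power_series k) \<ge> 1"
proof (induction k)
  case 0
  show ?case unfolding power_series_def fps_conv_radius_def
  proof (rule conv_radius_geI_ex')
    fix r :: real assume "0 < r" "ereal r < 1"
    then show "summable (\<lambda>n. fps_nth (Abs_fps (\<lambda>n. of_nat n ^ 0)) n * (of_real r :: complex) ^ n)"
      by (simp add: summable_geometric)
  qed
next
  case (Suc k)
  have "1 \<le> fps_conv_radius (fps_deriv (power_series k))"
    using Suc fps_conv_radius_deriv order.trans by blast
  moreover have "min (fps_conv_radius (fps_X :: complex fps)) (fps_conv_radius (fps_deriv (power_series k))) \<le>
      fps_conv_radius (fps_X * fps_deriv (power_series k))"
    by (rule fps_conv_radius_mult)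
  ultimately show ?case by (simp add: power_series_Suc)
qed

lemma norm_less_power_series: "norm z < 1 \<Longrightarrow> ereal (norm z) < fps_conv_radius (power_series k)"
  using conv_radius_power_series[of k] by (metis ereal_less(3) less_le_trans)

definition pser :: "nat \<Rightarrow> complex \<Rightarrow> complex" where
  "pser k = eval_fps (power_series k)"

lemma pser_0: "norm q < 1 \<Longrightarrow> pser 0 q = 1 / (1 - q)"
  by (simp add: pser_def eval_fps_def power_series_def suminf_geometric)

lemma pser_deriv:
  assumes "norm q < 1"
  shows "(pser k has_field_derivative eval_fps (fps_deriv (power_series k)) q) (at q)"
    and "q * eval_fps (fps_deriv (power_series k)) q = pser (Suc k) q"
proof -
  show "(pser k has_field_derivative eval_fps (fps_deriv (power_series k)) q) (at q)"
    unfolding pser_def by (rule has_field_derivative_eval_fps[OF norm_less_power_series[OF assms]])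
  have "ereal (norm q) < fps_conv_radius (fps_deriv (power_series k))"
    using norm_less_power_series[OF assms, of k] fps_conv_radius_deriv[of "power_series k"] by (rule less_le_trans)
  then show "q * eval_fps (fps_deriv (power_series k)) q = pser (Suc k) q"
    by (simp add: pser_def power_series_Suc eval_fps_mult)
qed

lemma pser_sums: "norm q < 1 \<Longrightarrow> (\<lambda>n. of_nat n ^ k * q ^ n) sums pser k q"
  using summable_fps[OF norm_less_power_series, of q k]
  by (simp add: pser_def eval_fps_def power_series_def summable_sums)

definition nome :: "complex \<Rightarrow> complex" where
  "nome z = exp (2 * of_real pi * \<i> * z)"

lemma norm_nome: "norm (nome z) = exp (- 2 * pi * Im z)"
  by (simp add: nome_def)

lemma norm_nome_less_1: "Im z > 0 \<Longrightarrow> norm (nome z) < 1"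
  by (simp add: norm_nome)

lemma nome_neq_1: "Im z > 0 \<Longrightarrow> nome z \<noteq> 1"
  using norm_nome_less_1[of z] by auto

lemma has_field_derivative_nome: "(nome has_field_derivative 2 * of_real pi * \<i> * nome z) (at z)"
  unfolding nome_def [abs_def] by (auto intro!: derivative_eq_intros)

lemma pser_nome_deriv:
  assumes "Im z > 0"
  shows "((\<lambda>z. pser k (nome z)) has_field_derivative 2 * of_real pi * \<i> * pser (Suc k) (nome z)) (at z)"
proof -
  have "((\<lambda>z. pser k (nome z)) has_field_derivative
     eval_fps (fps_deriv (power_series k)) (nome z) * (2 * of_real pi * \<i> * nome z)) (at z)"
    by (rule DERIV_chain2[OF pser_deriv(1) has_field_derivative_nome]) (rule norm_nome_less_1[OF assms])
  then show ?thesis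
    by (simp add: mult_ac flip: pser_deriv(2)[OF norm_nome_less_1[OF assms], of k])
qed

lemma Im_pos_not_Int: "Im z \<noteq> 0 \<Longrightarrow> z \<notin> \<int>" "Im z \<noteq> 0 \<Longrightarrow> z \<notin> \<int>\<^sub>\<le>\<^sub>0"
  by (auto elim!: Ints_cases nonpos_Ints_cases)

lemma open_upper: "open {z. Im z > 0}"
  by (simp add: open_halfspace_Im_gt)

lemma DERIV_eq_on_open:
  fixes f g :: "complex \<Rightarrow> complex"
  assumes "open S" "z \<in> S" "\<And>w. w \<in> S \<Longrightarrow> f w = g w"
    "(f has_field_derivative f') (at z)" "(g has_field_derivative g') (at z)"
  shows "f' = g'"
proof -
  have "(g has_field_derivative f') (at z)"
    by (rule has_field_derivative_transform_within_open[OF assms(4,1,2)]) (rule assms(3))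
  then show ?thesis using assms(5) by (rule DERIV_unique)
qed

text \<open>Logarithmic derivative of Gamma(z) Gamma(1 - z) = \<pi> / sin(\<pi> z); the resulting
  -\<pi> cot(\<pi> z) is then written in terms of q = exp(2 \<pi> i z).\<close>

lemma Digamma_reflection:
  assumes "Im z > 0"
  shows "Digamma z - Digamma (1 - z) = of_real pi * \<i> * (2 * pser 0 (nome z) - 1)"
proof -
  let ?s = "sin (of_real pi * z)" and ?c = "cos (of_real pi * z)"
  have nz: "w \<notin> \<int>\<^sub>\<le>\<^sub>0" "1 - w \<notin> \<int>\<^sub>\<le>\<^sub>0" if "Im w > 0" for w
    using that Im_pos_not_Int(2)[of w] Im_pos_not_Int(2)[of "1 - w"] by auto
  have G0: "Gamma z * Gamma (1 - z) \<noteq> 0"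
    using nz[OF assms] by (simp add: Gamma_eq_zero_iff)
  have s0: "?s \<noteq> 0"
    using Gamma_reflection_complex[of z] G0 by auto
  have "((\<lambda>w. Gamma w * Gamma (1 - w)) has_field_derivative
     (Gamma z * Gamma (1 - z)) * (Digamma z - Digamma (1 - z))) (at z)"
    using nz[OF assms] by (auto intro!: derivative_eq_intros simp: algebra_simps)
  moreover have "((\<lambda>w. of_real pi / sin (of_real pi * w)) has_field_derivative
     (of_real pi / ?s) * (- of_real pi * ?c / ?s)) (at z)"
    using s0 by (auto intro!: derivative_eq_intros simp: field_simps)
  ultimately have "(Gamma z * Gamma (1 - z)) * (Digamma z - Digamma (1 - z)) =
      (of_real pi / ?s) * (- of_real pi * ?c / ?s)"
    by (rule DERIV_eq_on_open[OF open_UNIV UNIV_I Gamma_reflection_complex])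
  then have "(of_real pi / ?s) * (Digamma z - Digamma (1 - z)) = (of_real pi / ?s) * (- of_real pi * ?c / ?s)"
    by (simp only: Gamma_reflection_complex[of z])
  then have 1: "Digamma z - Digamma (1 - z) = - of_real pi * ?c / ?s"
    by (rule mult_left_cancel[THEN iffD1, rotated]) (use G0 in \<open>simp add: Gamma_reflection_complex[of z]\<close>)
  define e where "e = exp (\<i> * (of_real pi * z))"
  have e: "exp (- (\<i> * (of_real pi * z))) = 1 / e" "e \<noteq> 0"
    by (auto simp: e_def exp_minus divide_simps)
  have ee: "nome z = e * e"
    by (simp add: nome_def e_def exp_add[symmetric] algebra_simps)
  have q1: "e * e \<noteq> 1" using nome_neq_1[OF assms] ee by simp
  have s: "?s = (e - 1 / e) / (2 * \<i>)" and c: "?c = (e + 1 / e) / 2"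
    by (simp_all add: sin_exp_eq cos_exp_eq e_def exp_minus divide_simps)
  have "- of_real pi * ?c / ?s = of_real pi * \<i> * (2 / (1 - e * e) - 1)"
    unfolding s c using e q1 by (simp add: field_simps)
  then show ?thesis using 1 pser_0[OF norm_nome_less_1[OF assms]] ee by simp
qed

lemma DERIV_eq_on_upper:
  fixes f g :: "complex \<Rightarrow> complex"
  assumes "Im z > 0" "\<And>w. Im w > 0 \<Longrightarrow> f w = g w"
    "(f has_field_derivative f') (at z)" "(g has_field_derivative g') (at z)"
  shows "f' = g'"
  by (rule DERIV_eq_on_open[OF open_upper _ _ assms(3,4)]) (simp_all add: assms(1,2))

text \<open>Repeated differentiation of \<open>Digamma_reflection\<close>: d/dz acts on q-series as
  2 \<pi> i q d/dq, which raises the index of \<open>pser\<close>. The constant term of the digamma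
  formula disappears at the first step, hence k \<ge> 1.\<close>

lemma Polygamma_reflection:
  assumes "Im z > 0" "k \<ge> 1"
  shows "Polygamma k z + (- 1) ^ (k + 1) * Polygamma k (1 - z) =
     (2 * of_real pi * \<i>) ^ (k + 1) * pser k (nome z)"
  using assms(2,1)
proof (induction k arbitrary: z rule: dec_induct)
  case base
  have nz: "z \<notin> \<int>\<^sub>\<le>\<^sub>0" "1 - z \<notin> \<int>\<^sub>\<le>\<^sub>0"
    using base Im_pos_not_Int(2)[of z] Im_pos_not_Int(2)[of "1 - z"] by auto
  have 1: "((\<lambda>w. 1 - w) has_field_derivative - 1) (at z)" by (auto intro!: derivative_eq_intros)
  note D1 = DERIV_diff[OF has_field_derivative_Polygamma[OF nz(1), of 0]
        DERIV_chain2[OF has_field_derivative_Polygamma[OF nz(2)] 1]]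
  note D2 = DERIV_cmult[OF DERIV_diff[OF DERIV_cmult[OF pser_nome_deriv[OF base, of 0], of 2] DERIV_const[of 1]],
      of "of_real pi * \<i>"]
  have "Polygamma (Suc 0) z - Polygamma (Suc 0) (1 - z) * - 1 =
      of_real pi * \<i> * (2 * (2 * of_real pi * \<i> * pser (Suc 0) (nome z)) - 0)"
    by (rule DERIV_eq_on_upper[OF base Digamma_reflection D1 D2])
  then show ?case by (simp add: power2_eq_square mult_ac)
next
  case (step k)
  have nz: "z \<notin> \<int>\<^sub>\<le>\<^sub>0" "1 - z \<notin> \<int>\<^sub>\<le>\<^sub>0"
    using step.prems Im_pos_not_Int(2)[of z] Im_pos_not_Int(2)[of "1 - z"] by auto
  have 1: "((\<lambda>w. 1 - w) has_field_derivative - 1) (at z)" by (auto intro!: derivative_eq_intros)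
  note D1 = DERIV_add[OF has_field_derivative_Polygamma[OF nz(1), of k]
        DERIV_cmult[OF DERIV_chain2[OF has_field_derivative_Polygamma[OF nz(2)] 1], of "(- 1) ^ (k + 1)"]]
  note D2 = DERIV_cmult[OF pser_nome_deriv[OF step.prems, of k], of "(2 * of_real pi * \<i>) ^ (k + 1)"]
  have "Polygamma (Suc k) z + (- 1) ^ (k + 1) * (Polygamma (Suc k) (1 - z) * - 1) =
      (2 * of_real pi * \<i>) ^ (k + 1) * (2 * of_real pi * \<i> * pser (Suc k) (nome z))"
    by (rule DERIV_eq_on_upper[OF step.prems step.IH D1 D2])
  then show ?case by (simp add: mult_ac)
qed

lemma has_sum_int:
  fixes f :: "int \<Rightarrow> 'a::{topological_comm_monoid_add}"
  assumes "((\<lambda>n. f (int n)) has_sum a) UNIV" "((\<lambda>n. f (- int (Suc n))) has_sum b) UNIV"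
  shows "(f has_sum (a + b)) UNIV"
proof -
  have "(f has_sum a) {0..}"
    using assms(1) has_sum_reindex_bij_betw[of int UNIV "{0..}" f a]
      bij_betwI[of int UNIV "{0..}" nat] by auto
  moreover have "(f has_sum b) {..<0}"
    using assms(2) has_sum_reindex_bij_betw[of "\<lambda>n. - int (Suc n)" UNIV "{..<0}" f b]
      bij_betwI[of "\<lambda>n. - int (Suc n)" UNIV "{..<0}" "\<lambda>m. nat (- m - 1)"] by auto
  ultimately have "(f has_sum (a + b)) ({0..} \<union> {..<0})"
    by (rule has_sum_Un_disjoint) auto
  moreover have "{0..} \<union> {..<0} = (UNIV :: int set)" by auto
  ultimately show ?thesis by simp
qed

lemma norm_summable_inverse_power:
  assumes "z \<notin> \<int>\<^sub>\<le>\<^sub>0" "k \<ge> 2"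
  shows "summable (\<lambda>n. norm (1 / (z + of_nat n :: complex) ^ k))"
proof (rule summable_comparison_test_ev)
  have z: "z \<noteq> 0" using assms(1) by auto
  define m where "m = nat \<lceil>norm z\<rceil>"
  show "\<forall>\<^sub>F n in sequentially. norm (norm (1 / (z + of_nat n) ^ k)) \<le> inverse (real (n - m) ^ k)"
    using eventually_gt_at_top[of m]
  proof eventually_elim
    case (elim n)
    have "real (n - m) = norm (of_nat n :: complex) - real m" using elim by (simp add: of_nat_diff)
    also have "\<dots> \<le> norm (of_nat n :: complex) - norm z" unfolding m_def by linarith
    also have "\<dots> \<le> norm (of_nat n + z)" by (rule norm_diff_ineq)
    finally have "real (n - m) ^ k \<le> norm (z + of_nat n) ^ k"
      by (intro power_mono) (simp_all add: add.commute)
    moreover have "real (n - m) ^ k > 0" using elim by simp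
    ultimately have "inverse (norm (z + of_nat n) ^ k) \<le> inverse (real (n - m) ^ k)"
      by (rule le_imp_inverse_le)
    then show ?case by (simp add: norm_divide norm_power inverse_eq_divide)
  qed
  have "summable (\<lambda>n. inverse (real n ^ k))" using inverse_power_summable[of k, where 'a = real] assms(2) by simp
  then have "summable (\<lambda>n. inverse (real (n + m - m) ^ k))" by simp
  then show "summable (\<lambda>n. inverse (real (n - m) ^ k))" by (rule summable_offset)
qed

text \<open>The halves n \<ge> 0 and n < 0 of the sum are polygamma values at z and 1 - z. For odd k
  the exponent k + 1 is even, so both enter with the sign required by the reflection
  formula.\<close>

theorem lipschitz_formula:
  assumes z: "Im z > 0" and k: "odd k"
  shows "((\<lambda>n. 1 / (z + of_int n) ^ (k + 1)) has_sum
     ((2 * of_real pi * \<i>) ^ (k + 1) / fact k * pser k (nome z))) UNIV"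
proof -
  have nz: "z \<notin> \<int>\<^sub>\<le>\<^sub>0" "1 - z \<notin> \<int>\<^sub>\<le>\<^sub>0"
    using z Im_pos_not_Int(2)[of z] Im_pos_not_Int(2)[of "1 - z"] by auto
  have k1: "k \<ge> 1" "k > 0" "k + 1 \<ge> 2" using k by (auto elim!: oddE)
  have S: "((\<lambda>n. 1 / (w + of_nat n) ^ (k + 1)) has_sum (Polygamma k w / fact k)) UNIV"
    if "w \<notin> \<int>\<^sub>\<le>\<^sub>0" for w :: complex
  proof (rule norm_summable_imp_has_sum)
    show "summable (\<lambda>n. norm (1 / (w + of_nat n) ^ (k + 1)))"
      by (rule norm_summable_inverse_power[OF that k1(3)])
    have "w \<noteq> 0" using that by auto
    from Polygamma_LIMSEQ[OF this k1(2)] show "(\<lambda>n. 1 / (w + of_nat n) ^ (k + 1)) sums (Polygamma k w / fact k)"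
      using k by (simp add: inverse_eq_divide)
  qed
  have "1 / (1 - z + of_nat n) ^ (k + 1) = 1 / (z + of_int (- int (Suc n))) ^ (k + 1)" for n
  proof -
    have "1 - z + of_nat n = - (z + of_int (- int (Suc n)))" by simp
    then have "(1 - z + of_nat n) ^ (k + 1) = (- (z + of_int (- int (Suc n)))) ^ (k + 1)"
      by (simp only:)
    also have "\<dots> = (z + of_int (- int (Suc n))) ^ (k + 1)" using k by (intro power_minus_even) auto
    finally show ?thesis by simp
  qed
  then have "((\<lambda>n. 1 / (z + of_int (- int (Suc n))) ^ (k + 1)) has_sum (Polygamma k (1 - z) / fact k)) UNIV"
    using S[OF nz(2)] by simp
  moreover have "((\<lambda>n. 1 / (z + of_int (int n)) ^ (k + 1)) has_sum (Polygamma k z / fact k)) UNIV"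
    using S[OF nz(1)] by simp
  ultimately have "((\<lambda>n. 1 / (z + of_int n) ^ (k + 1)) has_sum (Polygamma k z / fact k + Polygamma k (1 - z) / fact k)) UNIV"
    by (intro has_sum_int[of "\<lambda>n. 1 / (z + of_int n) ^ (k + 1)"])
  moreover have "Polygamma k z / fact k + Polygamma k (1 - z) / fact k =
      (2 * of_real pi * \<i>) ^ (k + 1) / fact k * pser k (nome z)"
    using Polygamma_reflection[OF z k1(1)] k by (simp add: add_divide_distrib[symmetric])
  ultimately show ?thesis by simp
qed

section \<open>Lambert series of divisor sums\<close>

definition sigma_fps :: "nat \<Rightarrow> complex fps" where
  "sigma_fps k = Abs_fps (\<lambda>n. if n = 0 then 0 else of_nat (divisor_power_sum k n))"

lemma norm_summable_power_geometric:
  assumes "0 \<le> r" "r < 1"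
  shows "summable (\<lambda>n. real n ^ k * r ^ n)"
proof -
  have n: "norm (complex_of_real r) < 1" using assms by simp
  have "ereal (norm (complex_of_real r)) < conv_radius (fps_nth (power_series k))"
    using norm_less_power_series[OF n, of k] unfolding fps_conv_radius_def .
  then have "summable (\<lambda>n. norm (fps_nth (power_series k) n * of_real r ^ n))"
    by (rule abs_summable_in_conv_radius)
  then show ?thesis using assms by (simp add: power_series_def norm_mult norm_power)
qed

text \<open>Both series are rearrangements of the double sum of d^k q^(m d) over m, d \<ge> 1,
  grouped once by m and once by n = m d.\<close>

lemma lambert_has_sum:
  assumes q: "norm q < 1" and k: "k \<ge> 1"
  shows "((\<lambda>m. pser k (q ^ m)) has_sum eval_fps (sigma_fps k) q) {1..}"
    and "fps_conv_radius (sigma_fps k) \<ge> 1"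
proof -
  define f :: "complex \<Rightarrow> nat \<times> nat \<Rightarrow> complex" where "f q = (\<lambda>(m, d). of_nat d ^ k * q ^ (m * d))" for q
  have abs: "(\<lambda>x. norm (f q x)) summable_on ({1..} \<times> {1..})" if q: "norm q < 1" for q
  proof (rule Infinite_Sum.abs_summable_on_comparison_test)
    define r where "r = norm q"
    have r: "0 \<le> r" "r < 1" using q by (simp_all add: r_def)
    have "(\<lambda>d. real d ^ k * r ^ d) summable_on UNIV"
      using norm_summable_power_geometric[OF r] r by (intro norm_summable_imp_summable_on) (simp add: norm_mult)
    then have 1: "(\<lambda>d. real d ^ k * r ^ d) summable_on {1..}" by (rule summable_on_subset_banach) auto
    have "(\<lambda>m. r ^ (m - 1)) summable_on {1..}"
    proof -
      have "(\<lambda>m. r ^ m) summable_on UNIV"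
        using r by (intro norm_summable_imp_summable_on) (simp add: norm_power summable_geometric)
      then show ?thesis
        using summable_on_reindex_bij_betw[of Suc UNIV "{1..}" "\<lambda>m. r ^ (m - 1)"]
          bij_betwI[of Suc UNIV "{1..}" "\<lambda>m. m - 1"] by auto
    qed
    have "(\<lambda>x. r ^ (fst x - 1) * (real (snd x) ^ k * r ^ snd x)) summable_on ({1..} \<times> {1..})"
    proof (rule summable_on_SigmaI)
      show "((\<lambda>d. r ^ (fst (m, d) - 1) * (real (snd (m, d)) ^ k * r ^ snd (m, d))) has_sum
          r ^ (m - 1) * infsum (\<lambda>d. real d ^ k * r ^ d) {1..}) {1..}" for m :: nat
        using has_sum_cmult_right[OF has_sum_infsum[OF 1], of "r ^ (m - 1)"] by simp
      show "(\<lambda>m. r ^ (m - 1) * infsum (\<lambda>d. real d ^ k * r ^ d) {1..}) summable_on {1..}"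
        by (rule summable_on_cmult_left[OF \<open>(\<lambda>m. r ^ (m - 1)) summable_on {1..}\<close>])
    qed (use r in simp)
    then show "(\<lambda>x. norm (r ^ (fst x - 1) * (real (snd x) ^ k * r ^ snd x))) summable_on ({1..} \<times> {1..})"
      using r by simp
    fix x :: "nat \<times> nat" assume "x \<in> {1..} \<times> {1..}"
    then obtain m d where x: "x = (m, d)" "m \<ge> 1" "d \<ge> 1" by auto
    \<comment> \<open>This inequality majorises the term by a product of a function of m and a
      function of d, both summable.\<close>
    have "m - 1 + d \<le> m * d"
      using x by (cases m; cases d) auto
    then have "r ^ (m * d) \<le> r ^ (m - 1 + d)" using r by (intro power_decreasing) auto
    then have "real d ^ k * r ^ (m * d) \<le> real d ^ k * (r ^ (m - 1) * r ^ d)"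
      by (intro mult_left_mono) (simp_all add: power_add)
    then show "norm (f q x) \<le> norm (r ^ (fst x - 1) * (real (snd x) ^ k * r ^ snd x))"
      using r by (simp add: x f_def norm_mult norm_power r_def mult_ac)
  qed
  have inner: "((\<lambda>d. f q (m, d)) has_sum pser k (q ^ m)) {1..}" if q: "norm q < 1" and m: "m \<in> {1..}" for q m
  proof -
    have "norm q ^ m \<le> norm q ^ 1" using q m by (intro power_decreasing) auto
    then have qm: "norm (q ^ m) < 1" using q by (simp add: norm_power)
    have "((\<lambda>d. of_nat d ^ k * (q ^ m) ^ d) has_sum pser k (q ^ m)) UNIV"
      using norm_summable_power_geometric[of "norm (q ^ m)" k] qm
      by (intro norm_summable_imp_has_sum pser_sums) (auto simp: norm_mult norm_power)
    moreover have "((\<lambda>d. of_nat d ^ k * (q ^ m) ^ d) has_sum pser k (q ^ m)) UNIV \<longleftrightarrow>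
        ((\<lambda>d. f q (m, d)) has_sum pser k (q ^ m)) {1..}"
      by (rule has_sum_cong_neutral) (use k in \<open>auto simp: f_def power_mult not_le\<close>)
    ultimately show ?thesis by simp
  qed
  have main: "((\<lambda>m. pser k (q ^ m)) has_sum infsum (f q) ({1..} \<times> {1..})) {1..}"
    and sums: "((\<lambda>n. fps_nth (sigma_fps k) n * q ^ n) has_sum infsum (f q) ({1..} \<times> {1..})) {1..}" if q: "norm q < 1" for q
  proof -
    have hs: "(f q has_sum infsum (f q) ({1..} \<times> {1..})) ({1..} \<times> {1..})"
      using abs_summable_summable[OF abs[OF q]] by simp
    show "((\<lambda>m. pser k (q ^ m)) has_sum infsum (f q) ({1..} \<times> {1..})) {1..}"
      by (rule has_sum_Sigma'[OF hs inner[OF q]])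
    have hs': "((\<lambda>(n, d). of_nat d ^ k * q ^ n) has_sum infsum (f q) ({1..} \<times> {1..})) (SIGMA n:{1..}. {d. d dvd n})"
    proof -
      have "bij_betw (\<lambda>(m, d). (m * d, d)) ({1..} \<times> {1..}) (SIGMA n:{1..}. {d. d dvd (n::nat)})"
        by (rule bij_betwI[of _ _ _ "\<lambda>(n, d). (n div d, d)"]) (auto elim!: dvdE simp: Suc_le_eq)
      from has_sum_reindex_bij_betw[OF this, of "\<lambda>(n, d). of_nat d ^ k * q ^ n" "infsum (f q) ({1..} \<times> {1..})"]
      moreover have "(\<lambda>x. (\<lambda>(n, d). of_nat d ^ k * q ^ n) ((\<lambda>(m, d). (m * d, d)) x)) = f q"
        by (auto simp: fun_eq_iff f_def)
      ultimately show ?thesis using hs by simp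
    qed
    have "((\<lambda>n. \<Sum>d | d dvd n. of_nat d ^ k * q ^ n) has_sum infsum (f q) ({1..} \<times> {1..})) {1..}"
      by (rule has_sum_Sigma'[OF hs']) (auto intro!: has_sum_finiteI finite_divisors_nat)
    moreover have eq: "fps_nth (sigma_fps k) n * q ^ n = (\<Sum>d | d dvd n. of_nat d ^ k * q ^ n)" if "n \<in> {1..}" for n
      using that by (auto simp: sigma_fps_def divisor_power_sum_def sum_distrib_right)
    ultimately show "((\<lambda>n. fps_nth (sigma_fps k) n * q ^ n) has_sum infsum (f q) ({1..} \<times> {1..})) {1..}"
      by (subst has_sum_cong[OF eq])
  qed
  have sums': "(\<lambda>n. fps_nth (sigma_fps k) n * q ^ n) sums infsum (f q) ({1..} \<times> {1..})" if q: "norm q < 1" for q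
  proof (rule has_sum_imp_sums)
    have "((\<lambda>n. fps_nth (sigma_fps k) n * q ^ n) has_sum infsum (f q) ({1..} \<times> {1..})) UNIV \<longleftrightarrow>
        ((\<lambda>n. fps_nth (sigma_fps k) n * q ^ n) has_sum infsum (f q) ({1..} \<times> {1..})) {1..}"
      by (rule has_sum_cong_neutral) (auto simp: sigma_fps_def not_le)
    then show "((\<lambda>n. fps_nth (sigma_fps k) n * q ^ n) has_sum infsum (f q) ({1..} \<times> {1..})) UNIV"
      using sums[OF q] by simp
  qed
  have "eval_fps (sigma_fps k) q = infsum (f q) ({1..} \<times> {1..})"
    using sums'[OF q] by (simp add: eval_fps_def sums_iff)
  then show "((\<lambda>m. pser k (q ^ m)) has_sum eval_fps (sigma_fps k) q) {1..}" using main[OF q] by simp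
  show "fps_conv_radius (sigma_fps k) \<ge> 1"
    unfolding fps_conv_radius_def
  proof (rule conv_radius_geI_ex')
    fix r :: real assume "0 < r" "ereal r < 1"
    then show "summable (\<lambda>n. fps_nth (sigma_fps k) n * of_real r ^ n)"
      using sums'[of "of_real r"] by (auto simp: sums_iff)
  qed
qed

section \<open>Eisenstein series as lattice sums\<close>

definition lat :: "complex \<Rightarrow> int \<Rightarrow> int \<Rightarrow> complex" where
  "lat \<tau> m n = of_int m * \<tau> + of_int n"

text \<open>The imaginary part controls m. For n, either n dominates m \<tau> and half of it
  survives in the sum, which gives the constant 1/2, or n is at most 2 \<bar>m\<bar>
  \<bar>\<tau>\<bar>, and the bound by m gives Im \<tau> / (2 \<bar>\<tau>\<bar>).\<close>

lemma lat_lower_bound: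
  assumes "Im \<tau> > 0"
  obtains \<delta> where "\<delta> > 0" "\<And>m n. norm (lat \<tau> m n) \<ge> \<delta> * real_of_int (max \<bar>m\<bar> \<bar>n\<bar>)"
proof
  define y where "y = Im \<tau>"
  define t where "t = norm \<tau>"
  have y: "y > 0" using assms by (simp add: y_def)
  have t: "t > 0" using assms by (auto simp: t_def)
  define \<delta> where "\<delta> = min y (min (1 / 2) (y / (2 * t)))"
  show \<delta>: "\<delta> > 0" using y t by (simp add: \<delta>_def)
  fix m n
  have m: "norm (lat \<tau> m n) \<ge> real_of_int \<bar>m\<bar> * y"
    using abs_Im_le_cmod[of "lat \<tau> m n"] y by (simp add: lat_def y_def abs_mult)
  have 1: "norm (lat \<tau> m n) \<ge> \<delta> * real_of_int \<bar>m\<bar>"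
  proof -
    have "\<delta> * real_of_int \<bar>m\<bar> \<le> y * real_of_int \<bar>m\<bar>" by (intro mult_right_mono) (simp_all add: \<delta>_def)
    then show ?thesis using m by (simp add: mult.commute)
  qed
  have 2: "norm (lat \<tau> m n) \<ge> \<delta> * real_of_int \<bar>n\<bar>"
  proof (cases "real_of_int \<bar>n\<bar> \<ge> 2 * real_of_int \<bar>m\<bar> * t")
    case True
    have "real_of_int \<bar>n\<bar> \<le> norm (lat \<tau> m n) + real_of_int \<bar>m\<bar> * t"
      using norm_triangle_ineq4[of "lat \<tau> m n" "of_int m * \<tau>"] by (simp add: lat_def norm_mult t_def)
    then have "real_of_int \<bar>n\<bar> / 2 \<le> norm (lat \<tau> m n)" using True by linarith
    moreover have "\<delta> * real_of_int \<bar>n\<bar> \<le> 1 / 2 * real_of_int \<bar>n\<bar>"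
      by (intro mult_right_mono) (simp_all add: \<delta>_def)
    ultimately show ?thesis by simp
  next
    case False
    then have "real_of_int \<bar>n\<bar> / (2 * t) * y \<le> real_of_int \<bar>m\<bar> * y"
      using t y by (intro mult_right_mono) (simp_all add: divide_simps mult_ac)
    moreover have "\<delta> * real_of_int \<bar>n\<bar> \<le> y / (2 * t) * real_of_int \<bar>n\<bar>"
      by (intro mult_right_mono) (simp_all add: \<delta>_def)
    ultimately show ?thesis using m by (simp add: mult_ac)
  qed
  show "norm (lat \<tau> m n) \<ge> \<delta> * real_of_int (max \<bar>m\<bar> \<bar>n\<bar>)"
    using 1 2 by (cases "\<bar>m\<bar> \<le> \<bar>n\<bar>") (simp_all add: max_def)
qed

lemma lat_eq_0_iff: "Im \<tau> > 0 \<Longrightarrow> lat \<tau> m n = 0 \<longleftrightarrow> m = 0 \<and> n = 0"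
  by (auto simp: lat_def complex_eq_iff)

text \<open>With M the maximum of \<bar>m\<bar> and \<bar>n\<bar>, the bound M^(-3) is split as
  M^(-3/2) M^(-3/2), giving a product of functions of m and n that are separately summable. The
  maximum with 1 covers the index 0.\<close>

definition int_decay :: "int \<Rightarrow> real" where
  "int_decay m = real_of_int (max 1 \<bar>m\<bar>) powr (- 3 / 2)"

lemma int_decay_nonneg [simp]: "int_decay m \<ge> 0"
  by (simp add: int_decay_def)

lemma int_decay_summable: "int_decay summable_on UNIV"
proof -
  have s: "(\<lambda>n. real (Suc n) powr (- 3 / 2)) summable_on UNIV"
  proof (rule norm_summable_imp_summable_on)
    have "summable (\<lambda>n. real n powr (- 3 / 2))" by (simp add: summable_real_powr_iff)
    then show "summable (\<lambda>n. norm (real (Suc n) powr (- 3 / 2)))"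
      by (subst summable_Suc_iff[of "\<lambda>n. norm (real n powr (- 3 / 2))"]) simp
  qed
  have 1: "(\<lambda>n. int_decay (- int (Suc n))) summable_on UNIV"
    using s by (simp add: int_decay_def add.commute)
  have "(\<lambda>n. int_decay (int n)) summable_on UNIV"
  proof -
    have "(\<lambda>n. int_decay (int n)) summable_on {1..}"
      using summable_on_reindex_bij_betw[of Suc UNIV "{1..}" "\<lambda>n. int_decay (int n)"] s
        bij_betwI[of Suc UNIV "{1..}" "\<lambda>m. m - 1"]
      by (simp add: int_decay_def add.commute)
    then have "(\<lambda>n. int_decay (int n)) summable_on (insert 0 {1..})"
      by (simp add: summable_on_insert_iff)
    moreover have "insert 0 {1..} = (UNIV :: nat set)" by auto
    ultimately show ?thesis by simp
  qed
  then show ?thesis using 1 has_sum_int[of int_decay] by (auto simp: summable_on_def)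
qed

lemma int_decay_prod_summable: "(\<lambda>x. int_decay (fst x) * int_decay (snd x)) summable_on (UNIV \<times> UNIV)"
proof (rule summable_on_SigmaI)
  fix m
  show "((\<lambda>n. int_decay (fst (m, n)) * int_decay (snd (m, n))) has_sum (int_decay m * infsum int_decay UNIV)) UNIV"
    using has_sum_cmult_right[OF has_sum_infsum[OF int_decay_summable]] by simp
next
  show "(\<lambda>m. int_decay m * infsum int_decay UNIV) summable_on UNIV"
    by (rule summable_on_cmult_left[OF int_decay_summable])
qed simp

lemma int_decay_bound:
  assumes "(m, n) \<noteq> (0, 0)"
  shows "1 / real_of_int (max \<bar>m\<bar> \<bar>n\<bar>) ^ 3 \<le> int_decay m * int_decay n"
proof -
  define M where "M = real_of_int (max \<bar>m\<bar> \<bar>n\<bar>)"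
  have M: "M \<ge> 1" "real_of_int (max 1 \<bar>m\<bar>) \<le> M" "real_of_int (max 1 \<bar>n\<bar>) \<le> M"
    using assms by (auto simp: M_def)
  have d: "M powr (- 3 / 2) \<le> int_decay k" if "real_of_int (max 1 \<bar>k\<bar>) \<le> M" for k
    unfolding int_decay_def using that by (intro powr_mono2') auto
  have "1 / M ^ 3 = M powr (- 3)" using M by (simp add: powr_minus powr_numeral divide_inverse)
  also have "\<dots> = M powr (- 3 / 2) * M powr (- 3 / 2)" by (simp flip: powr_add)
  also have "\<dots> \<le> int_decay m * int_decay n"
    using d M by (intro mult_mono) auto
  finally show ?thesis by (simp add: M_def)
qed

lemma lat_inverse_bound:
  assumes "Im \<tau> > 0"
  obtains C where "C \<ge> 0" "\<And>m n. (m, n) \<noteq> (0, 0) \<Longrightarrow> 1 / norm (lat \<tau> m n) \<le> C / real_of_int (max \<bar>m\<bar> \<bar>n\<bar>)"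
proof -
  obtain \<delta> where \<delta>: "\<delta> > 0" "\<And>m n. norm (lat \<tau> m n) \<ge> \<delta> * real_of_int (max \<bar>m\<bar> \<bar>n\<bar>)"
    using lat_lower_bound[OF assms] by blast
  show ?thesis
  proof (rule that[of "1 / \<delta>"])
    fix m n :: int assume "(m, n) \<noteq> (0, 0)"
    then have "real_of_int (max \<bar>m\<bar> \<bar>n\<bar>) > 0" by auto
    then have "1 / norm (lat \<tau> m n) \<le> 1 / (\<delta> * real_of_int (max \<bar>m\<bar> \<bar>n\<bar>))"
      using \<delta> by (intro divide_left_mono mult_pos_pos less_le_trans[OF mult_pos_pos \<delta>(2)]) auto
    then show "1 / norm (lat \<tau> m n) \<le> (1 / \<delta>) / real_of_int (max \<bar>m\<bar> \<bar>n\<bar>)" by simp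
  qed (use \<delta> in simp)
qed

lemma lat_summable:
  assumes \<tau>: "Im \<tau> > 0" and w: "w \<ge> 3"
  shows "(\<lambda>x. norm (1 / lat \<tau> (fst x) (snd x) ^ w)) summable_on (UNIV \<times> UNIV)"
proof -
  obtain C where C: "C \<ge> 0" "\<And>m n. (m, n) \<noteq> (0, 0) \<Longrightarrow> 1 / norm (lat \<tau> m n) \<le> C / real_of_int (max \<bar>m\<bar> \<bar>n\<bar>)"
    using lat_inverse_bound[OF \<tau>] by blast
  show ?thesis
  proof (rule Infinite_Sum.abs_summable_on_comparison_test')
    show "(\<lambda>x. C ^ w * (int_decay (fst x) * int_decay (snd x))) summable_on (UNIV \<times> UNIV)"
      by (rule summable_on_cmult_right[OF int_decay_prod_summable])
    fix x :: "int \<times> int"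
    obtain m n where x: "x = (m, n)" by force
    show "norm (1 / lat \<tau> (fst x) (snd x) ^ w) \<le> C ^ w * (int_decay (fst x) * int_decay (snd x))"
    proof (cases "(m, n) = (0, 0)")
      case True
      then show ?thesis using w C by (simp add: x lat_def power_0_left)
    next
      case False
      define M where "M = real_of_int (max \<bar>m\<bar> \<bar>n\<bar>)"
      have M: "M \<ge> 1" using False by (auto simp: M_def)
      have "norm (1 / lat \<tau> m n ^ w) = (1 / norm (lat \<tau> m n)) ^ w"
        by (simp add: norm_divide norm_power power_divide)
      also have "\<dots> \<le> (C / M) ^ w"
        using C(2)[OF False] by (intro power_mono) (auto simp: M_def)
      also have "\<dots> = C ^ w * (1 / M ^ w)" by (simp add: power_divide)
      also have "1 / M ^ w \<le> 1 / M ^ 3"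
        using M w by (intro divide_left_mono power_increasing mult_pos_pos) auto
      also have "\<dots> \<le> int_decay m * int_decay n"
        using int_decay_bound[OF False] by (simp add: M_def)
      finally show ?thesis using C by (simp add: x mult_left_mono)
    qed
  qed
qed

text \<open>Since 1/0 = 0, the index 0 contributes nothing for w > 0; for even w \<ge> 2 this is 2
  \<zeta>(w).\<close>

definition zeta_sum :: "nat \<Rightarrow> complex" where
  "zeta_sum w = infsum (\<lambda>n::int. 1 / of_int n ^ w) UNIV"

lemma zeta_has_sum:
  assumes "w \<ge> 2" "even w"
  shows "((\<lambda>n::int. 1 / of_int n ^ w :: complex) has_sum zeta_sum w) UNIV" and "zeta_sum w \<noteq> 0"
proof -
  have "summable (\<lambda>n. norm (1 / (1 + of_nat n :: complex) ^ w))"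
    by (rule norm_summable_inverse_power) (use assms in auto)
  then have s: "summable (\<lambda>n. norm (1 / of_nat (Suc n) ^ w :: complex))" by simp
  define S where "S = suminf (\<lambda>n. 1 / real (Suc n) ^ w)"
  have sS: "(\<lambda>n. 1 / real (Suc n) ^ w) sums S"
    using s unfolding S_def by (intro summable_sums) (simp add: norm_divide norm_power del: of_nat_Suc)
  have "(\<lambda>n. of_real (1 / real (Suc n) ^ w) :: complex) sums of_real S"
    using sS by (rule sums_of_real)
  then have "(\<lambda>n. 1 / of_nat (Suc n) ^ w :: complex) sums of_real S" by simp
  from norm_summable_imp_has_sum[OF s this]
  have 1: "((\<lambda>n. 1 / of_nat (Suc n) ^ w :: complex) has_sum of_real S) UNIV" .
  have neg: "((\<lambda>n. 1 / of_int (- int (Suc n)) ^ w :: complex) has_sum of_real S) UNIV"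
    using 1 assms(2) by (simp add: power_minus_even del: of_nat_Suc)
  have "((\<lambda>n. 1 / of_nat n ^ w :: complex) has_sum of_real S) {1..}"
    using 1 has_sum_reindex_bij_betw[of Suc UNIV "{1..}" "\<lambda>n. 1 / of_nat n ^ w :: complex" "of_real S"]
      bij_betwI[of Suc UNIV "{1..}" "\<lambda>m. m - 1"] by auto
  moreover have "((\<lambda>n. 1 / of_nat n ^ w :: complex) has_sum of_real S) {1..} \<longleftrightarrow>
      ((\<lambda>n. 1 / of_int (int n) ^ w :: complex) has_sum of_real S) UNIV"
    by (rule has_sum_cong_neutral) (use assms in \<open>auto simp: not_le\<close>)
  ultimately have pos: "((\<lambda>n. 1 / of_int (int n) ^ w :: complex) has_sum of_real S) UNIV" by simp
  have hs: "((\<lambda>n::int. 1 / of_int n ^ w :: complex) has_sum (of_real S + of_real S)) UNIV"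
    by (rule has_sum_int[of "\<lambda>n. 1 / of_int n ^ w", OF pos neg])
  then have z: "zeta_sum w = of_real S + of_real S" unfolding zeta_sum_def by (rule infsumI)
  show "((\<lambda>n::int. 1 / of_int n ^ w :: complex) has_sum zeta_sum w) UNIV" unfolding z by (rule hs)
  have "0 < S" unfolding S_def
    using sS by (intro suminf_pos) (auto simp: sums_iff)
  moreover have "zeta_sum w = of_real (2 * S)" unfolding z by simp
  ultimately show "zeta_sum w \<noteq> 0" by simp
qed

definition eis_coeff :: "nat \<Rightarrow> complex" where
  "eis_coeff k = (2 * of_real pi * \<i>) ^ (k + 1) / fact k"

definition row_sum :: "nat \<Rightarrow> complex \<Rightarrow> int \<Rightarrow> complex" where
  "row_sum k \<tau> m = (if m = 0 then zeta_sum (k + 1) else eis_coeff k * pser k (nome \<tau> ^ nat \<bar>m\<bar>))"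

text \<open>For odd k this is the lattice sum G_(k+1) of (m \<tau> + n)^(-k-1), summed over n first
  and then over m; the origin contributes 1/0 = 0. For k = 1 the order of summation matters.\<close>

definition eis :: "nat \<Rightarrow> complex \<Rightarrow> complex" where
  "eis k \<tau> = zeta_sum (k + 1) + 2 * eis_coeff k * eval_fps (sigma_fps k) (nome \<tau>)"

lemma nome_of_nat_mult: "nome (of_nat m * \<tau>) = nome \<tau> ^ m"
  by (simp add: nome_def exp_of_nat_mult[symmetric] mult_ac)

lemma row_has_sum:
  assumes \<tau>: "Im \<tau> > 0" and k: "odd k"
  shows "((\<lambda>n. 1 / lat \<tau> m n ^ (k + 1)) has_sum row_sum k \<tau> m) UNIV"
proof -
  have k1: "k + 1 \<ge> 2" "even (k + 1)" using k by (auto elim: oddE)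
  have pos: "((\<lambda>n. 1 / lat \<tau> (int m) n ^ (k + 1)) has_sum row_sum k \<tau> (int m)) UNIV" if "m > 0" for m
    using lipschitz_formula[of "of_nat m * \<tau>" k] \<tau> k that
    by (simp add: lat_def row_sum_def eis_coeff_def nome_of_nat_mult)
  consider "m = 0" | "m > 0" | "m < 0" by linarith
  then show ?thesis
  proof cases
    case 1
    then show ?thesis using zeta_has_sum(1)[OF k1] by (simp add: lat_def row_sum_def)
  next
    case 2
    then show ?thesis using pos[of "nat m"] by simp
  next
    case 3
    have "bij_betw uminus (UNIV :: int set) UNIV" by (rule bij_betwI[of _ _ _ uminus]) auto
    from has_sum_reindex_bij_betw[OF this, of "\<lambda>n. 1 / lat \<tau> (- m) n ^ (k + 1)" "row_sum k \<tau> (- m)"]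
    have "((\<lambda>n. 1 / lat \<tau> (- m) (- n) ^ (k + 1)) has_sum row_sum k \<tau> (- m)) UNIV"
      using pos[of "nat (- m)"] 3 by simp
    moreover have "lat \<tau> (- m) (- n) ^ (k + 1) = lat \<tau> m n ^ (k + 1)" for n
    proof -
      have "lat \<tau> (- m) (- n) = - lat \<tau> m n" by (simp add: lat_def)
      then show ?thesis using k1(2) by (simp only: power_minus_even)
    qed
    moreover have "row_sum k \<tau> (- m) = row_sum k \<tau> m" by (simp add: row_sum_def)
    ultimately show ?thesis by simp
  qed
qed

lemma row_sums_has_sum:
  assumes \<tau>: "Im \<tau> > 0" and k: "odd k"
  shows "(row_sum k \<tau> has_sum eis k \<tau>) UNIV"
proof -
  let ?E = "eis_coeff k * eval_fps (sigma_fps k) (nome \<tau>)"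
  have k1: "k \<ge> 1" using k by (auto elim: oddE)
  have 1: "((\<lambda>m. eis_coeff k * pser k (nome \<tau> ^ m)) has_sum ?E) {1..}"
    by (rule has_sum_cmult_right[OF lambert_has_sum(1)[OF norm_nome_less_1[OF \<tau>] k1]])
  have neg: "((\<lambda>m. row_sum k \<tau> (- int (Suc m))) has_sum ?E) UNIV"
    using 1 has_sum_reindex_bij_betw[of Suc UNIV "{1..}" "\<lambda>m. eis_coeff k * pser k (nome \<tau> ^ m)" ?E]
      bij_betwI[of Suc UNIV "{1..}" "\<lambda>m. m - 1"] by (simp add: row_sum_def nat_add_distrib)
  have "((\<lambda>m. row_sum k \<tau> (int m)) has_sum ?E) {1..}"
    using 1 by (rule has_sum_cong[THEN iffD1, rotated]) (simp add: row_sum_def)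
  then have "((\<lambda>m. row_sum k \<tau> (int m)) has_sum (row_sum k \<tau> (int 0) + ?E)) (insert 0 {1..})"
    by (subst has_sum_insert) auto
  moreover have "insert 0 {1..} = (UNIV :: nat set)" by auto
  ultimately have pos: "((\<lambda>m. row_sum k \<tau> (int m)) has_sum (zeta_sum (k + 1) + ?E)) UNIV"
    by (simp add: row_sum_def)
  have "zeta_sum (k + 1) + ?E + ?E = eis k \<tau>" by (simp add: eis_def)
  with has_sum_int[of "row_sum k \<tau>", OF pos neg] show ?thesis by (simp only:)
qed

lemma eis_period: "eis k (\<tau> + of_int n) = eis k \<tau>"
proof -
  have "nome (\<tau> + of_int n) = nome \<tau>"
    using exp_integer_2pi[of "of_int n"] by (simp add: nome_def distrib_left exp_add mult_ac)
  then show ?thesis by (simp add: eis_def)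
qed

lemma Im_minus_inverse: "Im \<tau> > 0 \<Longrightarrow> Im (- 1 / \<tau>) > 0"
proof -
  assume "Im \<tau> > 0"
  moreover have "Im (- 1 / \<tau>) = Im \<tau> / ((Re \<tau>)\<^sup>2 + (Im \<tau>)\<^sup>2)" by (simp add: Im_divide)
  ultimately show ?thesis by (simp add: sum_power2_gt_zero_iff)
qed

text \<open>For k \<ge> 3 the double sum converges absolutely and may be reindexed by (m, n) to (n,
  -m), which corresponds to multiplying the lattice by \<tau>.\<close>

theorem eis_modular:
  assumes \<tau>: "Im \<tau> > 0" and k: "odd k" "k \<ge> 3"
  shows "eis k (- 1 / \<tau>) = \<tau> ^ (k + 1) * eis k \<tau>"
proof -
  let ?f = "\<lambda>\<tau> x. 1 / lat \<tau> (fst x) (snd x) ^ (k + 1)"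
  have eq: "(?f \<tau> has_sum eis k \<tau>) (UNIV \<times> UNIV)" if \<tau>: "Im \<tau> > 0" for \<tau>
  proof -
    have hs: "(?f \<tau> has_sum infsum (?f \<tau>) (UNIV \<times> UNIV)) (UNIV \<times> UNIV)"
      by (rule has_sum_infsum[OF abs_summable_summable[OF lat_summable[OF \<tau>]]]) (use k in simp)
    have "(row_sum k \<tau> has_sum infsum (?f \<tau>) (UNIV \<times> UNIV)) UNIV"
      by (rule has_sum_Sigma'[OF hs]) (simp only: fst_conv snd_conv row_has_sum[OF \<tau> k(1)])
    then have "infsum (?f \<tau>) (UNIV \<times> UNIV) = eis k \<tau>"
      by (rule has_sum_unique[OF _ row_sums_has_sum[OF \<tau> k(1)]])
    with hs show ?thesis by (simp only:)
  qed
  have \<tau>0: "\<tau> \<noteq> 0" using \<tau> by auto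
  have "bij_betw (\<lambda>(m, n). (n, - m)) (UNIV \<times> UNIV) (UNIV \<times> (UNIV :: int set))"
    by (rule bij_betwI[of _ _ _ "\<lambda>(m, n). (- n, m)"]) auto
  from has_sum_reindex_bij_betw[OF this, of "?f \<tau>" "eis k \<tau>"] eq[OF \<tau>]
  have "((\<lambda>x. ?f \<tau> (case x of (m, n) \<Rightarrow> (n, - m))) has_sum eis k \<tau>) (UNIV \<times> UNIV)" by simp
  note hs = has_sum_cmult_right[OF this, of "\<tau> ^ (k + 1)"]
  have fe: "(\<lambda>x. \<tau> ^ (k + 1) * ?f \<tau> (case x of (m, n) \<Rightarrow> (n, - m))) = ?f (- 1 / \<tau>)"
  proof
    fix x :: "int \<times> int"
    obtain m n where x: "x = (m, n)" by force
    have "lat (- 1 / \<tau>) m n = lat \<tau> n (- m) / \<tau>"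
      using \<tau>0 by (simp add: lat_def divide_simps)
    then show "\<tau> ^ (k + 1) * ?f \<tau> (case x of (m, n) \<Rightarrow> (n, - m)) = ?f (- 1 / \<tau>) x"
      by (simp add: x power_divide)
  qed
  show ?thesis by (rule has_sum_unique[OF eq[OF Im_minus_inverse[OF \<tau>]] hs[unfolded fe]])
qed

section \<open>The transformation of \<open>G\<^sub>2\<close>\<close>

lemma has_sum_diff:
  fixes f g :: "'a \<Rightarrow> complex"
  assumes "(f has_sum a) A" "(g has_sum b) A"
  shows "((\<lambda>x. f x - g x) has_sum (a - b)) A"
  using has_sum_add[OF assms(1) has_sum_cmult_right[OF assms(2), of "- 1"]] by simp

lemma has_sum_finite_sum:
  fixes f :: "'i \<Rightarrow> 'a \<Rightarrow> complex"
  assumes "\<And>i. i \<in> I \<Longrightarrow> (f i has_sum a i) A"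
  shows "((\<lambda>x. \<Sum>i\<in>I. f i x) has_sum (\<Sum>i\<in>I. a i)) A"
  using assms by (induction I rule: infinite_finite_induct) (simp_all add: has_sum_add)

lemma has_sum_remove_0:
  fixes f :: "int \<Rightarrow> complex"
  assumes "(f has_sum a) UNIV"
  shows "((\<lambda>n. if n = 0 then 0 else f n) has_sum (a - f 0)) UNIV"
proof -
  have "((\<lambda>n::int. if n = 0 then f 0 else 0) has_sum f 0) UNIV \<longleftrightarrow> ((\<lambda>n::int. if n = 0 then f 0 else 0) has_sum f 0) {0::int}"
    by (rule has_sum_cong_neutral) auto
  then have "((\<lambda>n::int. if n = 0 then f 0 else 0) has_sum f 0) UNIV" by (simp add: has_sum_finiteI)
  from has_sum_diff[OF assms this]
  have "((\<lambda>n. f n - (if n = 0 then f 0 else 0)) has_sum (a - f 0)) UNIV" .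
  moreover have "(\<lambda>n. f n - (if n = 0 then f 0 else 0)) = (\<lambda>n. if n = 0 then 0 else f n)" by auto
  ultimately show ?thesis by simp
qed

lemma has_sum_int_interval_tendsto:
  fixes f :: "int \<Rightarrow> complex"
  assumes "(f has_sum a) UNIV"
  shows "(\<lambda>N. \<Sum>n\<in>{- int N..<int N}. f n) \<longlonglongrightarrow> a"
proof -
  have "filterlim (\<lambda>N. {- int N..<int N}) (finite_subsets_at_top UNIV) sequentially"
    unfolding filterlim_finite_subsets_at_top
  proof (intro allI impI)
    fix X :: "int set" assume X: "finite X \<and> X \<subseteq> UNIV"
    define K where "K = Max (insert 0 (abs ` X)) + 1"
    have K: "\<bar>x\<bar> < K" if "x \<in> X" for x
      unfolding K_def using X that by (intro zless_add1_eq[THEN iffD2] disjCI) (metis Max_ge finite.insertI finite_imageI image_eqI insertI2 le_less)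
    show "\<forall>\<^sub>F N in sequentially. finite {- int N..<int N} \<and> X \<subseteq> {- int N..<int N} \<and> {- int N..<int N} \<subseteq> UNIV"
      using eventually_ge_at_top[of "nat K"]
    proof eventually_elim
      case (elim N)
      have "x \<in> {- int N..<int N}" if "x \<in> X" for x
        using K[OF that] elim by auto
      then show ?case by auto
    qed
  qed
  with assms show ?thesis unfolding has_sum_def by (rule filterlim_compose)
qed

lemma sum_int_telescope:
  fixes f :: "int \<Rightarrow> complex"
  shows "(\<Sum>n\<in>{- int N..<int N}. f n - f (n + 1)) = f (- int N) - f (int N)"
proof (induction N)
  case (Suc N)
  have "{- int (Suc N)..<int (Suc N)} = insert (- int N - 1) (insert (int N) {- int N..<int N})" by auto
  moreover have "- int N - 1 \<notin> insert (int N) {- int N..<int N}" "int N \<notin> {- int N..<int N}" by auto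
  ultimately have "(\<Sum>n\<in>{- int (Suc N)..<int (Suc N)}. f n - f (n + 1)) =
      (f (- int N - 1) - f (- int N - 1 + 1)) + ((f (int N) - f (int N + 1)) + (\<Sum>n\<in>{- int N..<int N}. f n - f (n + 1)))"
    by (simp only: sum.insert finite_insert finite_atLeastLessThan_int not_False_eq_True)
  also have "- int N - 1 + 1 = - int N" by simp
  also have "(f (- int N - 1) - f (- int N)) + ((f (int N) - f (int N + 1)) + (\<Sum>n\<in>{- int N..<int N}. f n - f (n + 1))) =
      f (- int N - 1) - f (int N + 1)"
    unfolding Suc by simp
  also have "- int N - 1 = - int (Suc N)" by simp
  also have "int N + 1 = int (Suc N)" by simp
  finally show ?case .
qed simp

text \<open>Eisenstein's device for weight 2. With L the lattice point, subtracting the telescoping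
  difference 1/L - 1/(L+1) from 1/L^2 leaves 1/(L^2 (L+1)), which is absolutely summable over all m
  \<noteq> 0 and n.\<close>

definition corr :: "complex \<Rightarrow> int \<Rightarrow> int \<Rightarrow> complex" where
  "corr \<tau> m n = (if m = 0 then 0 else 1 / lat \<tau> m n ^ 2 - (1 / lat \<tau> m n - 1 / lat \<tau> m (n + 1)))"

lemma corr_summable:
  assumes \<tau>: "Im \<tau> > 0"
  shows "(\<lambda>x. corr \<tau> (fst x) (snd x)) summable_on (UNIV \<times> UNIV)"
proof (rule abs_summable_summable)
  obtain C where C: "C \<ge> 0" "\<And>m n. (m, n) \<noteq> (0, 0) \<Longrightarrow> 1 / norm (lat \<tau> m n) \<le> C / real_of_int (max \<bar>m\<bar> \<bar>n\<bar>)"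
    using lat_inverse_bound[OF \<tau>] by blast
  show "(\<lambda>x. norm (corr \<tau> (fst x) (snd x))) summable_on (UNIV \<times> UNIV)"
  proof (rule Infinite_Sum.abs_summable_on_comparison_test')
    show "(\<lambda>x. 2 * C ^ 3 * (int_decay (fst x) * int_decay (snd x))) summable_on (UNIV \<times> UNIV)"
      by (rule summable_on_cmult_right[OF int_decay_prod_summable])
    fix x :: "int \<times> int"
    obtain m n where x: "x = (m, n)" by force
    have "norm (corr \<tau> m n) \<le> 2 * C ^ 3 * (int_decay m * int_decay n)"
    proof (cases "m = 0")
      case True
      then show ?thesis using C by (simp add: corr_def)
    next
      case False
      define L where "L = lat \<tau> m n"
      define L' where "L' = lat \<tau> m (n + 1)"
      define M where "M = real_of_int (max \<bar>m\<bar> \<bar>n\<bar>)"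
      have M: "M \<ge> 1" using False by (auto simp: M_def)
      have LL: "L' = L + 1" by (simp add: L_def L'_def lat_def)
      have nz: "L \<noteq> 0" "L' \<noteq> 0" using False lat_eq_0_iff[OF \<tau>] by (auto simp: L_def L'_def)
      have "corr \<tau> m n = 1 / L ^ 2 - (1 / L - 1 / L')" using False by (simp add: corr_def L_def L'_def)
      also have "\<dots> = 1 / L ^ 2 * (1 / L')" using nz unfolding LL by (simp add: divide_simps power2_eq_square)
      finally have "norm (corr \<tau> m n) = (1 / norm L) ^ 2 * (1 / norm L')"
        by (simp add: norm_divide norm_power norm_mult power_divide)
      also have "\<dots> \<le> (C / M) ^ 2 * (2 * (C / M))"
      proof (intro mult_mono power_mono)
        show "1 / norm L \<le> C / M" using C(2)[of m n] False by (simp add: L_def M_def)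
        have "1 / norm L' \<le> C / real_of_int (max \<bar>m\<bar> \<bar>n + 1\<bar>)" using C(2)[of m "n + 1"] False by (simp add: L'_def)
        also have "\<dots> \<le> C / (M / 2)"
        proof (intro divide_left_mono)
          have "max \<bar>m\<bar> \<bar>n\<bar> \<le> 2 * max \<bar>m\<bar> (\<bar>n + 1\<bar>)"
          proof (rule max.boundedI)
            have "\<bar>m\<bar> \<ge> 1" using False by linarith
            moreover have "\<bar>n\<bar> \<le> \<bar>n + 1\<bar> + 1" by linarith
            ultimately show "\<bar>m\<bar> \<le> 2 * max \<bar>m\<bar> (\<bar>n + 1\<bar>)" "\<bar>n\<bar> \<le> 2 * max \<bar>m\<bar> (\<bar>n + 1\<bar>)"
              using max.cobounded1[of "\<bar>m\<bar>" "\<bar>n + 1\<bar>"] max.cobounded2[of "\<bar>n + 1\<bar>" "\<bar>m\<bar>"]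
              by linarith+
          qed
          then show "M / 2 \<le> real_of_int (max \<bar>m\<bar> \<bar>n + 1\<bar>)" unfolding M_def by linarith
          then show "0 < real_of_int (max \<bar>m\<bar> \<bar>n + 1\<bar>) * (M / 2)" using M by (intro mult_pos_pos) linarith+
        qed (use C in simp)
        finally show "1 / norm L' \<le> 2 * (C / M)" by (simp add: mult.commute)
      qed (use C M in auto)
      also have "\<dots> = 2 * C ^ 3 * (1 / M ^ 3)" by (simp add: power2_eq_square power3_eq_cube)
      also have "\<dots> \<le> 2 * C ^ 3 * (int_decay m * int_decay n)"
        using int_decay_bound[of m n] False C by (intro mult_left_mono) (auto simp: M_def)
      finally show ?thesis .
    qed
    then show "norm (corr \<tau> (fst x) (snd x)) \<le> 2 * C ^ 3 * (int_decay (fst x) * int_decay (snd x))" by (simp add: x)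
  qed
qed

lemma inverse_lat_tendsto_0: "(\<lambda>N. 1 / lat \<tau> m (int N)) \<longlonglongrightarrow> 0" "(\<lambda>N. 1 / lat \<tau> m (- int N)) \<longlonglongrightarrow> 0"
proof -
  have "filterlim (\<lambda>N. of_int m * \<tau> + of_nat N) at_infinity sequentially"
    by (intro tendsto_add_filterlim_at_infinity[OF tendsto_const] tendsto_of_nat)
  from tendsto_divide_0[OF tendsto_const this] show "(\<lambda>N. 1 / lat \<tau> m (int N)) \<longlonglongrightarrow> 0"
    by (simp add: lat_def)
  have "filterlim (\<lambda>N. of_int (- m) * \<tau> + of_nat N) at_infinity sequentially"
    by (intro tendsto_add_filterlim_at_infinity[OF tendsto_const] tendsto_of_nat)
  from tendsto_divide_0[OF tendsto_const this] have "(\<lambda>N. - 1 / (of_int (- m) * \<tau> + of_nat N)) \<longlonglongrightarrow> 0" .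
  moreover have "- 1 / (of_int (- m) * \<tau> + of_nat N) = 1 / lat \<tau> m (- int N)" for N
    unfolding lat_def by (metis (no_types, opaque_lifting) ab_group_add_class.ab_diff_conv_add_uminus add_uminus_conv_diff
      minus_add_distrib minus_divide_divide minus_minus mult_minus_left of_int_minus of_int_of_nat_eq)
  ultimately show "(\<lambda>N. 1 / lat \<tau> m (- int N)) \<longlonglongrightarrow> 0" by simp
qed

text \<open>Along a row the subtracted differences telescope to 0, so the correction is invisible
  when rows are summed first.\<close>

lemma corr_row_has_sum:
  assumes \<tau>: "Im \<tau> > 0"
  shows "((\<lambda>n. corr \<tau> m n) has_sum (if m = 0 then 0 else row_sum 1 \<tau> m)) UNIV"
proof (cases "m = 0")
  case True
  then show ?thesis by (simp add: corr_def)
next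
  case False
  have "(\<lambda>n. corr \<tau> m n) summable_on UNIV"
    using summable_on_SigmaD1[of "\<lambda>x y. corr \<tau> x y" UNIV "\<lambda>_. UNIV" m] corr_summable[OF \<tau>] by (simp add: case_prod_unfold)
  then obtain c where c: "((\<lambda>n. corr \<tau> m n) has_sum c) UNIV" by (auto simp: summable_on_def)
  have r: "((\<lambda>n. 1 / lat \<tau> m n ^ 2) has_sum row_sum 1 \<tau> m) UNIV"
    using row_has_sum[OF \<tau>, of 1 m] by (simp only: one_add_one odd_one simp_thms)
  have eq: "(\<lambda>n. 1 / lat \<tau> m n ^ 2 - corr \<tau> m n) = (\<lambda>n. 1 / lat \<tau> m n - 1 / lat \<tau> m (n + 1))"
    using False by (simp add: corr_def)
  have 1: "(\<lambda>N. \<Sum>n\<in>{- int N..<int N}. 1 / lat \<tau> m n - 1 / lat \<tau> m (n + 1)) \<longlonglongrightarrow> row_sum 1 \<tau> m - c"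
    using has_sum_int_interval_tendsto[OF has_sum_diff[OF r c]] unfolding eq .
  have 2: "(\<lambda>N. 1 / lat \<tau> m (- int N) - 1 / lat \<tau> m (int N)) \<longlonglongrightarrow> 0 - 0"
    by (rule tendsto_diff[OF inverse_lat_tendsto_0(2,1)])
  have "row_sum 1 \<tau> m - c = 0 - 0"
    by (rule LIMSEQ_unique[OF 1[unfolded sum_int_telescope[of "\<lambda>n. 1 / lat \<tau> m n"]] 2])
  then show ?thesis using c False by simp
qed

text \<open>The partial fractions of \<pi> cot(\<pi> x): in the limit formulas for
  \<open>Digamma x\<close> and \<open>Digamma (1 - x)\<close> the logarithms cancel.\<close>

lemma cotangent_sum:
  assumes x: "Im x > 0"
  shows "(\<lambda>M. \<Sum>m=1..M. 1 / (x + of_nat m) + 1 / (x - of_nat m)) \<longlonglongrightarrow>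
    - (of_real pi * \<i> * (2 * pser 0 (nome x) - 1)) - 1 / x"
proof -
  have nz: "x \<noteq> 0" "1 - x \<noteq> 0" using x by auto
  have "(\<lambda>M. (\<Sum>n<M. inverse (1 - x + of_nat n)) - (\<Sum>n<M. inverse (x + of_nat n))) \<longlonglongrightarrow> Digamma x - Digamma (1 - x)"
    using tendsto_diff[OF Digamma_LIMSEQ[OF nz(1)] Digamma_LIMSEQ[OF nz(2)]] by simp
  from tendsto_minus[OF this]
  have "(\<lambda>M. (\<Sum>n<M. inverse (x + of_nat n)) - (\<Sum>n<M. inverse (1 - x + of_nat n))) \<longlonglongrightarrow>
      - (of_real pi * \<i> * (2 * pser 0 (nome x) - 1))"
    by (simp add: Digamma_reflection[OF x])
  from LIMSEQ_Suc[OF this]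
  have 1: "(\<lambda>M. (\<Sum>n<Suc M. inverse (x + of_nat n)) - (\<Sum>n<Suc M. inverse (1 - x + of_nat n))) \<longlonglongrightarrow>
      - (of_real pi * \<i> * (2 * pser 0 (nome x) - 1))" .
  have "filterlim (\<lambda>M. (1 - x) + of_nat M :: complex) at_infinity sequentially"
    by (intro tendsto_add_filterlim_at_infinity[OF tendsto_const] tendsto_of_nat)
  from tendsto_divide_0[OF tendsto_const this]
  have 2: "(\<lambda>M. 1 / (1 - x + of_nat M)) \<longlonglongrightarrow> 0" .
  have "(\<Sum>m=1..M. 1 / (x + of_nat m) + 1 / (x - of_nat m)) =
      (\<Sum>n<Suc M. inverse (x + of_nat n)) - (\<Sum>n<Suc M. inverse (1 - x + of_nat n)) + 1 / (1 - x + of_nat M) - 1 / x" for M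
  proof -
    have a: "(\<Sum>m=1..M. 1 / (x + of_nat m)) = (\<Sum>n<Suc M. inverse (x + of_nat n)) - 1 / x"
      by (induction M) (simp_all add: inverse_eq_divide)
    have b: "(\<Sum>m=1..M. 1 / (x - of_nat m)) = - (\<Sum>n<M. inverse (1 - x + of_nat n))"
    proof (induction M)
      case (Suc M)
      have "x - of_nat (Suc M) = - (1 - x + of_nat M)" by simp
      then have "1 / (x - of_nat (Suc M)) = - inverse (1 - x + of_nat M)" by (simp only: inverse_eq_divide divide_minus_right)
      then show ?case using Suc by simp
    qed simp
    show ?thesis unfolding sum.distrib a b by (simp add: inverse_eq_divide)
  qed
  then show ?thesis
    using tendsto_diff[OF tendsto_add[OF 1 2] tendsto_const[of "1 / x"]] by simp
qed

text \<open>The boundary terms left by telescoping over \<bar>n\<bar> up to N. Dividing by \<tau>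
  turns them into partial fractions of the cotangent at -N/\<tau>, a point of the upper half
  plane.\<close>

lemma eis_2_column_sum:
  assumes \<tau>: "Im \<tau> > 0" and N: "N > 0"
    and s: "((\<lambda>m. if m = 0 then 0 else 1 / lat \<tau> m (- int N) - 1 / lat \<tau> m (int N)) has_sum t) UNIV"
  shows "t = 2 / \<tau> * (- (of_real pi * \<i> * (2 * pser 0 (nome (of_nat N * (- 1 / \<tau>))) - 1)) + \<tau> / of_nat N)"
proof -
  have \<tau>0: "\<tau> \<noteq> 0" using \<tau> by auto
  define x where "x = of_nat N * (- 1 / \<tau>)"
  have "Im x = real N * Im (- 1 / \<tau>)"
    unfolding x_def by (simp only: times_complex.sel complex_Re_of_nat complex_Im_of_nat mult_zero_left add_0_right)
  then have x: "Im x > 0" using Im_minus_inverse[OF \<tau>] N by (simp only: of_nat_0_less_iff mult_pos_pos)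
  define D :: "int \<Rightarrow> complex" where "D m = (if m = 0 then 0 else 1 / lat \<tau> m (- int N) - 1 / lat \<tau> m (int N))" for m
  have Dt: "(D has_sum t) UNIV" using s unfolding D_def .
  have Dneg: "D (- m) = D m" for m
  proof -
    have "lat \<tau> (- m) (- int N) = - lat \<tau> m (int N)" "lat \<tau> (- m) (int N) = - lat \<tau> m (- int N)"
      by (simp_all add: lat_def)
    then show ?thesis by (simp add: D_def)
  qed
  have "D summable_on {1..}"
    by (rule summable_on_subset_banach[of _ UNIV]) (use Dt in \<open>auto simp: summable_on_def\<close>)
  moreover have "bij_betw (\<lambda>m. int (Suc m)) UNIV {1..}"
    by (rule bij_betwI[of _ _ _ "\<lambda>m. nat m - 1"]) auto
  ultimately have "(\<lambda>m. D (int (Suc m))) summable_on UNIV"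
    using summable_on_reindex_bij_betw[of "\<lambda>m. int (Suc m)" UNIV "{1..}" D] by blast
  then obtain p where p: "((\<lambda>m. D (int (Suc m))) has_sum p) UNIV" by (auto simp: summable_on_def)
  have neg: "((\<lambda>m. D (- int (Suc m))) has_sum p) UNIV" unfolding Dneg by (rule p)
  have "((\<lambda>m. D (int m)) has_sum p) {1..}"
    using p has_sum_reindex_bij_betw[of Suc UNIV "{1..}" "\<lambda>m. D (int m)" p]
      bij_betwI[of Suc UNIV "{1..}" "\<lambda>m. m - 1"] by auto
  moreover have "((\<lambda>m. D (int m)) has_sum p) {1..} \<longleftrightarrow> ((\<lambda>m. D (int m)) has_sum p) UNIV"
    by (rule has_sum_cong_neutral) (auto simp: D_def not_le)
  ultimately have "((\<lambda>m. D (int m)) has_sum p) UNIV" by simp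
  from has_sum_unique[OF Dt has_sum_int[of D, OF this neg]] have t: "t = p + p" .
  have D: "D (int m) = (1 / \<tau>) * (1 / (x + of_nat m) + 1 / (x - of_nat m))" if "m > 0" for m
  proof -
    have "lat \<tau> (int m) (- int N) = \<tau> * (x + of_nat m)" "lat \<tau> (int m) (int N) = - (\<tau> * (x - of_nat m))"
      using \<tau>0 by (simp_all add: lat_def x_def algebra_simps)
    then show ?thesis using that by (simp add: D_def distrib_left)
  qed
  have "(\<lambda>M. \<Sum>m<M. D (int (Suc m))) \<longlonglongrightarrow> p"
    using has_sum_imp_sums[OF p] by (simp add: sums_def)
  moreover have "(\<Sum>m<M. D (int (Suc m))) = (1 / \<tau>) * (\<Sum>m=1..M. 1 / (x + of_nat m) + 1 / (x - of_nat m))" for M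
    unfolding sum_distrib_left by (rule sum.reindex_bij_witness[of _ "\<lambda>m. m - 1" Suc]) (auto simp: D simp del: of_nat_Suc)
  ultimately have "(\<lambda>M. (1 / \<tau>) * (\<Sum>m=1..M. 1 / (x + of_nat m) + 1 / (x - of_nat m))) \<longlonglongrightarrow> p" by simp
  moreover have "(\<lambda>M. (1 / \<tau>) * (\<Sum>m=1..M. 1 / (x + of_nat m) + 1 / (x - of_nat m))) \<longlonglongrightarrow>
      (1 / \<tau>) * (- (of_real pi * \<i> * (2 * pser 0 (nome x) - 1)) - 1 / x)"
    by (rule tendsto_mult[OF tendsto_const cotangent_sum[OF x]])
  ultimately have "p = (1 / \<tau>) * (- (of_real pi * \<i> * (2 * pser 0 (nome x) - 1)) - 1 / x)"
    by (rule LIMSEQ_unique)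
  moreover have "- (of_real pi * \<i> * (2 * pser 0 (nome x) - 1)) - 1 / x =
      - (of_real pi * \<i> * (2 * pser 0 (nome x) - 1)) + \<tau> / of_nat N" using \<tau>0 N by (simp add: x_def)
  ultimately have "p = (1 / \<tau>) * (- (of_real pi * \<i> * (2 * pser 0 (nome x) - 1)) + \<tau> / of_nat N)"
    by (simp only:)
  then show ?thesis unfolding t x_def[symmetric] by simp
qed

text \<open>The sum of \<open>corr\<close> is computed twice. By rows it is
  \<open>eis 1 \<tau>\<close> up to the row m = 0; by columns it is
  \<open>eis 1 (- 1 / \<tau>) / \<tau> ^ 2\<close> up to the same constant, minus the limit of the
  boundary terms, which no longer vanish.\<close>

theorem eis_2_transformation:
  assumes \<tau>: "Im \<tau> > 0"
  shows "eis 1 (- 1 / \<tau>) = \<tau> ^ 2 * eis 1 \<tau> - 2 * of_real pi * \<i> * \<tau>"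
proof -
  have \<tau>0: "\<tau> \<noteq> 0" using \<tau> by auto
  let ?\<tau>' = "- 1 / \<tau>" and ?Z = "zeta_sum 2"
  have \<tau>': "Im ?\<tau>' > 0" by (rule Im_minus_inverse[OF \<tau>])
  have one: "(1::nat) + 1 = 2" by simp
  define \<beta> where "\<beta> = infsum (\<lambda>x. corr \<tau> (fst x) (snd x)) (UNIV \<times> UNIV)"
  have \<beta>: "((\<lambda>x. corr \<tau> (fst x) (snd x)) has_sum \<beta>) (UNIV \<times> UNIV)"
    unfolding \<beta>_def by (rule has_sum_infsum[OF corr_summable[OF \<tau>]])
  have "((\<lambda>m. if m = 0 then 0 else row_sum 1 \<tau> m) has_sum \<beta>) UNIV"
    by (rule has_sum_Sigma'[OF \<beta>]) (simp only: fst_conv snd_conv corr_row_has_sum[OF \<tau>])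
  moreover have "((\<lambda>m. if m = 0 then 0 else row_sum 1 \<tau> m) has_sum (eis 1 \<tau> - ?Z)) UNIV"
    using has_sum_remove_0[OF row_sums_has_sum[OF \<tau> odd_one]] by (simp add: row_sum_def one del: One_nat_def)
  ultimately have \<beta>_eq: "\<beta> = eis 1 \<tau> - ?Z" by (rule has_sum_unique)
  \<comment> \<open>Because m \<tau> + n = -\<tau> (n (-1/\<tau>) - m), a column for \<tau> is a row
    for -1/\<tau> divided by \<tau>^2; the term m = 0 is then taken out.\<close>
  define colf where "colf n = row_sum 1 ?\<tau>' n / \<tau> ^ 2 - 1 / of_int n ^ 2" for n :: int
  have colf: "((\<lambda>m. if m = 0 then 0 else 1 / lat \<tau> m n ^ 2) has_sum colf n) UNIV" for n
  proof -
    have "((\<lambda>k. 1 / lat ?\<tau>' n k ^ 2) has_sum row_sum 1 ?\<tau>' n) UNIV"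
      using row_has_sum[OF \<tau>' odd_one, of n] by (simp only: one)
    from has_sum_cmult_right[OF this, of "1 / \<tau> ^ 2"]
    have "((\<lambda>k. 1 / \<tau> ^ 2 * (1 / lat ?\<tau>' n k ^ 2)) has_sum row_sum 1 ?\<tau>' n / \<tau> ^ 2) UNIV" by simp
    moreover have "bij_betw uminus (UNIV :: int set) UNIV" by (rule bij_betwI[of _ _ _ uminus]) auto
    ultimately have "((\<lambda>m. 1 / \<tau> ^ 2 * (1 / lat ?\<tau>' n (- m) ^ 2)) has_sum row_sum 1 ?\<tau>' n / \<tau> ^ 2) UNIV"
      using has_sum_reindex_bij_betw[of uminus UNIV UNIV "\<lambda>k. 1 / \<tau> ^ 2 * (1 / lat ?\<tau>' n k ^ 2)"] by simp
    moreover have "1 / \<tau> ^ 2 * (1 / lat ?\<tau>' n (- m) ^ 2) = 1 / lat \<tau> m n ^ 2" for m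
    proof -
      have "lat ?\<tau>' n (- m) = - (lat \<tau> m n / \<tau>)" using \<tau>0 by (simp add: lat_def field_simps)
      then show ?thesis using \<tau>0 by (simp add: power_divide)
    qed
    ultimately have "((\<lambda>m. 1 / lat \<tau> m n ^ 2) has_sum row_sum 1 ?\<tau>' n / \<tau> ^ 2) UNIV" by simp
    from has_sum_remove_0[OF this] show ?thesis by (simp add: colf_def lat_def)
  qed
  have colf_sum: "(colf has_sum (eis 1 ?\<tau>' / \<tau> ^ 2 - ?Z)) UNIV"
  proof -
    have "((\<lambda>n. 1 / \<tau> ^ 2 * row_sum 1 ?\<tau>' n) has_sum (1 / \<tau> ^ 2 * eis 1 ?\<tau>')) UNIV"
      by (rule has_sum_cmult_right[OF row_sums_has_sum[OF \<tau>' odd_one]])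
    from has_sum_diff[OF this zeta_has_sum(1)[of 2]] show ?thesis by (simp add: colf_def[abs_def])
  qed
  have "(\<lambda>(n, m). corr \<tau> m n) summable_on (UNIV \<times> UNIV)"
    using corr_summable[OF \<tau>] summable_on_swap[of "\<lambda>x. corr \<tau> (fst x) (snd x)" UNIV UNIV] by simp
  then have cols: "(\<lambda>m. corr \<tau> m n) summable_on UNIV" for n
    using summable_on_SigmaD1[of "\<lambda>n m. corr \<tau> m n" UNIV "\<lambda>_. UNIV" n] by simp
  define b where "b n = infsum (\<lambda>m. corr \<tau> m n) UNIV" for n
  have b: "((\<lambda>m. corr \<tau> m n) has_sum b n) UNIV" for n
    unfolding b_def by (rule has_sum_infsum[OF cols])
  have "((\<lambda>(n, m). corr \<tau> m n) has_sum \<beta>) (UNIV \<times> UNIV)"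
    using \<beta> has_sum_swap[of "\<lambda>x. corr \<tau> (fst x) (snd x)" UNIV UNIV \<beta>] by simp
  then have b_sum: "(b has_sum \<beta>) UNIV"
    by (rule has_sum_Sigma') (simp add: b)
  define a where "a n = colf n - b n" for n
  have a: "((\<lambda>m. if m = 0 then 0 else 1 / lat \<tau> m n - 1 / lat \<tau> m (n + 1)) has_sum a n) UNIV" for n
  proof -
    have eq: "(\<lambda>m. (if m = 0 then 0 else 1 / lat \<tau> m n ^ 2) - corr \<tau> m n) =
        (\<lambda>m. if m = 0 then 0 else 1 / lat \<tau> m n - 1 / lat \<tau> m (n + 1))"
      by (auto simp: corr_def)
    from has_sum_diff[OF colf[of n] b[of n]] show ?thesis unfolding eq a_def .
  qed
  have "(a has_sum (eis 1 ?\<tau>' / \<tau> ^ 2 - ?Z - \<beta>)) UNIV"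
    unfolding a_def[abs_def] by (rule has_sum_diff[OF colf_sum b_sum])
  from has_sum_int_interval_tendsto[OF this]
  have lim: "(\<lambda>N. \<Sum>n\<in>{- int N..<int N}. a n) \<longlonglongrightarrow> eis 1 ?\<tau>' / \<tau> ^ 2 - eis 1 \<tau>"
    by (simp add: \<beta>_eq)
  let ?v = "\<lambda>N. 2 / \<tau> * (- (of_real pi * \<i> * (2 * pser 0 (nome (of_nat N * ?\<tau>')) - 1)) + \<tau> / of_nat N)"
  have val: "(\<Sum>n\<in>{- int N..<int N}. a n) = ?v N" if "N > 0" for N
  proof -
    have "((\<lambda>m. \<Sum>n\<in>{- int N..<int N}. if m = 0 then 0 else 1 / lat \<tau> m n - 1 / lat \<tau> m (n + 1)) has_sum
        (\<Sum>n\<in>{- int N..<int N}. a n)) UNIV"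
      by (rule has_sum_finite_sum) (rule a)
    moreover have "(\<Sum>n\<in>{- int N..<int N}. if m = 0 then 0 else 1 / lat \<tau> m n - 1 / lat \<tau> m (n + 1)) =
        (if m = 0 then 0 else 1 / lat \<tau> m (- int N) - 1 / lat \<tau> m (int N))" for m
      using sum_int_telescope[of "\<lambda>n. 1 / lat \<tau> m n" N] by (cases "m = 0") simp_all
    ultimately have "((\<lambda>m. if m = 0 then 0 else 1 / lat \<tau> m (- int N) - 1 / lat \<tau> m (int N)) has_sum
        (\<Sum>n\<in>{- int N..<int N}. a n)) UNIV" by simp
    from eis_2_column_sum[OF \<tau> that this] show ?thesis .
  qed
  \<comment> \<open>The nome at -N/\<tau> tends to 0, where \<open>pser 0\<close> is 1. The limit -2
    \<pi> i / \<tau> is the source of the anomaly of E_2.\<close>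
  have "(\<lambda>N. ?v N) \<longlonglongrightarrow> 2 / \<tau> * (- (of_real pi * \<i> * (2 * 1 - 1)) + 0)"
  proof -
    have q: "norm (nome ?\<tau>') < 1" by (rule norm_nome_less_1[OF \<tau>'])
    have "(\<lambda>N. 1 / (1 - nome ?\<tau>' ^ N)) \<longlonglongrightarrow> 1 / (1 - 0)"
      by (intro tendsto_intros LIMSEQ_power_zero[OF q]) auto
    then have "(\<lambda>N. 1 / (1 - nome ?\<tau>' ^ N)) \<longlonglongrightarrow> 1" by simp
    moreover have "\<forall>\<^sub>F N in sequentially. 1 / (1 - nome ?\<tau>' ^ N) = pser 0 (nome (of_nat N * ?\<tau>'))"
      using eventually_gt_at_top[of 0]
    proof eventually_elim
      case (elim N)
      have "Im (of_nat N * ?\<tau>') = real N * Im ?\<tau>'"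
        by (simp only: times_complex.sel complex_Re_of_nat complex_Im_of_nat mult_zero_left add_0_right)
      then have "Im (of_nat N * ?\<tau>') > 0" using \<tau>' elim by (simp only: of_nat_0_less_iff mult_pos_pos)
      from pser_0[OF norm_nome_less_1[OF this]] show ?case by (simp only: nome_of_nat_mult)
    qed
    ultimately have p: "(\<lambda>N. pser 0 (nome (of_nat N * ?\<tau>'))) \<longlonglongrightarrow> 1"
      by (rule Lim_transform_eventually)
    have n: "(\<lambda>N. \<tau> / of_nat N) \<longlonglongrightarrow> 0" by (rule lim_const_over_n)
    show ?thesis
      by (rule tendsto_mult[OF tendsto_const tendsto_add[OF tendsto_minus[OF tendsto_mult[OF tendsto_const
        tendsto_diff[OF tendsto_mult[OF tendsto_const p] tendsto_const]]] n]])
  qed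
  moreover have "\<forall>\<^sub>F N in sequentially. ?v N = (\<Sum>n\<in>{- int N..<int N}. a n)"
    using eventually_gt_at_top[of 0] by eventually_elim (rule val[symmetric])
  ultimately have "(\<lambda>N. \<Sum>n\<in>{- int N..<int N}. a n) \<longlonglongrightarrow> 2 / \<tau> * (- (of_real pi * \<i> * (2 * 1 - 1)) + 0)"
    by (rule Lim_transform_eventually)
  from LIMSEQ_unique[OF lim this] have "eis 1 ?\<tau>' / \<tau> ^ 2 - eis 1 \<tau> = - (2 * of_real pi * \<i>) / \<tau>" by simp
  moreover have "E' = t ^ 2 * E - c * t" if "t \<noteq> 0" "E' / t ^ 2 - E = - c / t" for t E E' c :: complex
  proof -
    have "E' = t ^ 2 * (E' / t ^ 2 - E) + t ^ 2 * E" using that(1) by (simp add: right_diff_distrib)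
    also have "\<dots> = t ^ 2 * E - c * t" unfolding that(2) using that(1) by (simp add: power2_eq_square)
    finally show ?thesis .
  qed
  ultimately show ?thesis using \<tau>0 by blast
qed

section \<open>Algebraic independence of the Eisenstein series\<close>

definition poly_fun :: "(complex \<Rightarrow> complex) \<Rightarrow> bool" where
  "poly_fun f \<longleftrightarrow> (\<exists>p. \<forall>x. f x = poly p x)"

lemma poly_fun_intros:
  "poly_fun (\<lambda>x. c)" "poly_fun (\<lambda>x. x)"
  "poly_fun f \<Longrightarrow> poly_fun g \<Longrightarrow> poly_fun (\<lambda>x. f x + g x)"
  "poly_fun f \<Longrightarrow> poly_fun g \<Longrightarrow> poly_fun (\<lambda>x. f x * g x)"
proof -
  show "poly_fun (\<lambda>x. c)" unfolding poly_fun_def by (rule exI[of _ "[:c:]"]) simp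
  show "poly_fun (\<lambda>x. x)" unfolding poly_fun_def by (rule exI[of _ "[:0, 1:]"]) simp
  show "poly_fun (\<lambda>x. f x + g x)" if "poly_fun f" "poly_fun g"
    using that unfolding poly_fun_def by (metis poly_add)
  show "poly_fun (\<lambda>x. f x * g x)" if "poly_fun f" "poly_fun g"
    using that unfolding poly_fun_def by (metis poly_mult)
qed

lemma poly_fun_power: "poly_fun f \<Longrightarrow> poly_fun (\<lambda>x. f x ^ n)"
  by (induction n) (auto intro: poly_fun_intros)

lemma poly_fun_sum: "(\<And>i. i \<in> A \<Longrightarrow> poly_fun (f i)) \<Longrightarrow> poly_fun (\<lambda>x. \<Sum>i\<in>A. f i x)"
  by (induction A rule: infinite_finite_induct) (auto intro: poly_fun_intros)

lemma poly_fun_zero: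
  assumes "poly_fun f" "infinite {x. f x = 0}"
  shows "f x = 0"
proof -
  obtain p where p: "\<And>x. f x = poly p x" using assms(1) by (auto simp: poly_fun_def)
  then have "p = 0" using assms(2) poly_roots_finite[of p] by auto
  then show ?thesis by (simp add: p)
qed

lemma coeffs_zero:
  fixes a :: "nat \<Rightarrow> complex"
  assumes "\<And>x. (\<Sum>i<n. a i * x ^ i) = 0" "i < n"
  shows "a i = 0"
proof -
  define p where "p = (\<Sum>i<n. monom (a i) i)"
  have "poly p x = 0" for x using assms(1) by (simp add: p_def poly_sum poly_monom)
  then have "p = 0" by (metis poly_all_0_iff_0)
  then have "coeff p i = 0" by simp
  then show ?thesis using assms(2) by (simp add: p_def coeff_sum)
qed

lemma coeffs_zero_3:
  fixes c :: "nat \<times> nat \<times> nat \<Rightarrow> complex"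
  assumes A: "finite A" and z: "\<And>x y z. (\<Sum>(i, j, k)\<in>A. c (i, j, k) * x ^ i * y ^ j * z ^ k) = 0"
    and "t \<in> A"
  shows "c t = 0"
proof -
  define c' where "c' t = (if t \<in> A then c t else 0)" for t
  obtain n where n: "\<And>i j k. (i, j, k) \<in> A \<Longrightarrow> i < n \<and> j < n \<and> k < n"
  proof
    fix i j k assume t: "(i, j, k) \<in> A"
    have "i + j + k \<le> Max ((\<lambda>(i, j, k). i + j + k) ` A)"
      by (rule Max_ge) (use A t in \<open>auto simp: image_iff intro!: bexI[of _ "(i, j, k)"]\<close>)
    then show "i < Suc (Max ((\<lambda>(i, j, k). i + j + k) ` A)) \<and> j < Suc (Max ((\<lambda>(i, j, k). i + j + k) ` A)) \<and>
        k < Suc (Max ((\<lambda>(i, j, k). i + j + k) ` A))" by auto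
  qed
  have box: "(\<Sum>i<n. (\<Sum>j<n. (\<Sum>k<n. c' (i, j, k) * z ^ k) * y ^ j) * x ^ i) = 0" for x y z
  proof -
    have "(\<Sum>i<n. (\<Sum>j<n. (\<Sum>k<n. c' (i, j, k) * z ^ k) * y ^ j) * x ^ i) =
        (\<Sum>i<n. \<Sum>j<n. \<Sum>k<n. c' (i, j, k) * x ^ i * y ^ j * z ^ k)"
      by (simp add: sum_distrib_left sum_distrib_right mult_ac)
    also have "\<dots> = (\<Sum>t\<in>{..<n} \<times> {..<n} \<times> {..<n}. case t of (i, j, k) \<Rightarrow> c' (i, j, k) * x ^ i * y ^ j * z ^ k)"
      by (simp add: sum.cartesian_product)
    also have "\<dots> = (\<Sum>t\<in>A. case t of (i, j, k) \<Rightarrow> c' (i, j, k) * x ^ i * y ^ j * z ^ k)"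
      by (rule sum.mono_neutral_right) (use n in \<open>auto simp: c'_def\<close>)
    also have "\<dots> = (\<Sum>(i, j, k)\<in>A. c (i, j, k) * x ^ i * y ^ j * z ^ k)"
      by (intro sum.cong) (auto simp: c'_def)
    finally show ?thesis using z by simp
  qed
  obtain i j k where t: "t = (i, j, k)" by (metis surj_pair)
  with n \<open>t \<in> A\<close> have lt: "i < n" "j < n" "k < n" by auto
  have 1: "(\<Sum>j<n. (\<Sum>k<n. c' (i, j, k) * z ^ k) * y ^ j) = 0" for y z
    by (rule coeffs_zero[OF box lt(1)])
  have 2: "(\<Sum>k<n. c' (i, j, k) * z ^ k) = 0" for z
    by (rule coeffs_zero[OF 1 lt(2)])
  have "c' (i, j, k) = 0" by (rule coeffs_zero[OF 2 lt(3)])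
  then show ?thesis using \<open>t \<in> A\<close> by (simp add: c'_def t)
qed

text \<open>The point is (\<tau> + j) / (N (\<tau> + j) + 1), obtained from \<tau> by the word S
  T^(-N) S T^j in the generators of SL_2(Z). Its denominator is \<open>lam j\<close>, and the lower
  left entry N is the factor in the anomaly of E_2.\<close>

lemma eis_orbit:
  assumes \<tau>: "Im \<tau> > 0" and N: "N > 0"
  defines "lam \<equiv> (\<lambda>j. 1 + of_nat N * (\<tau> + of_int j))"
  obtains \<sigma> where "Im \<sigma> > 0" "eis 1 \<sigma> = lam j ^ 2 * eis 1 \<tau> - 2 * of_real pi * \<i> * of_nat N * lam j"
    "eis 3 \<sigma> = lam j ^ 4 * eis 3 \<tau>" "eis 5 \<sigma> = lam j ^ 6 * eis 5 \<tau>"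
proof -
  define t1 where "t1 = \<tau> + of_int j"
  define t2 where "t2 = - 1 / t1"
  define t3 where "t3 = t2 + of_int (- int N)"
  define \<sigma> where "\<sigma> = - 1 / t3"
  have i1: "Im t1 > 0" using \<tau> by (simp add: t1_def)
  have i2: "Im t2 > 0" unfolding t2_def by (rule Im_minus_inverse[OF i1])
  have i3: "Im t3 > 0" using i2 by (simp add: t3_def)
  have i4: "Im \<sigma> > 0" unfolding \<sigma>_def by (rule Im_minus_inverse[OF i3])
  have t10: "t1 \<noteq> 0" using i1 by auto
  define l where "l = lam j"
  have "t3 * t1 = - 1 - of_nat N * t1" using t10 by (simp add: t3_def t2_def algebra_simps)
  also have "\<dots> = - l" by (simp add: l_def lam_def t1_def)
  finally have prod: "t3 * t1 = - l" .
  have gen: "eis k \<sigma> = l ^ (k + 1) * eis k \<tau>" if k: "odd k" "k \<ge> 3" for k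
  proof -
    have "eis k \<sigma> = t3 ^ (k + 1) * eis k t2"
      unfolding \<sigma>_def eis_modular[OF i3 k] by (simp only: t3_def eis_period)
    also have "eis k t2 = t1 ^ (k + 1) * eis k \<tau>"
      unfolding t2_def eis_modular[OF i1 k] by (simp only: t1_def eis_period)
    also have "t3 ^ (k + 1) * (t1 ^ (k + 1) * eis k \<tau>) = (t3 * t1) ^ (k + 1) * eis k \<tau>"
      by (simp only: power_mult_distrib mult.assoc)
    also have "(t3 * t1) ^ (k + 1) = l ^ (k + 1)" unfolding prod using k by (intro power_minus_even) auto
    finally show ?thesis .
  qed
  have e2: "eis 1 \<sigma> = t3 ^ 2 * (t1 ^ 2 * eis 1 \<tau> - 2 * of_real pi * \<i> * t1) - 2 * of_real pi * \<i> * t3"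
  proof -
    have "eis 1 \<sigma> = t3 ^ 2 * eis 1 t2 - 2 * of_real pi * \<i> * t3"
      unfolding \<sigma>_def eis_2_transformation[OF i3] by (simp only: t3_def eis_period)
    also have "eis 1 t2 = t1 ^ 2 * eis 1 \<tau> - 2 * of_real pi * \<i> * t1"
      unfolding t2_def eis_2_transformation[OF i1] by (simp only: t1_def eis_period)
    finally show ?thesis .
  qed
  also have "\<dots> = (t3 * t1) ^ 2 * eis 1 \<tau> - 2 * of_real pi * \<i> * (t3 * (t3 * t1 + 1))"
    by (simp add: power2_eq_square algebra_simps)
  also have "t3 * t1 + 1 = - of_nat N * t1" unfolding prod by (simp add: l_def lam_def t1_def)
  also have "t3 * (- of_nat N * t1) = - of_nat N * (t3 * t1)" by (rule mult.left_commute)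
  also have "\<dots> = of_nat N * l" unfolding prod by simp
  also have "(t3 * t1) ^ 2 = l ^ 2" unfolding prod by simp
  finally have "eis 1 \<sigma> = l ^ 2 * eis 1 \<tau> - 2 * of_real pi * \<i> * of_nat N * l" by (simp only: mult.assoc)
  moreover have "eis 3 \<sigma> = l ^ 4 * eis 3 \<tau>" "eis 5 \<sigma> = l ^ 6 * eis 5 \<tau>"
    using gen[of 3] gen[of 5] by simp_all
  ultimately show ?thesis using that i4 unfolding l_def by blast
qed

lemma eis_coeff_nonzero: "eis_coeff k \<noteq> 0"
  by (simp add: eis_coeff_def)

lemma nome_surj:
  assumes "q \<noteq> 0" "norm q < 1"
  obtains \<tau> where "Im \<tau> > 0" "nome \<tau> = q"
proof
  define \<tau> where "\<tau> = Ln q / (2 * of_real pi * \<i>)"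
  show "nome \<tau> = q" using assms by (simp add: nome_def \<tau>_def)
  then have "exp (- 2 * pi * Im \<tau>) < 1" using assms(2) norm_nome[of \<tau>] by simp
  then have "- 2 * pi * Im \<tau> < 0" by (simp only: exp_less_one_iff)
  then have "pi * Im \<tau> > 0" by simp
  then show "Im \<tau> > 0" by (rule zero_less_mult_pos) simp
qed

text \<open>
  If \<open>E\<^sub>6\<^sup>2 / E\<^sub>4\<^sup>3\<close> took finitely many values, it would be constant near \<open>q = 0\<close>, and the first
  four coefficients in \<open>q\<close> rule this out.
\<close>

lemma weight_12_forms_infinite:
  "infinite ((\<lambda>\<tau>. eis 5 \<tau> ^ 2 / eis 3 \<tau> ^ 3) ` {\<tau>. Im \<tau> > 0 \<and> eis 3 \<tau> \<noteq> 0})"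
proof
  define T where "T = (\<lambda>\<tau>. eis 5 \<tau> ^ 2 / eis 3 \<tau> ^ 3) ` {\<tau>. Im \<tau> > 0 \<and> eis 3 \<tau> \<noteq> 0}"
  assume "finite ((\<lambda>\<tau>. eis 5 \<tau> ^ 2 / eis 3 \<tau> ^ 3) ` {\<tau>. Im \<tau> > 0 \<and> eis 3 \<tau> \<noteq> 0})"
  then have fin: "finite T" by (simp add: T_def)
  define P where "P k = fps_const (zeta_sum (k + 1)) + fps_const (2 * eis_coeff k) * sigma_fps k" for k
  have R: "fps_conv_radius (P k) \<ge> 1" if "k \<ge> 1" for k
  proof -
    have s: "1 \<le> fps_conv_radius (sigma_fps k)" by (rule lambert_has_sum(2)[of 0, OF _ that]) simp
    have "1 \<le> fps_conv_radius (fps_const (2 * eis_coeff k) * sigma_fps k)"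
      using fps_conv_radius_mult[of "fps_const (2 * eis_coeff k)" "sigma_fps k"] s by (auto intro: order.trans)
    then show ?thesis
      using fps_conv_radius_add[of "fps_const (zeta_sum (k + 1))" "fps_const (2 * eis_coeff k) * sigma_fps k"]
      unfolding P_def by (auto intro: order.trans)
  qed
  have rad: "ereal (norm q) < fps_conv_radius (P k)" if "norm q < 1" "k \<ge> 1" for q :: complex and k
    using R[OF that(2)] that(1) by (metis ereal_less(3) less_le_trans)
  have E: "eis k \<tau> = eval_fps (P k) (nome \<tau>)" if "Im \<tau> > 0" "k \<ge> 1" for \<tau> k
  proof -
    have q: "norm (nome \<tau>) < 1" by (rule norm_nome_less_1[OF that(1)])
    have "1 \<le> fps_conv_radius (sigma_fps k)" by (rule lambert_has_sum(2)[OF q that(2)])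
    then have s: "ereal (norm (nome \<tau>)) < fps_conv_radius (sigma_fps k)"
      using q by (metis ereal_less(3) less_le_trans)
    have "ereal (norm (nome \<tau>)) < fps_conv_radius (fps_const (2 * eis_coeff k) * sigma_fps k)"
      using s eis_coeff_nonzero[of k] by (simp add: fps_conv_radius_cmult_left)
    then show ?thesis using s by (simp add: P_def eval_fps_add eval_fps_mult eis_def)
  qed
  have P0: "eval_fps (P 3) 0 \<noteq> 0"
    using zeta_has_sum(2)[of 4] by (simp add: eval_fps_at_0 P_def sigma_fps_def)
  have cont: "continuous_on (ball 0 1) (eval_fps (P k))" if "k \<ge> 1" for k
    by (rule continuous_on_subset[OF continuous_on_eval_fps]) (use rad[OF _ that] in \<open>auto simp: eball_def\<close>)
  have "isCont (eval_fps (P 3)) 0" using cont[of 3] by (simp add: continuous_on_eq_continuous_at)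
  from continuous_at_avoid[OF this P0]
  obtain r0 where r0: "r0 > 0" "\<And>q. dist 0 q < r0 \<Longrightarrow> eval_fps (P 3) q \<noteq> 0" by blast
  define r where "r = min r0 1"
  have r: "r > 0" "r \<le> 1" "\<And>q. q \<in> ball 0 r \<Longrightarrow> eval_fps (P 3) q \<noteq> 0" using r0 by (auto simp: r_def)
  define \<rho> where "\<rho> q = eval_fps (P 5) q ^ 2 / eval_fps (P 3) q ^ 3" for q
  have "continuous_on (ball 0 r) \<rho>"
    unfolding \<rho>_def using r by (intro continuous_intros continuous_on_subset[OF cont]) auto
  then have "connected (\<rho> ` ball 0 r)" by (rule connected_continuous_image) simp
  moreover have "\<rho> ` ball 0 r \<subseteq> insert (\<rho> 0) T"
  proof clarify
    fix q :: complex assume q: "q \<in> ball 0 r" and "\<rho> q \<notin> T"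
    show "\<rho> q = \<rho> 0"
    proof (rule ccontr)
      assume "\<rho> q \<noteq> \<rho> 0"
      then have "q \<noteq> 0" by auto
      moreover have "norm q < 1" using q r by simp
      ultimately obtain \<tau> where \<tau>: "Im \<tau> > 0" "nome \<tau> = q" by (rule nome_surj)
      then have "\<rho> q = eis 5 \<tau> ^ 2 / eis 3 \<tau> ^ 3" "eis 3 \<tau> \<noteq> 0"
        using E[OF \<tau>(1), of 5] E[OF \<tau>(1), of 3] r(3)[OF q] by (simp_all add: \<rho>_def)
      then show False using \<tau>(1) \<open>\<rho> q \<notin> T\<close> by (auto simp: T_def)
    qed
  qed
  then have "finite (\<rho> ` ball 0 r)" using fin finite_subset by blast
  ultimately obtain \<rho>0 where "\<rho> ` ball 0 r = {} \<or> \<rho> ` ball 0 r = {\<rho>0}"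
    using connected_finite_iff_sing by blast
  then have const: "\<rho> q = \<rho>0" if "q \<in> ball 0 r" for q using that by blast
  have "P 5 ^ 2 = fps_const \<rho>0 * P 3 ^ 3"
  proof (rule eval_fps_eqD)
    have p: "fps_conv_radius (P k ^ n) \<ge> 1" if "k \<ge> 1" for k n
      using R[OF that] fps_conv_radius_power[of "P k" n] by (rule order.trans)
    have m: "fps_conv_radius (fps_const \<rho>0 * P 3 ^ 3) \<ge> 1"
      using fps_conv_radius_mult[of "fps_const \<rho>0" "P 3 ^ 3"] p[of 3 3] by (auto intro: order.trans)
    show "fps_conv_radius (P 5 ^ 2) > 0" by (rule less_le_trans[OF _ p[of 5 2]]) simp_all
    show "fps_conv_radius (fps_const \<rho>0 * P 3 ^ 3) > 0" by (rule less_le_trans[OF _ m]) simp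
    have "\<forall>\<^sub>F q in nhds 0. q \<in> ball (0::complex) r" using r(1) by (intro eventually_nhds_in_open) auto
    then show "\<forall>\<^sub>F q in nhds 0. eval_fps (P 5 ^ 2) q = eval_fps (fps_const \<rho>0 * P 3 ^ 3) q"
    proof eventually_elim
      case (elim q)
      then have q: "norm q < 1" using r by simp
      have "ereal (norm q) < fps_conv_radius (P 3 ^ 3)"
        using p[of 3 3] q by (metis ereal_less(3) less_le_trans one_le_numeral)
      then have "eval_fps (fps_const \<rho>0 * P 3 ^ 3) q = \<rho>0 * eval_fps (P 3) q ^ 3"
        using rad[OF q, of 3] by (simp add: eval_fps_mult eval_fps_power)
      moreover have "eval_fps (P 5 ^ 2) q = eval_fps (P 5) q ^ 2"
        using rad[OF q, of 5] by (simp add: eval_fps_power)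
      moreover have "\<rho>0 * eval_fps (P 3) q ^ 3 = eval_fps (P 5) q ^ 2"
        using const[OF elim] r(3)[OF elim] by (auto simp: \<rho>_def divide_simps)
      ultimately show ?case by simp
    qed
  qed
  then have eq: "P 5 * P 5 = fps_const \<rho>0 * (P 3 * (P 3 * P 3))"
    by (simp add: power2_eq_square power3_eq_cube mult.assoc)
  define a a' b b' where ab: "a = zeta_sum 4" "a' = 2 * eis_coeff 3" "b = zeta_sum 6" "b' = 2 * eis_coeff 5"
  have nz: "a \<noteq> 0" "a' \<noteq> 0" "b \<noteq> 0" "b' \<noteq> 0"
    using zeta_has_sum(2)[of 4] zeta_has_sum(2)[of 6] eis_coeff_nonzero by (simp_all add: ab)
  have "d dvd 2 \<longleftrightarrow> d = 1 \<or> d = 2" "d dvd 3 \<longleftrightarrow> d = 1 \<or> d = 3" for d :: nat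
  proof -
    have "d dvd 2 \<Longrightarrow> d = 1 \<or> d = 2"
      using dvd_imp_le[of d 2] by (cases "d = 0") auto
    then show "d dvd 2 \<longleftrightarrow> d = 1 \<or> d = 2" by auto
    have "d = 1 \<or> d = 3" if d: "d dvd 3"
    proof -
      have "d \<le> 3" using dvd_imp_le[OF d] by simp
      then have "d = 0 \<or> d = 1 \<or> d = 2 \<or> d = 3" by linarith
      then show ?thesis using d by auto
    qed
    then show "d dvd 3 \<longleftrightarrow> d = 1 \<or> d = 3" by auto
  qed
  then have divs: "{d::nat. d dvd 1} = {1}" "{d::nat. d dvd 2} = {1, 2}" "{d::nat. d dvd 3} = {1, 3}"
    by auto
  have sig: "fps_nth (sigma_fps k) 0 = 0" "fps_nth (sigma_fps k) 1 = 1"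
    "fps_nth (sigma_fps k) 2 = 1 + 2 ^ k" "fps_nth (sigma_fps k) 3 = 1 + 3 ^ k" for k
    by (simp_all add: sigma_fps_def divisor_power_sum_def divs del: One_nat_def)
  have P3: "fps_nth (P 3) 0 = a" "fps_nth (P 3) 1 = a'" "fps_nth (P 3) 2 = 9 * a'" "fps_nth (P 3) 3 = 28 * a'"
    by (simp_all add: P_def sig ab fps_nth_fps_const del: One_nat_def)
  have P5: "fps_nth (P 5) 0 = b" "fps_nth (P 5) 1 = b'" "fps_nth (P 5) 2 = 33 * b'" "fps_nth (P 5) 3 = 244 * b'"
    by (simp_all add: P_def sig ab fps_nth_fps_const del: One_nat_def)
  have mult: "fps_nth (f * g) 0 = fps_nth f 0 * fps_nth g 0"
    "fps_nth (f * g) 1 = fps_nth f 0 * fps_nth g 1 + fps_nth f 1 * fps_nth g 0"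
    "fps_nth (f * g) 2 = fps_nth f 0 * fps_nth g 2 + fps_nth f 1 * fps_nth g 1 + fps_nth f 2 * fps_nth g 0"
    "fps_nth (f * g) 3 = fps_nth f 0 * fps_nth g 3 + fps_nth f 1 * fps_nth g 2 + fps_nth f 2 * fps_nth g 1
      + fps_nth f 3 * fps_nth g 0" for f g :: "complex fps"
    by (simp_all add: fps_mult_nth numeral_eq_Suc)
  have C0: "fps_nth (fps_const \<rho>0) 0 = \<rho>0" "fps_nth (fps_const \<rho>0) 1 = 0" "fps_nth (fps_const \<rho>0) 2 = 0"
    "fps_nth (fps_const \<rho>0) 3 = 0" by simp_all
  have c0: "b * b = \<rho>0 * (a * (a * a))"
    using arg_cong[OF eq, of "\<lambda>f. fps_nth f 0"] by (simp only: mult P3 P5 C0 mult_zero_left add_0_right)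
  have c1: "b * b' + b' * b = \<rho>0 * (a * (a * a' + a' * a) + a' * (a * a))"
    using arg_cong[OF eq, of "\<lambda>f. fps_nth f 1"] by (simp only: mult P3 P5 C0 mult_zero_left add_0_right)
  have c2: "b * (33 * b') + b' * b' + 33 * b' * b =
      \<rho>0 * (a * (a * (9 * a') + a' * a' + 9 * a' * a) + a' * (a * a' + a' * a) + 9 * a' * (a * a))"
    using arg_cong[OF eq, of "\<lambda>f. fps_nth f 2"] by (simp only: mult P3 P5 C0 mult_zero_left add_0_right)
  have c3: "b * (244 * b') + b' * (33 * b') + 33 * b' * b' + 244 * b' * b =
      \<rho>0 * (a * (a * (28 * a') + a' * (9 * a') + 9 * a' * a' + 28 * a' * a) +
        a' * (a * (9 * a') + a' * a' + 9 * a' * a) + 9 * a' * (a * a' + a' * a) + 28 * a' * (a * a))"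
    using arg_cong[OF eq, of "\<lambda>f. fps_nth f 3"] by (simp only: mult P3 P5 C0 mult_zero_left add_0_right)
  \<comment> \<open>x and y are the coefficients of q after both constant terms have been normalised
    to 1.\<close>
  have "\<exists>x y. b' = b * x \<and> a' = a * y \<and> x \<noteq> 0 \<and> y \<noteq> 0"
    by (rule exI[of _ "b' / b"], rule exI[of _ "a' / a"]) (use nz in simp)
  then obtain x y where xy: "b' = b * x" "a' = a * y" "x \<noteq> 0" "y \<noteq> 0" by blast
  have e0: "b ^ 2 = \<rho>0 * a ^ 3"
    using c0 by (simp add: power2_eq_square power3_eq_cube)
  have e1: "b ^ 2 * (2 * x) = \<rho>0 * a ^ 3 * (3 * y)"
    using c1 unfolding xy by (simp add: power2_eq_square power3_eq_cube algebra_simps)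
  have e2: "b ^ 2 * (x ^ 2 + 66 * x) = \<rho>0 * a ^ 3 * (3 * y ^ 2 + 27 * y)"
    using c2 unfolding xy by (simp add: power2_eq_square power3_eq_cube algebra_simps)
  have e3: "b ^ 2 * (488 * x + 66 * x ^ 2) = \<rho>0 * a ^ 3 * (84 * y + 54 * y ^ 2 + y ^ 3)"
    using c3 unfolding xy by (simp add: power2_eq_square power3_eq_cube algebra_simps)
  have "b ^ 2 \<noteq> 0" using nz by simp
  then have f1: "2 * x = 3 * y" and f2: "x ^ 2 + 66 * x = 3 * y ^ 2 + 27 * y"
    and f3: "488 * x + 66 * x ^ 2 = 84 * y + 54 * y ^ 2 + y ^ 3"
    using e1 e2 e3 unfolding e0[symmetric] mult_cancel_left by auto
  \<comment> \<open>The coefficient of q forces x = 3u and y = 2u, that of q^2 then forces u = 48,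
    and that of q^3 fails for this value.\<close>
  define u where "u = y / 2"
  have y: "y = 2 * u" by (simp add: u_def)
  then have x: "x = 3 * u" using f1 by simp
  have "3 * (u * (u - 48)) = (3 * y ^ 2 + 27 * y) - (x ^ 2 + 66 * x)"
    unfolding x y by (simp add: power2_eq_square algebra_simps)
  also have "\<dots> = 0" by (simp only: f2 diff_self)
  finally have "u = 48" using xy y by simp
  then show False using f3 x y by simp
qed

text \<open>
  Moving \<open>\<tau>\<close> along \<open>SL\<^sub>2(\<int>)\<close> multiplies \<open>E\<^sub>4, E\<^sub>6\<close> by \<open>\<lambda>\<^sup>4, \<lambda>\<^sup>6\<close> and \<open>E\<^sub>2\<close> by \<open>\<lambda>\<^sup>2\<close> up to a term
  linear in \<open>\<lambda>\<close>. A polynomial vanishing for infinitely many \<open>\<lambda>\<close> vanishes identically; this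
  frees first \<open>\<lambda>\<close>, then the value of \<open>E\<^sub>2\<close>, and finally that of \<open>E\<^sub>6\<^sup>2 / E\<^sub>4\<^sup>3\<close>.
\<close>

lemma eisenstein_independent_fun:
  fixes F :: "complex \<Rightarrow> complex \<Rightarrow> complex \<Rightarrow> complex"
  assumes p1: "\<And>f g h. poly_fun f \<Longrightarrow> poly_fun g \<Longrightarrow> poly_fun h \<Longrightarrow> poly_fun (\<lambda>x. F (f x) (g x) (h x))"
    and \<beta>: "\<beta>1 \<noteq> 0" "\<beta>2 \<noteq> 0" "\<beta>3 \<noteq> 0"
    and z: "\<And>\<tau>. Im \<tau> > 0 \<Longrightarrow> F (\<alpha>1 + \<beta>1 * eis 1 \<tau>) (\<alpha>2 + \<beta>2 * eis 3 \<tau>) (\<alpha>3 + \<beta>3 * eis 5 \<tau>) = 0"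
  shows "F x y w = 0"
proof -
  let ?\<kappa> = "- 2 * of_real pi * \<i> :: complex"
  note poly = poly_fun_intros poly_fun_power
  \<comment> \<open>For fixed \<tau> and N the shifts j produce infinitely many multipliers l, so
    the polynomial relation extends from them to every l.\<close>
  have 1: "F (\<alpha>1 + \<beta>1 * (l ^ 2 * eis 1 \<tau> + ?\<kappa> * of_nat N * l)) (\<alpha>2 + \<beta>2 * (l ^ 4 * eis 3 \<tau>))
      (\<alpha>3 + \<beta>3 * (l ^ 6 * eis 5 \<tau>)) = 0" (is "?G l = 0") if \<tau>: "Im \<tau> > 0" and N: "N > 0" for \<tau> N l
  proof (rule poly_fun_zero[of ?G])
    show "poly_fun ?G" by (intro p1 poly)
    have sub: "range (\<lambda>j. 1 + of_nat N * (\<tau> + of_int j)) \<subseteq> {l. ?G l = 0}"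
    proof clarify
      fix j :: int
      obtain \<sigma> where "Im \<sigma> > 0"
        "eis 1 \<sigma> = (1 + of_nat N * (\<tau> + of_int j)) ^ 2 * eis 1 \<tau> - 2 * of_real pi * \<i> * of_nat N * (1 + of_nat N * (\<tau> + of_int j))"
        "eis 3 \<sigma> = (1 + of_nat N * (\<tau> + of_int j)) ^ 4 * eis 3 \<tau>"
        "eis 5 \<sigma> = (1 + of_nat N * (\<tau> + of_int j)) ^ 6 * eis 5 \<tau>"
        by (rule eis_orbit[OF \<tau> N, of j])
      then show "?G (1 + of_nat N * (\<tau> + of_int j)) = 0"
        using z[of \<sigma>] by (simp only: diff_conv_add_uminus mult_minus_left)
    qed
    have "inj (\<lambda>j. 1 + of_nat N * (\<tau> + of_int j))" using N by (auto simp: inj_on_def)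
    then have "infinite (range (\<lambda>j. 1 + of_nat N * (\<tau> + of_int j)))"
      by (simp only: finite_image_iff infinite_UNIV_int not_False_eq_True)
    then show "infinite {l. ?G l = 0}" by (rule infinite_super[OF sub])
  qed
  \<comment> \<open>For fixed l the relation is polynomial in N and holds for all N \<ge> 1, hence
    for a complex x in place of N. As x enters only the first argument, linearly and with nonzero
    factor, that argument becomes arbitrary.\<close>
  have 2: "F \<mu> (\<alpha>2 + \<beta>2 * (l ^ 4 * eis 3 \<tau>)) (\<alpha>3 + \<beta>3 * (l ^ 6 * eis 5 \<tau>)) = 0"
    if \<tau>: "Im \<tau> > 0" and l: "l \<noteq> 0" for \<tau> l \<mu>
  proof -
    let ?H = "\<lambda>x. F (\<alpha>1 + \<beta>1 * (l ^ 2 * eis 1 \<tau> + ?\<kappa> * x * l)) (\<alpha>2 + \<beta>2 * (l ^ 4 * eis 3 \<tau>))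
      (\<alpha>3 + \<beta>3 * (l ^ 6 * eis 5 \<tau>))"
    have "?H x = 0" for x
    proof (rule poly_fun_zero[of ?H])
      show "poly_fun ?H" by (intro p1 poly)
      have "?H (of_nat N) = 0" if "N \<in> {1..}" for N
        using 1[OF \<tau>, of N l] that by (simp only: atLeast_iff Suc_le_eq One_nat_def)
      then have sub: "of_nat ` {1..} \<subseteq> {x. ?H x = 0}" by (intro image_subsetI CollectI)
      have "infinite (of_nat ` {1..} :: complex set)"
        by (subst finite_image_iff) (auto simp: inj_on_def infinite_Ici)
      then show "infinite {x. ?H x = 0}" by (rule infinite_super[OF sub])
    qed
    from this[of "((\<mu> - \<alpha>1) / \<beta>1 - l ^ 2 * eis 1 \<tau>) / (?\<kappa> * l)"] show ?thesis
      using \<beta>(1) l by simp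
  qed
  \<comment> \<open>A suitable fourth root l scales E_4 to the prescribed nonzero value y. The
    square of the scaled E_6, divided by y^3, is then E_6^2 / E_4^3, so infinitely many values of
    this quotient yield infinitely many zeros Z.\<close>
  have 3: "F \<mu> Y Z = 0" if Y: "Y \<noteq> \<alpha>2" for \<mu> Y Z
  proof (rule poly_fun_zero[of "F \<mu> Y"])
    show "poly_fun (F \<mu> Y)" using p1[OF poly(1) poly(1) poly(2)] by simp
    define y where "y = (Y - \<alpha>2) / \<beta>2"
    have y: "y \<noteq> 0" "Y = \<alpha>2 + \<beta>2 * y" using Y \<beta>(2) by (simp_all add: y_def)
    define T where "T = (\<lambda>\<tau>. eis 5 \<tau> ^ 2 / eis 3 \<tau> ^ 3) ` {\<tau>. Im \<tau> > 0 \<and> eis 3 \<tau> \<noteq> 0}"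
    have T: "infinite T" unfolding T_def by (rule weight_12_forms_infinite)
    have "T \<subseteq> (\<lambda>Z. ((Z - \<alpha>3) / \<beta>3) ^ 2 / y ^ 3) ` {Z. F \<mu> Y Z = 0}"
    proof
      fix t assume "t \<in> T"
      then obtain \<tau> where \<tau>: "Im \<tau> > 0" "eis 3 \<tau> \<noteq> 0" "t = eis 5 \<tau> ^ 2 / eis 3 \<tau> ^ 3" by (auto simp: T_def)
      define l where "l = exp (Ln (y / eis 3 \<tau>) / 4)"
      have "l ^ 4 = exp (of_nat 4 * (Ln (y / eis 3 \<tau>) / 4))"
        unfolding l_def by (rule exp_of_nat_mult[symmetric])
      then have l4: "l ^ 4 = y / eis 3 \<tau>" using y \<tau> by simp
      have l0: "l \<noteq> 0" by (simp add: l_def)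
      define Z where "Z = \<alpha>3 + \<beta>3 * (l ^ 6 * eis 5 \<tau>)"
      have "F \<mu> Y Z = 0" using 2[OF \<tau>(1) l0, of \<mu>] \<tau>(2) by (simp add: l4 y(2) Z_def)
      moreover have "((Z - \<alpha>3) / \<beta>3) ^ 2 / y ^ 3 = t"
      proof -
        have "((Z - \<alpha>3) / \<beta>3) ^ 2 = (l ^ 4) ^ 3 * eis 5 \<tau> ^ 2"
          using \<beta>(3) by (simp add: Z_def power_mult_distrib flip: power_mult)
        then show ?thesis using y \<tau> unfolding l4 by (simp add: power_divide)
      qed
      ultimately show "t \<in> (\<lambda>Z. ((Z - \<alpha>3) / \<beta>3) ^ 2 / y ^ 3) ` {Z. F \<mu> Y Z = 0}" by blast
    qed
    from finite_surj[OF _ this] T show "infinite {Z. F \<mu> Y Z = 0}" by auto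
  qed
  show ?thesis
  proof (rule poly_fun_zero[of "\<lambda>y. F x y w"])
    show "poly_fun (\<lambda>y. F x y w)" using p1[OF poly(1) poly(2) poly(1)] by simp
    have sub: "- {\<alpha>2} \<subseteq> {y. F x y w = 0}" using 3 by auto
    have "infinite (UNIV - {\<alpha>2} :: complex set)"
      using infinite_UNIV_char_0 by (rule infinite_remove)
    then show "infinite {y. F x y w = 0}" using sub by (simp only: Compl_eq_Diff_UNIV infinite_super not_False_eq_True)
  qed
qed

lemma conv_radius_ge_1_intros:
  fixes f g :: "complex fps"
  shows "fps_conv_radius (fps_const c :: complex fps) \<ge> 1"
    "fps_conv_radius f \<ge> 1 \<Longrightarrow> fps_conv_radius g \<ge> 1 \<Longrightarrow> fps_conv_radius (f + g) \<ge> 1"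
    "fps_conv_radius f \<ge> 1 \<Longrightarrow> fps_conv_radius g \<ge> 1 \<Longrightarrow> fps_conv_radius (f * g) \<ge> 1"
    "fps_conv_radius f \<ge> 1 \<Longrightarrow> fps_conv_radius (f ^ n) \<ge> 1"
proof -
  show "fps_conv_radius (f + g) \<ge> 1" "fps_conv_radius (f * g) \<ge> 1"
    if "fps_conv_radius f \<ge> 1" "fps_conv_radius g \<ge> 1"
    using order.trans[OF min.boundedI[OF that] fps_conv_radius_add]
      order.trans[OF min.boundedI[OF that] fps_conv_radius_mult] .
  show "fps_conv_radius (f ^ n) \<ge> 1" if "fps_conv_radius f \<ge> 1"
    using that fps_conv_radius_power by (rule order.trans)
qed simp

text \<open>All series converge on the unit disc, so a formal relation becomes one between functions
  of \<tau>. The affine parameters absorb the change between the q-expansions in use and the lattice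
  sums \<open>eis\<close>.\<close>

theorem eisenstein_independent:
  fixes c :: "nat \<times> nat \<times> nat \<Rightarrow> complex" and \<alpha>1 \<alpha>2 \<alpha>3 \<beta>1 \<beta>2 \<beta>3 :: complex
  assumes \<beta>: "\<beta>1 \<noteq> 0" "\<beta>2 \<noteq> 0" "\<beta>3 \<noteq> 0" and A: "finite A"
  defines "e1 \<equiv> fps_const \<alpha>1 + fps_const \<beta>1 * sigma_fps 1"
    and "e2 \<equiv> fps_const \<alpha>2 + fps_const \<beta>2 * sigma_fps 3"
    and "e3 \<equiv> fps_const \<alpha>3 + fps_const \<beta>3 * sigma_fps 5"
  assumes z: "(\<Sum>(i, j, k)\<in>A. fps_const (c (i, j, k)) * e1 ^ i * e2 ^ j * e3 ^ k) = 0" and t: "t \<in> A"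
  shows "c t = 0"
proof -
  define F where "F x y w = (\<Sum>(i, j, k)\<in>A. c (i, j, k) * x ^ i * y ^ j * w ^ k)" for x y w
  have sig: "fps_conv_radius (sigma_fps k) \<ge> 1" if "k \<ge> 1" for k
    by (rule lambert_has_sum(2)[of 0, OF _ that]) simp
  have R: "fps_conv_radius e1 \<ge> 1" "fps_conv_radius e2 \<ge> 1" "fps_conv_radius e3 \<ge> 1"
    unfolding e1_def e2_def e3_def by (intro conv_radius_ge_1_intros sig, simp)+
  have ev: "eval_fps (f + g) q = eval_fps f q + eval_fps g q" "eval_fps (f * g) q = eval_fps f q * eval_fps g q"
    if "fps_conv_radius f \<ge> 1" "fps_conv_radius g \<ge> 1" "norm q < 1" for f g :: "complex fps" and q
  proof -
    have "ereal (norm q) < fps_conv_radius f" "ereal (norm q) < fps_conv_radius g"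
      using that by (metis ereal_less(3) less_le_trans)+
    then show "eval_fps (f + g) q = eval_fps f q + eval_fps g q" "eval_fps (f * g) q = eval_fps f q * eval_fps g q"
      by (simp_all add: eval_fps_add eval_fps_mult)
  qed
  have evp: "eval_fps (f ^ n) q = eval_fps f q ^ n"
    if "fps_conv_radius f \<ge> 1" "norm q < 1" for f :: "complex fps" and q n
    by (induction n) (simp_all add: ev(2) that conv_radius_ge_1_intros)
  have zero: "F (eval_fps e1 q) (eval_fps e2 q) (eval_fps e3 q) = 0" if q: "norm q < 1" for q
  proof -
    let ?m = "\<lambda>(i, j, k). fps_const (c (i, j, k)) * e1 ^ i * e2 ^ j * e3 ^ k"
    have m: "fps_conv_radius (?m t) \<ge> 1" for t
      by (cases t) (auto intro!: conv_radius_ge_1_intros R)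
    have "fps_conv_radius (sum ?m B) \<ge> 1 \<and> eval_fps (sum ?m B) q = (\<Sum>t\<in>B. eval_fps (?m t) q)" if "finite B" for B
      using that
    proof induction
      case (insert t B)
      then show ?case using m[of t] ev(1)[OF m[of t] _ q, of "sum ?m B"]
        by (auto intro: conv_radius_ge_1_intros)
    qed simp
    from this[OF A] have "(\<Sum>t\<in>A. eval_fps (?m t) q) = eval_fps (sum ?m A) q" by simp
    also have "sum ?m A = 0" using z by simp
    finally have "(\<Sum>t\<in>A. eval_fps (?m t) q) = 0" by simp
    moreover have mE: "eval_fps (?m (i, j, k)) q = c (i, j, k) * eval_fps e1 q ^ i * eval_fps e2 q ^ j * eval_fps e3 q ^ k" for i j k
      using q by (simp add: ev(2) evp conv_radius_ge_1_intros R)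
    moreover have "(\<Sum>t\<in>A. eval_fps (?m t) q) = F (eval_fps e1 q) (eval_fps e2 q) (eval_fps e3 q)"
      unfolding F_def by (intro sum.cong refl) (use mE in \<open>auto split: prod.splits\<close>)
    ultimately show ?thesis by simp
  qed
  have E: "eval_fps (fps_const \<alpha> + fps_const \<beta> * sigma_fps k) (nome \<tau>) =
      (\<alpha> - \<beta> * zeta_sum (k + 1) / (2 * eis_coeff k)) + \<beta> / (2 * eis_coeff k) * eis k \<tau>"
    if "Im \<tau> > 0" "k \<ge> 1" for \<alpha> \<beta> k \<tau>
  proof -
    have q: "norm (nome \<tau>) < 1" by (rule norm_nome_less_1[OF that(1)])
    have "eval_fps (fps_const \<alpha> + fps_const \<beta> * sigma_fps k) (nome \<tau>) = \<alpha> + \<beta> * eval_fps (sigma_fps k) (nome \<tau>)"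
      using q sig[OF that(2)] by (simp add: ev(1,2) conv_radius_ge_1_intros)
    then show ?thesis using eis_coeff_nonzero[of k] by (simp add: eis_def field_simps)
  qed
  have "F x y w = 0" for x y w
  proof (rule eisenstein_independent_fun[of F])
    show "poly_fun (\<lambda>x. F (f x) (g x) (h x))" if "poly_fun f" "poly_fun g" "poly_fun h" for f g h
      unfolding F_def by (intro poly_fun_sum) (auto intro!: poly_fun_intros poly_fun_power that)
    show "\<beta>1 / (2 * eis_coeff 1) \<noteq> 0" "\<beta>2 / (2 * eis_coeff 3) \<noteq> 0" "\<beta>3 / (2 * eis_coeff 5) \<noteq> 0"
      using \<beta> eis_coeff_nonzero by simp_all
    fix \<tau> :: complex assume \<tau>: "Im \<tau> > 0"
    show "F ((\<alpha>1 - \<beta>1 * zeta_sum (1 + 1) / (2 * eis_coeff 1)) + \<beta>1 / (2 * eis_coeff 1) * eis 1 \<tau>)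
       ((\<alpha>2 - \<beta>2 * zeta_sum (3 + 1) / (2 * eis_coeff 3)) + \<beta>2 / (2 * eis_coeff 3) * eis 3 \<tau>)
       ((\<alpha>3 - \<beta>3 * zeta_sum (5 + 1) / (2 * eis_coeff 5)) + \<beta>3 / (2 * eis_coeff 5) * eis 5 \<tau>) = 0"
      using zero[OF norm_nome_less_1[OF \<tau>]]
      unfolding e1_def e2_def e3_def E[OF \<tau> order_refl] E[OF \<tau>, of 3, simplified] E[OF \<tau>, of 5, simplified]
      by simp
  qed
  then show ?thesis using coeffs_zero_3[OF A _ t, of c] unfolding F_def by blast
qed

section \<open>Square-bracket modes and the evaluation of the contractions\<close>

section \<open>Series in \<open>q\<close>\<close>

lemma q_series_add: "q_series (f + g) = q_series f + q_series g"
  by (simp add: q_series_def fps_compose_add_distrib fps_to_fls_plus)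

lemma q_series_mult: "q_series (f * g) = q_series f * q_series g"
  by (simp add: q_series_def fps_compose_mult_distrib fls_times_fps_to_fls)

lemma q_series_const: "q_series (fps_const c) = fls_const c"
  by (simp add: q_series_def)

lemma q_series_1: "q_series 1 = 1"
  using q_series_const[of 1] by simp

lemma q_series_power: "q_series (f ^ n) = q_series f ^ n"
  by (induction n) (simp_all add: q_series_1 q_series_mult)

lemma q_series_nth: "fps_nth (f oo fps_X ^ 24) (24 * n) = fps_nth f n"
proof -
  have "fps_nth (f oo fps_X ^ 24) (24 * n) = (\<Sum>i=0..24*n. fps_nth f i * fps_nth ((fps_X ^ 24) ^ i) (24 * n))"
    by (simp add: fps_compose_nth)
  also have "\<dots> = (\<Sum>i=0..24*n. if i = n then fps_nth f n else 0)"
    by (intro sum.cong refl) (auto simp: fps_X_power_nth power_mult[symmetric])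
  finally show ?thesis by simp
qed

lemma q_series_inj: "q_series f = q_series g \<Longrightarrow> f = g"
proof -
  assume "q_series f = q_series g"
  then have "f oo fps_X ^ 24 = g oo fps_X ^ 24" by (simp add: q_series_def)
  then show "f = g" by (intro fps_ext) (metis q_series_nth)
qed

text \<open>The factor q^(d/24) of \<eta>^d cancels q^(-c/24) because c = d; what remains is a
  series in integral powers of q.\<close>

lemma eta_power_trace_fun:
  "eta ^ cvs.dim (UNIV :: 'h::quad_space set) * trace_fun (v :: 'h boson) =
     q_series (euler_product ^ cvs.dim (UNIV :: 'h set) * ztrace v)"
proof -
  let ?d = "cvs.dim (UNIV :: 'h set)"
  have "fls_X ^ ?d * fls_X_intpow (- int ?d) = (1 :: complex fls)"
    by (simp add: fls_X_power_conv_shift_1 fls_shifted_times_simps)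
  moreover have "eta ^ ?d = fls_X ^ ?d * q_series (euler_product ^ ?d)"
    by (simp add: eta_def euler_product_def power_mult_distrib q_series_power)
  moreover have "trace_fun v = fls_X_intpow (- int ?d) * q_series (ztrace v)"
    by (simp add: trace_fun_def ztrace_def)
  ultimately have "eta ^ ?d * trace_fun v = 1 * (q_series (euler_product ^ ?d) * q_series (ztrace v))"
    by (metis (no_types, lifting) mult.assoc mult.commute mult.left_commute)
  then show ?thesis by (simp add: q_series_mult)
qed

section \<open>Bernoulli numbers and bracket modes\<close>

text \<open>The series (e^z - 1) / z. Its inverse \<open>bern\<close> generates the numbers B_n /
  n!.\<close>

definition exp_quot :: "complex fps" where
  "exp_quot = Abs_fps (\<lambda>n. 1 / fact (n + 1))"

definition bern :: "complex fps" where
  "bern = inverse exp_quot"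

lemma exp_minus_1: "fps_exp 1 - 1 = fps_X * exp_quot"
proof (rule fps_ext)
  fix n
  show "fps_nth (fps_exp 1 - 1) n = fps_nth (fps_X * exp_quot) n"
    by (cases n) (simp_all add: exp_quot_def algebra_simps)
qed

lemma exp_quot_0: "fps_nth exp_quot 0 = 1"
  by (simp add: exp_quot_def)

lemma bern_mult: "bern * exp_quot = 1"
  unfolding bern_def by (rule inverse_mult_eq_1) (simp add: exp_quot_0)

lemma bern_eq: "fps_X / (fps_exp 1 - 1) = bern"
proof -
  have nz: "exp_quot \<noteq> 0" using exp_quot_0 by auto
  have "bern * (fps_X * exp_quot) = fps_X * (bern * exp_quot)" by (simp only: mult_ac)
  then have "fps_X / (fps_exp 1 - 1) = bern * (fps_X * exp_quot) / (fps_X * exp_quot)"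
    by (simp only: exp_minus_1 bern_mult mult_1_right)
  also have "\<dots> = bern" using nz by (intro nonzero_mult_div_cancel_right) simp
  finally show ?thesis .
qed

lemma fps_mult_nths:
  fixes f g :: "complex fps"
  shows "fps_nth (f * g) 0 = fps_nth f 0 * fps_nth g 0"
    "fps_nth (f * g) 1 = fps_nth f 0 * fps_nth g 1 + fps_nth f 1 * fps_nth g 0"
    "fps_nth (f * g) 2 = fps_nth f 0 * fps_nth g 2 + fps_nth f 1 * fps_nth g 1 + fps_nth f 2 * fps_nth g 0"
    "fps_nth (f * g) 3 = fps_nth f 0 * fps_nth g 3 + fps_nth f 1 * fps_nth g 2 + fps_nth f 2 * fps_nth g 1 +
       fps_nth f 3 * fps_nth g 0"
    "fps_nth (f * g) 4 = fps_nth f 0 * fps_nth g 4 + fps_nth f 1 * fps_nth g 3 + fps_nth f 2 * fps_nth g 2 +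
       fps_nth f 3 * fps_nth g 1 + fps_nth f 4 * fps_nth g 0"
    "fps_nth (f * g) 5 = fps_nth f 0 * fps_nth g 5 + fps_nth f 1 * fps_nth g 4 + fps_nth f 2 * fps_nth g 3 +
       fps_nth f 3 * fps_nth g 2 + fps_nth f 4 * fps_nth g 1 + fps_nth f 5 * fps_nth g 0"
    "fps_nth (f * g) 6 = fps_nth f 0 * fps_nth g 6 + fps_nth f 1 * fps_nth g 5 + fps_nth f 2 * fps_nth g 4 +
       fps_nth f 3 * fps_nth g 3 + fps_nth f 4 * fps_nth g 2 + fps_nth f 5 * fps_nth g 1 + fps_nth f 6 * fps_nth g 0"
  by (simp_all add: fps_mult_nth numeral_eq_Suc)

lemma exp_quot_nths:
  "fps_nth exp_quot 0 = 1" "fps_nth exp_quot 1 = 1 / 2" "fps_nth exp_quot 2 = 1 / 6"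
  "fps_nth exp_quot 3 = 1 / 24" "fps_nth exp_quot 4 = 1 / 120" "fps_nth exp_quot 5 = 1 / 720"
  "fps_nth exp_quot 6 = 1 / 5040"
  by (simp_all add: exp_quot_def fact_numeral)

lemma bern_nths:
  "fps_nth bern 0 = 1" "fps_nth bern 1 = - 1 / 2" "fps_nth bern 2 = 1 / 12" "fps_nth bern 3 = 0"
  "fps_nth bern 4 = - 1 / 720" "fps_nth bern 5 = 0" "fps_nth bern 6 = 1 / 30240"
proof -
  note e = arg_cong[OF bern_mult, of "\<lambda>f. fps_nth f n" for n]
  have linear: "x = - y" if "y + x * 1 = 0" for x y :: complex
    using that by (simp add: eq_neg_iff_add_eq_0 add.commute)
  have one: "fps_nth (1 :: complex fps) (numeral k) = 0" "fps_nth (1 :: complex fps) 1 = 0" for k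
    by simp_all
  show 0: "fps_nth bern 0 = 1"
    using e[of 0] by (simp only: fps_mult_nths exp_quot_nths) simp
  show 1: "fps_nth bern 1 = - 1 / 2"
    by (rule trans[OF linear[OF e[of 1, unfolded fps_mult_nths exp_quot_nths one 0]]]) simp
  show 2: "fps_nth bern 2 = 1 / 12"
    by (rule trans[OF linear[OF e[of 2, unfolded fps_mult_nths exp_quot_nths one 0 1]]]) simp
  show 3: "fps_nth bern 3 = 0"
    by (rule trans[OF linear[OF e[of 3, unfolded fps_mult_nths exp_quot_nths one 0 1 2]]]) simp
  show 4: "fps_nth bern 4 = - 1 / 720"
    by (rule trans[OF linear[OF e[of 4, unfolded fps_mult_nths exp_quot_nths one 0 1 2 3]]]) simp
  show 5: "fps_nth bern 5 = 0"
    by (rule trans[OF linear[OF e[of 5, unfolded fps_mult_nths exp_quot_nths one 0 1 2 3 4]]]) simp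
  show 6: "fps_nth bern 6 = 1 / 30240"
    by (rule trans[OF linear[OF e[of 6, unfolded fps_mult_nths exp_quot_nths one 0 1 2 3 4 5]]]) simp
qed

text \<open>The coefficient of \<open>a(m)\<close> in \<open>a[-k]\<close>.\<close>

definition bcoeff :: "nat \<Rightarrow> int \<Rightarrow> complex" where
  "bcoeff k m = fls_nth ((fps_to_fls (fps_exp 1 - 1)) powi (- m - 1) * fps_to_fls (fps_exp (of_nat 1))) (int k - 1)"

lemma bcoeff_neg:
  assumes "k \<ge> 1"
  shows "bcoeff k (- int (Suc j)) = (if k - 1 < j then 0 else fps_nth (exp_quot ^ j * fps_exp 1) (k - 1 - j))"
proof -
  have "(fps_to_fls (fps_exp 1 - 1)) powi (- (- int (Suc j)) - 1) * fps_to_fls (fps_exp (of_nat 1)) =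
      fps_to_fls (fps_X ^ j * (exp_quot ^ j * fps_exp 1 :: complex fps))"
    by (simp add: exp_minus_1 fps_to_fls_power fls_times_fps_to_fls power_mult_distrib mult.assoc)
  then have "bcoeff k (- int (Suc j)) = fps_nth (fps_X ^ j * (exp_quot ^ j * fps_exp 1)) (k - 1)"
    using assms by (simp add: bcoeff_def fps_to_fls_nth nat_diff_distrib)
  then show ?thesis by (simp only: fps_X_power_mult_nth)
qed

text \<open>(e^z - 1)^(-m-1) equals z^(-m-1) times the (m+1)-st power of z / (e^z - 1), so the
  coefficient of z^(k-1) sits at k + m after the shift.\<close>

lemma bcoeff_nonneg:
  assumes "k \<ge> 1"
  shows "bcoeff k (int m) = fps_nth (fps_exp 1 * bern ^ Suc m) (k + m)"
proof -
  let ?x = "fps_to_fls (fps_X * exp_quot) :: complex fls" and ?b = "fps_to_fls bern"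
  have b: "?b ^ Suc m * fps_to_fls exp_quot ^ Suc m = 1"
    by (simp only: power_mult_distrib[symmetric] fls_times_fps_to_fls[symmetric] bern_mult power_one fps_one_to_fls)
  have x: "?x ^ Suc m = fls_X ^ Suc m * fps_to_fls exp_quot ^ Suc m"
    by (simp only: fls_times_fps_to_fls fps_X_to_fls power_mult_distrib)
  have "?x powi (- int m - 1) = inverse (?x ^ Suc m)"
    by (simp add: power_int_def nat_add_distrib add.commute power_inverse)
  also have "\<dots> = inverse (fls_X ^ Suc m) * ?b ^ Suc m"
  proof (rule inverse_unique)
    have "fls_X ^ Suc m \<noteq> (0 :: complex fls)" by simp
    then show "?x ^ Suc m * (inverse (fls_X ^ Suc m) * ?b ^ Suc m) = 1"
      unfolding x using b by (metis (no_types, opaque_lifting) mult.assoc mult.commute mult.left_neutral right_inverse)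
  qed
  also have "inverse (fls_X ^ Suc m) = (fls_X_intpow (- int (Suc m)) :: complex fls)"
    by (simp only: fls_inverse_X_power fls_X_inv_power_conv_shift_1 minus_minus)
  finally have "?x powi (- int m - 1) * fps_to_fls (fps_exp (of_nat 1)) =
      fls_shift (int (Suc m)) (fps_to_fls (bern ^ Suc m * fps_exp 1))"
    by (simp add: fls_times_fps_to_fls fps_to_fls_power fls_shifted_times_simps mult.assoc add.commute)
  then have "bcoeff k (int m) = fls_nth (fps_to_fls (bern ^ Suc m * fps_exp 1)) (int k - 1 + int (Suc m))"
    by (simp add: bcoeff_def exp_minus_1)
  also have "int k - 1 + int (Suc m) = int (k + m)" by simp
  finally show ?thesis by (simp only: fps_to_fls_nth nat_int mult.commute) simp
qed

lemma exp_nths: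
  "fps_nth (fps_exp 1 :: complex fps) 0 = 1" "fps_nth (fps_exp 1 :: complex fps) 1 = 1"
  "fps_nth (fps_exp 1 :: complex fps) 2 = 1 / 2" "fps_nth (fps_exp 1 :: complex fps) 3 = 1 / 6"
  "fps_nth (fps_exp 1 :: complex fps) 4 = 1 / 24" "fps_nth (fps_exp 1 :: complex fps) 5 = 1 / 120"
  "fps_nth (fps_exp 1 :: complex fps) 6 = 1 / 720"
  by (simp_all add: fact_numeral)

lemma exp_bern_1_nths:
  "fps_nth (fps_exp 1 * bern) 0 = 1" "fps_nth (fps_exp 1 * bern) 1 = 1 / 2" "fps_nth (fps_exp 1 * bern) 2 = 1 / 12"
  "fps_nth (fps_exp 1 * bern) 3 = 0" "fps_nth (fps_exp 1 * bern) 4 = - 1 / 720" "fps_nth (fps_exp 1 * bern) 5 = 0"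
  "fps_nth (fps_exp 1 * bern) 6 = 1 / 30240"
  by (simp_all only: fps_mult_nths exp_nths bern_nths) simp_all

lemma exp_bern_2_nths:
  "fps_nth (fps_exp 1 * bern * bern) 0 = 1" "fps_nth (fps_exp 1 * bern * bern) 1 = 0"
  "fps_nth (fps_exp 1 * bern * bern) 2 = - 1 / 12"
  "fps_nth (fps_exp 1 * bern * bern) 3 = 0" "fps_nth (fps_exp 1 * bern * bern) 4 = 1 / 240"
  "fps_nth (fps_exp 1 * bern * bern) 5 = 0" "fps_nth (fps_exp 1 * bern * bern) 6 = - 1 / 6048"
  by (simp_all only: fps_mult_nths(1-7)[of "fps_exp 1 * bern"] exp_bern_1_nths bern_nths) simp_all

lemma exp_bern_3_nths:
  "fps_nth (fps_exp 1 * bern * bern * bern) 0 = 1" "fps_nth (fps_exp 1 * bern * bern * bern) 1 = - 1 / 2"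
  "fps_nth (fps_exp 1 * bern * bern * bern) 2 = 0"
  "fps_nth (fps_exp 1 * bern * bern * bern) 3 = 1 / 24" "fps_nth (fps_exp 1 * bern * bern * bern) 4 = - 1 / 240"
  "fps_nth (fps_exp 1 * bern * bern * bern) 5 = - 1 / 480" "fps_nth (fps_exp 1 * bern * bern * bern) 6 = 1 / 3024"
  by (simp_all only: fps_mult_nths(1-7)[of "fps_exp 1 * bern * bern"] exp_bern_2_nths bern_nths) simp_all

lemma exp_bern_4_nths:
  "fps_nth (fps_exp 1 * bern * bern * bern * bern) 4 = - 19 / 720"
  "fps_nth (fps_exp 1 * bern * bern * bern * bern) 5 = 1 / 240"
  "fps_nth (fps_exp 1 * bern * bern * bern * bern) 6 = 1 / 945"
  by (simp_all only: fps_mult_nths(1-7)[of "fps_exp 1 * bern * bern * bern"] exp_bern_3_nths bern_nths) simp_all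

lemma bcoeff_values:
  "bcoeff 1 (- 1) = 1" "bcoeff 1 (- 2) = 0" "bcoeff 1 (- 3) = 0"
  "bcoeff 2 (- 1) = 1" "bcoeff 2 (- 2) = 1" "bcoeff 2 (- 3) = 0"
  "bcoeff 3 (- 1) = 1 / 2" "bcoeff 3 (- 2) = 3 / 2" "bcoeff 3 (- 3) = 1"
  "bcoeff 1 1 = - 1 / 12" "bcoeff 1 2 = 1 / 24" "bcoeff 1 3 = - 19 / 720"
  "bcoeff 2 1 = 0" "bcoeff 2 2 = - 1 / 240" "bcoeff 2 3 = 1 / 240"
  "bcoeff 3 1 = 1 / 240" "bcoeff 3 2 = - 1 / 480" "bcoeff 3 3 = 1 / 945"
proof -
  have n: "- 1 = - int (Suc 0)" "- 2 = - int (Suc 1)" "- 3 = - int (Suc 2)" by simp_all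
  have p: "1 = int 1" "2 = int 2" "3 = int 3" by simp_all
  have pw: "fps_exp 1 * bern ^ Suc 1 = fps_exp 1 * bern * bern"
    "fps_exp 1 * bern ^ Suc 2 = fps_exp 1 * bern * bern * bern"
    "fps_exp 1 * bern ^ Suc 3 = fps_exp 1 * bern * bern * bern * bern"
    by (simp_all add: numeral_eq_Suc mult_ac)
  have ar: "(1::nat) + 1 = 2" "(1::nat) + 2 = 3" "(1::nat) + 3 = 4" "(2::nat) + 1 = 3" "(2::nat) + 2 = 4" "(2::nat) + 3 = 5"
    "(3::nat) + 1 = 4" "(3::nat) + 2 = 5" "(3::nat) + 3 = 6" "(1::nat) - 1 = 0" "(2::nat) - 1 = 1" "(3::nat) - 1 = 2"
    "(1::nat) - 0 = 1" "(2::nat) - 0 = 2" "(1::nat) - 1 = 0" "(2::nat) - 2 = 0" by simp_all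
  show "bcoeff 1 (- 1) = 1" "bcoeff 1 (- 2) = 0" "bcoeff 1 (- 3) = 0"
    "bcoeff 2 (- 1) = 1" "bcoeff 2 (- 2) = 1" "bcoeff 2 (- 3) = 0"
    "bcoeff 3 (- 1) = 1 / 2" "bcoeff 3 (- 3) = 1"
    unfolding n by (subst bcoeff_neg; simp add: fps_power_zeroth exp_quot_nths(1))+
  have "bcoeff 3 (- 2) = fps_nth (exp_quot * fps_exp 1) 1"
    unfolding n by (subst bcoeff_neg) simp_all
  then show "bcoeff 3 (- 2) = 3 / 2"
    by (simp only: fps_mult_nths exp_quot_nths exp_nths) simp
  have 1: "bcoeff k 1 = fps_nth (fps_exp 1 * bern * bern) (k + 1)" if "k \<ge> 1" for k
    using bcoeff_nonneg[OF that, of 1] unfolding pw by simp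
  have 2: "bcoeff k 2 = fps_nth (fps_exp 1 * bern * bern * bern) (k + 2)" if "k \<ge> 1" for k
    using bcoeff_nonneg[OF that, of 2] unfolding pw by simp
  have 3: "bcoeff k 3 = fps_nth (fps_exp 1 * bern * bern * bern * bern) (k + 3)" if "k \<ge> 1" for k
    using bcoeff_nonneg[OF that, of 3] unfolding pw by simp
  have ge: "(1::nat) \<le> 1" "(1::nat) \<le> 2" "(1::nat) \<le> 3" by simp_all
  show "bcoeff 1 1 = - 1 / 12" "bcoeff 2 1 = 0" "bcoeff 3 1 = 1 / 240"
    unfolding 1[OF ge(1)] 1[OF ge(2)] 1[OF ge(3)] ar exp_bern_2_nths by (rule refl)+
  show "bcoeff 1 2 = 1 / 24" "bcoeff 2 2 = - 1 / 240" "bcoeff 3 2 = - 1 / 480"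
    unfolding 2[OF ge(1)] 2[OF ge(2)] 2[OF ge(3)] ar exp_bern_3_nths by (rule refl)+
  show "bcoeff 1 3 = - 19 / 720" "bcoeff 2 3 = 1 / 240" "bcoeff 3 3 = 1 / 945"
    unfolding 3[OF ge(1)] 3[OF ge(2)] 3[OF ge(3)] ar exp_bern_4_nths by (rule refl)+
qed

lemma bcoeff_below: "1 \<le> k \<Longrightarrow> m < - int k \<Longrightarrow> bcoeff k m = 0"
  using bcoeff_neg[of k "nat (- m - 1)"] by simp

section \<open>Trace functions of the vectors \<open>a[-1]\<^sup>r a[-2]\<^sup>s a[-3]\<^sup>t \<one>\<close>\<close>

lemma hbracket_eq:
  "hbracket a (- int k) w = Sum_any (\<lambda>m. bcoeff k m *\<^sub>C hmode a m w)"
  by (simp add: hbracket_def bracket_mode_def bcoeff_def vmode_hmode_vac)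

text \<open>Words in a[-1], a[-2], a[-3] involve no creation mode below a(-3), so annihilation modes
  above a(3) kill them. Hence a[-k] acts on such words by a finite sum, and only coefficients up to
  index 3 have to be computed.\<close>

definition small :: "'h::quad_space \<Rightarrow> 'h boson \<Rightarrow> bool" where
  "small a w \<longleftrightarrow> (\<forall>m>3. hmode a m w = 0)"

definition bop :: "'h::quad_space \<Rightarrow> nat \<Rightarrow> 'h boson \<Rightarrow> 'h boson" where
  "bop a k w = (\<Sum>m\<in>{-3..3}. bcoeff k m *\<^sub>C hmode a m w)"

lemma clin_bop: "clin (bop a k)"
  unfolding bop_def by (intro clin_sum_fun clin_scale_fun clin_hmode)

lemma hbracket_bop:
  assumes "k \<in> {1..3}" "small a w"
  shows "hbracket a (- int k) w = bop a k w"
  unfolding hbracket_eq bop_def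
proof (rule Sum_any.expand_superset)
  show "{m. bcoeff k m *\<^sub>C hmode a m w \<noteq> 0} \<subseteq> {-3..3}"
  proof
    fix m assume "m \<in> {m. bcoeff k m *\<^sub>C hmode a m w \<noteq> 0}"
    then have "bcoeff k m \<noteq> 0" "hmode a m w \<noteq> 0" by auto
    then have "\<not> m < - int k" "\<not> m > 3" using bcoeff_below[of k m] assms by (auto simp: small_def)
    then show "m \<in> {-3..3}" using assms(1) by auto
  qed
qed simp

lemma small_hmode:
  assumes "small a w" "n \<ge> -3"
  shows "small a (hmode a n w)"
  using assms by (auto simp: small_def hmode_commute[of a _ a n] hmode_zero)

lemma small_vac: "small a vac"
  by (simp add: small_def hmode_nonneg_vac)

lemma small_bop: "small a w \<Longrightarrow> small a (bop a k w)"
  using small_hmode[of a w] by (simp add: bop_def small_def hmode_sum hmode_scale)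

text \<open>Only the summand a(-l) of a[-k] fails to commute with a(l), so the commutator is a
  scalar.\<close>

lemma hmode_bop:
  assumes "form a a = 1" "l \<in> {1..3}"
  shows "hmode a (int l) (bop a k w) = bop a k (hmode a (int l) w) + (of_nat l * bcoeff k (- int l)) *\<^sub>C w"
proof -
  have "hmode a (int l) (bop a k w) = (\<Sum>m\<in>{-3..3}. bcoeff k m *\<^sub>C hmode a m (hmode a (int l) w) +
      (if m = - int l then (of_nat l * bcoeff k (- int l)) *\<^sub>C w else 0))"
    unfolding bop_def hmode_sum hmode_scale
    by (intro sum.cong refl) (auto simp: hmode_commute[of a "int l"] assms(1) cvs.scale_right_distrib mult.commute)
  also have "\<dots> = bop a k (hmode a (int l) w) + (of_nat l * bcoeff k (- int l)) *\<^sub>C w"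
    using assms(2) by (simp add: sum.distrib bop_def)
  finally show ?thesis .
qed

lemma sum_upto_3:
  fixes f :: "nat \<Rightarrow> 'a::comm_monoid_add"
  shows "(\<Sum>l=1..3. f l) = f 1 + f 2 + f 3"
  by (simp add: numeral_eq_Suc add_ac)

lemma bop_expand:
  "bop a k w = (\<Sum>j=1..3. bcoeff k (- int j) *\<^sub>C hmode a (- int j) w) + (\<Sum>l=1..3. bcoeff k (int l) *\<^sub>C hmode a (int l) w)"
proof -
  have "{-3..3} = {-3, -2, -1, 0, 1, 2, 3 :: int}" by auto
  then show ?thesis unfolding bop_def sum_upto_3 by (simp add: hmode_0 add_ac)
qed

lemma ztrace_hmode_small:
  assumes "small a w" "k \<ge> 1"
  shows "ztrace (hmode a (- int k) w) = (\<Sum>l=1..3. trace_coeff k l * ztrace (hmode a (int l) w))"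
proof -
  have "\<forall>\<^sub>F L in sequentially. 3 \<le> (L::nat)" by (rule eventually_ge_at_top)
  then have "\<forall>\<^sub>F L::nat in sequentially. ?thesis"
    using ztrace_hmode[OF assms(2), of a w]
  proof eventually_elim
    case (elim L)
    have "(\<Sum>l\<le>L. trace_coeff k l * ztrace (hmode a (int l) w)) = (\<Sum>l=1..3. trace_coeff k l * ztrace (hmode a (int l) w))"
      using elim(1) assms(1) by (intro sum.mono_neutral_right) (auto simp: small_def ztrace_zero hmode_0 not_le Suc_le_eq)
    then show ?case using elim by simp
  qed
  then show ?thesis by simp
qed

text \<open>The creation part of a[-k] is converted into annihilation modes by the trace recursion;
  its annihilation part enters directly, as the last summand.\<close>

definition bop_coeff :: "nat \<Rightarrow> nat \<Rightarrow> complex fps" where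
  "bop_coeff k l = (\<Sum>j=1..3. fps_const (bcoeff k (- int j)) * trace_coeff j l) + fps_const (bcoeff k (int l))"

lemma ztrace_sum: "ztrace (sum f A) = (\<Sum>i\<in>A. ztrace (f i))"
  by (induction A rule: infinite_finite_induct) (simp_all add: ztrace_add ztrace_zero)

lemma ztrace_bop:
  assumes "small a w"
  shows "ztrace (bop a k w) = (\<Sum>l=1..3. bop_coeff k l * ztrace (hmode a (int l) w))"
proof -
  have h: "ztrace (hmode a (- int j) w) = (\<Sum>l=1..3. trace_coeff j l * ztrace (hmode a (int l) w))" if "j \<in> {1..3}" for j
    by (rule ztrace_hmode_small[OF assms]) (use that in simp)
  have "ztrace (bop a k w) = (\<Sum>j=1..3. fps_const (bcoeff k (- int j)) * (\<Sum>l=1..3. trace_coeff j l * ztrace (hmode a (int l) w))) +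
      (\<Sum>l=1..3. fps_const (bcoeff k (int l)) * ztrace (hmode a (int l) w))"
    unfolding bop_expand ztrace_add ztrace_sum ztrace_scale
    by (intro arg_cong2[of _ _ _ _ "(+)"] sum.cong refl arg_cong2[of _ _ _ _ "(*)"] h)
  also have "(\<Sum>j=1..3. fps_const (bcoeff k (- int j)) * (\<Sum>l=1..3. trace_coeff j l * ztrace (hmode a (int l) w))) =
      (\<Sum>l=1..3. (\<Sum>j=1..3. fps_const (bcoeff k (- int j)) * trace_coeff j l) * ztrace (hmode a (int l) w))"
    unfolding sum_distrib_left sum_distrib_right by (subst sum.swap) (simp add: mult.assoc)
  finally show ?thesis by (simp add: bop_coeff_def distrib_right sum.distrib)
qed

definition bword :: "'h::quad_space \<Rightarrow> nat \<Rightarrow> nat \<Rightarrow> nat \<Rightarrow> 'h boson" where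
  "bword a r s t = (bop a 1 ^^ r) ((bop a 2 ^^ s) ((bop a 3 ^^ t) vac))"

lemma bword_simps:
  "bword a (Suc r) s t = bop a 1 (bword a r s t)" "bword a 0 (Suc s) t = bop a 2 (bword a 0 s t)"
  "bword a 0 0 (Suc t) = bop a 3 (bword a 0 0 t)" "bword a 0 0 0 = vac"
  by (simp_all add: bword_def)

lemma small_bop_power: "small a w \<Longrightarrow> small a ((bop a k ^^ r) w)"
  by (induction r) (simp_all add: small_bop)

lemma small_bword: "small a (bword a r s t)"
  unfolding bword_def by (intro small_bop_power small_vac)

lemma hbracket_power_bop: "k \<in> {1..3} \<Longrightarrow> small a w \<Longrightarrow> (hbracket a (- int k) ^^ r) w = (bop a k ^^ r) w"
  by (induction r) (simp_all add: hbracket_bop small_bop_power)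

lemma hbracket_word_eq:
  "(hbracket a (- 1) ^^ r) ((hbracket a (- 2) ^^ s) ((hbracket a (- 3) ^^ t) vac)) = bword a r s t"
  using hbracket_power_bop[of 1 a] hbracket_power_bop[of 2 a] hbracket_power_bop[of 3 a]
  by (simp add: bword_def small_bop_power small_vac)

lemma clin_bop_power: "clin (bop a k ^^ r)"
proof (induction r)
  case 0
  then show ?case by (simp add: clin_id id_def)
next
  case (Suc r)
  show ?case using clin_compose[OF clin_bop Suc] by (simp add: comp_def)
qed

lemma hmode_bop_power:
  assumes "form a a = 1" "l \<in> {1..3}"
  shows "hmode a (int l) ((bop a k ^^ r) w) = (bop a k ^^ r) (hmode a (int l) w) +
    (of_nat r * (of_nat l * bcoeff k (- int l))) *\<^sub>C (bop a k ^^ (r - 1)) w"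
proof (induction r)
  case (Suc r)
  have "(bop a k ^^ Suc r) (hmode a (int l) w) = bop a k ((bop a k ^^ r) (hmode a (int l) w))" by simp
  moreover have "(of_nat r * (of_nat l * bcoeff k (- int l))) *\<^sub>C bop a k ((bop a k ^^ (r - 1)) w) =
      (of_nat r * (of_nat l * bcoeff k (- int l))) *\<^sub>C (bop a k ^^ r) w"
    by (cases r) simp_all
  ultimately show ?case
    by (simp add: hmode_bop[OF assms] Suc clin_add[OF clin_bop] clin_scale[OF clin_bop]
        cvs.scale_left_distrib distrib_right add_ac)
qed simp

text \<open>A positive mode acts as a derivation on words: it kills \<open>vac\<close> and has
  scalar commutators with all three letters.\<close>

lemma hmode_bword:
  assumes "form a a = 1" "l \<in> {1..3}"
  shows "hmode a (int l) (bword a r s t) =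
    (of_nat r * (of_nat l * bcoeff 1 (- int l))) *\<^sub>C bword a (r - 1) s t +
    (of_nat s * (of_nat l * bcoeff 2 (- int l))) *\<^sub>C bword a r (s - 1) t +
    (of_nat t * (of_nat l * bcoeff 3 (- int l))) *\<^sub>C bword a r s (t - 1)"
  unfolding bword_def
  by (simp add: hmode_bop_power[OF assms] hmode_nonneg_vac clin_add[OF clin_bop_power]
      clin_scale[OF clin_bop_power] clin_zero[OF clin_bop_power] add_ac)

text \<open>The pairing in Wick's theorem: the trace recursion replaces a[-n] by the modes a(l), and
  the last factor is the commutator of a(l) with a[-m].\<close>

definition contraction :: "nat \<Rightarrow> nat \<Rightarrow> complex fps" where
  "contraction n m = (\<Sum>l=1..3. bop_coeff n l * fps_const (of_nat l * bcoeff m (- int l)))"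

lemma ztrace_bop_bword:
  assumes "form a a = 1"
  shows "ztrace (bop a n (bword a r s t)) =
    of_nat r * contraction n 1 * ztrace (bword a (r - 1) s t) +
    of_nat s * contraction n 2 * ztrace (bword a r (s - 1) t) +
    of_nat t * contraction n 3 * ztrace (bword a r s (t - 1))"
proof -
  have c: "fps_const (of_nat r * x) = of_nat r * fps_const x" for r x
    by (simp add: fps_of_nat[symmetric])
  have "ztrace (bop a n (bword a r s t)) = (\<Sum>l=1..3. bop_coeff n l * (
     of_nat r * fps_const (of_nat l * bcoeff 1 (- int l)) * ztrace (bword a (r - 1) s t) +
     of_nat s * fps_const (of_nat l * bcoeff 2 (- int l)) * ztrace (bword a r (s - 1) t) +
     of_nat t * fps_const (of_nat l * bcoeff 3 (- int l)) * ztrace (bword a r s (t - 1))))"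
    unfolding ztrace_bop[OF small_bword]
    by (intro sum.cong refl arg_cong2[of _ _ _ _ "(*)"])
       (simp only: hmode_bword[OF assms] ztrace_add ztrace_scale c)
  also have "\<dots> = of_nat r * contraction n 1 * ztrace (bword a (r - 1) s t) +
    of_nat s * contraction n 2 * ztrace (bword a r (s - 1) t) +
    of_nat t * contraction n 3 * ztrace (bword a r s (t - 1))"
    unfolding contraction_def sum_upto_3 by (simp only: distrib_left distrib_right mult_ac add_ac)
  finally show ?thesis .
qed

section \<open>The contractions are Eisenstein series\<close>

definition eisen :: "nat \<Rightarrow> complex fps" where
  "eisen k = Abs_fps (\<lambda>n. if n = 0 then - bernoulli_number (2 * k) / fact (2 * k)
     else 2 / fact (2 * k - 1) * of_nat (divisor_power_sum (2 * k - 1) n))"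

lemma q_series_eisen: "q_series (eisen k) = eisenstein k"
  by (simp add: eisen_def eisenstein_def)

lemma eisen_eq: "eisen k = fps_const (- fps_nth bern (2 * k)) + fps_const (2 / fact (2 * k - 1)) * sigma_fps (2 * k - 1)"
  by (rule fps_ext) (simp add: eisen_def sigma_fps_def bernoulli_number_def bern_eq fps_nth_fps_const)

lemma eisen_values:
  "eisen 1 = fps_const (- 1 / 12) + fps_const 2 * sigma_fps 1"
  "eisen 2 = fps_const (1 / 720) + fps_const (1 / 3) * sigma_fps 3"
  "eisen 3 = fps_const (- 1 / 30240) + fps_const (1 / 60) * sigma_fps 5"
proof -
  have a: "2 * 1 = (2::nat)" "2 * 2 = (4::nat)" "2 * 3 = (6::nat)" "2 - 1 = (1::nat)" "4 - 1 = (3::nat)" "6 - 1 = (5::nat)"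
    by simp_all
  show "eisen 1 = fps_const (- 1 / 12) + fps_const 2 * sigma_fps 1"
    unfolding eisen_eq a bern_nths by simp
  show "eisen 2 = fps_const (1 / 720) + fps_const (1 / 3) * sigma_fps 3"
    unfolding eisen_eq a bern_nths by (simp add: fact_numeral)
  show "eisen 3 = fps_const (- 1 / 30240) + fps_const (1 / 60) * sigma_fps 5"
    unfolding eisen_eq a bern_nths by (simp add: fact_numeral)
qed

lemma sigma_fps_eq: "sigma_fps k = divisor_series (\<lambda>i. of_nat i ^ k)"
  by (rule fps_ext) (simp add: sigma_fps_def divisor_series_def divisor_power_sum_def)

lemma gchoose_small:
  fixes x :: complex
  shows "x gchoose 0 = 1" "x gchoose 1 = x" "x gchoose 2 = x * (x - 1) / 2" "x gchoose 3 = x * (x - 1) * (x - 2) / 6"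
  by (simp_all add: gbinomial_prod_rev numeral_eq_Suc)

text \<open>The summand is an odd polynomial in i of degree at most k - 1 + l. For k, l up to 3 only
  the powers 1, 3, 5 occur, that is, the divisor sums of E_2, E_4, E_6.\<close>

lemma trace_coeff_poly:
  assumes "\<And>i. np_coeff k (int i) * (of_int (int i) gchoose l) - np_coeff k (- int i) * (of_int (- int i) gchoose l)
     = x * of_nat i ^ 1 + (y * of_nat i ^ 3 + z * of_nat i ^ 5)"
  shows "trace_coeff k l = fps_const x * sigma_fps 1 + (fps_const y * sigma_fps 3 + fps_const z * sigma_fps 5)"
  unfolding trace_coeff_def assms divisor_series_add divisor_series_scale sigma_fps_eq ..

lemma np_coeff_small:
  "np_coeff 1 m = 1" "np_coeff 2 m = - of_int m - 1" "np_coeff 3 m = (- of_int m - 1) * (- of_int m - 2) / 2"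
  using gchoose_small(3)[of "of_int (- m - 1)"] by (simp_all add: np_coeff_def gchoose_small numeral_eq_Suc)

lemma trace_coeff_values:
  "trace_coeff 1 1 = fps_const 2 * sigma_fps 1 + (fps_const 0 * sigma_fps 3 + fps_const 0 * sigma_fps 5)"
  "trace_coeff 1 2 = fps_const (- 1) * sigma_fps 1 + (fps_const 0 * sigma_fps 3 + fps_const 0 * sigma_fps 5)"
  "trace_coeff 1 3 = fps_const (2 / 3) * sigma_fps 1 + (fps_const (1 / 3) * sigma_fps 3 + fps_const 0 * sigma_fps 5)"
  "trace_coeff 2 1 = fps_const (- 2) * sigma_fps 1 + (fps_const 0 * sigma_fps 3 + fps_const 0 * sigma_fps 5)"
  "trace_coeff 2 2 = fps_const 1 * sigma_fps 1 + (fps_const (- 1) * sigma_fps 3 + fps_const 0 * sigma_fps 5)"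
  "trace_coeff 2 3 = fps_const (- 2 / 3) * sigma_fps 1 + (fps_const (2 / 3) * sigma_fps 3 + fps_const 0 * sigma_fps 5)"
  "trace_coeff 3 1 = fps_const 2 * sigma_fps 1 + (fps_const 1 * sigma_fps 3 + fps_const 0 * sigma_fps 5)"
  "trace_coeff 3 2 = fps_const (- 1) * sigma_fps 1 + (fps_const 1 * sigma_fps 3 + fps_const 0 * sigma_fps 5)"
  "trace_coeff 3 3 = fps_const (2 / 3) * sigma_fps 1 + (fps_const (- 5 / 6) * sigma_fps 3 + fps_const (1 / 6) * sigma_fps 5)"
  by (rule trace_coeff_poly, simp only: np_coeff_small gchoose_small,
      simp add: field_simps power3_eq_cube power_numeral_reduce)+

text \<open>The divisor sums of unwanted weight cancel between the modes that make up a[-n] and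
  a[-m], and the annihilation coefficients supply exactly the Bernoulli constant terms.\<close>

lemma contraction_values:
  "contraction 1 1 = eisen 1" "contraction 1 2 = 0" "contraction 1 3 = fps_const 3 * eisen 2"
  "contraction 2 2 = fps_const (- 6) * eisen 2" "contraction 2 3 = 0" "contraction 3 3 = fps_const 30 * eisen 3"
proof -
  have i: "int 1 = 1" "int 2 = 2" "int 3 = 3" by simp_all
  note d = contraction_def bop_coeff_def sum_upto_3 i bcoeff_values trace_coeff_values eisen_values
  have const: "fps_nth (fps_const c) n = (if n = 0 then c else 0)" for c :: complex and n
    by simp
  note nth = fps_add_nth fps_mult_left_const_nth fps_mult_right_const_nth fps_zero_nth const
    if_True if_False refl mult_zero_left mult_zero_right add_0_left add_0_right
  show "contraction 1 1 = eisen 1"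
    unfolding d by (rule fps_ext, rename_tac n, case_tac n, simp_all only: nth nat.simps, simp_all add: field_simps)
  show "contraction 1 2 = 0"
    unfolding d by (rule fps_ext, rename_tac n, case_tac n, simp_all only: nth nat.simps, simp_all add: field_simps)
  show "contraction 1 3 = fps_const 3 * eisen 2"
    unfolding d by (rule fps_ext, rename_tac n, case_tac n, simp_all only: nth nat.simps, simp_all add: field_simps)
  show "contraction 2 2 = fps_const (- 6) * eisen 2"
    unfolding d by (rule fps_ext, rename_tac n, case_tac n, simp_all only: nth nat.simps, simp_all add: field_simps)
  show "contraction 2 3 = 0"
    unfolding d by (rule fps_ext, rename_tac n, case_tac n, simp_all only: nth nat.simps, simp_all add: field_simps)
  show "contraction 3 3 = fps_const 30 * eisen 3"
    unfolding d by (rule fps_ext, rename_tac n, case_tac n, simp_all only: nth nat.simps, simp_all add: field_simps)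
qed

section \<open>Triangularity of the trace map on W with respect to the monomials in E_2, E_4,
  E_6\<close>

section \<open>The character map on \<open>W\<close>\<close>

definition chi :: "'h::quad_space boson \<Rightarrow> complex fps" where
  "chi v = euler_product ^ cvs.dim (UNIV :: 'h set) * ztrace v"

lemma chi_add: "chi (v + w) = chi v + chi w"
  by (simp add: chi_def ztrace_add distrib_left)

lemma chi_scale: "chi (c *\<^sub>C v) = fps_const c * chi v"
  unfolding chi_def ztrace_scale by (rule mult.left_commute)

lemma chi_zero: "chi (0 :: 'h::quad_space boson) = 0"
  by (simp add: chi_def ztrace_zero)

lemma chi_sum: "chi (sum f A) = (\<Sum>i\<in>A. chi (f i))"
  by (induction A rule: infinite_finite_induct) (simp_all add: chi_add chi_zero)

lemma chi_vac: "chi (vac :: 'h::quad_space boson) = 1"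
  unfolding chi_def by (rule euler_product_ztrace_vac)

text \<open>The letters are removed from the outside in the order a[-1], a[-2], a[-3], so a[-n]
  meets only letters a[-m] with m \<ge> n.\<close>

lemma chi_bword:
  assumes "form a a = 1"
  shows "chi (bword a (Suc r) s t) = of_nat r * eisen 1 * chi (bword a (r - 1) s t) +
      of_nat t * (fps_const 3 * eisen 2) * chi (bword a r s (t - 1))"
    and "chi (bword a 0 (Suc s) t) = of_nat s * (fps_const (- 6) * eisen 2) * chi (bword a 0 (s - 1) t)"
    and "chi (bword a 0 0 (Suc t)) = of_nat t * (fps_const 30 * eisen 3) * chi (bword a 0 0 (t - 1))"
  unfolding bword_simps chi_def ztrace_bop_bword[OF assms] contraction_values
  by (simp_all only: distrib_left mult_ac mult_zero_left mult_zero_right of_nat_0 add_0_left add_0_right)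

interpretation fpsv: vector_space "\<lambda>c f. fps_const (c :: complex) * f"
  by unfold_locales (simp_all add: algebra_simps fps_const_add[symmetric] fps_const_mult[symmetric]
      del: fps_const_add fps_const_mult)

definition mon :: "nat \<times> nat \<times> nat \<Rightarrow> complex fps" where
  "mon = (\<lambda>(i, j, k). eisen 1 ^ i * eisen 2 ^ j * eisen 3 ^ k)"

lemma mon_mult: "mon (i, j, k) * mon (i', j', k') = mon (i + i', j + j', k + k')"
  by (simp add: mon_def power_add mult_ac)

lemma mon_simps: "mon (0, 0, 0) = 1" "mon (1, 0, 0) = eisen 1" "mon (0, 1, 0) = eisen 2" "mon (0, 0, 1) = eisen 3"
  by (simp_all add: mon_def)

lemma span_mon_mult:
  assumes "f \<in> fpsv.span (mon ` S)" "\<And>x. x \<in> S \<Longrightarrow> g * mon x \<in> fpsv.span T"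
  shows "g * f \<in> fpsv.span T"
  using assms(1)
proof (induction rule: fpsv.span_induct_alt)
  case base
  show ?case by (simp add: fpsv.span_zero)
next
  case (step c x y)
  then have "fps_const c * (g * x) \<in> fpsv.span T" using assms(2) by (intro fpsv.span_scale) auto
  with step(2) have "fps_const c * (g * x) + g * y \<in> fpsv.span T" by (intro fpsv.span_add)
  then show ?case by (simp add: distrib_left mult.left_commute)
qed

lemma mon_sum_eq_0:
  assumes "finite A" "(\<Sum>x\<in>A. fps_const (c x) * mon x) = 0" "t \<in> A"
  shows "c t = 0"
proof (rule eisenstein_independent[OF _ _ _ assms(1) _ assms(3)])
  show "(\<Sum>(i, j, k)\<in>A. fps_const (c (i, j, k)) * (fps_const (- 1 / 12) + fps_const 2 * sigma_fps 1) ^ i *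
    (fps_const (1 / 720) + fps_const (1 / 3) * sigma_fps 3) ^ j *
    (fps_const (- 1 / 30240) + fps_const (1 / 60) * sigma_fps 5) ^ k) = 0"
    using assms(2) unfolding eisen_values[symmetric] mon_def by (simp add: case_prod_unfold mult.assoc)
qed simp_all

text \<open>Independence in the form that isolates one monomial, with lower and competing terms
  collected in a span.\<close>

lemma mon_notin_span: "mon x \<notin> fpsv.span (mon ` {z. z \<noteq> x})"
proof
  assume "mon x \<in> fpsv.span (mon ` {z. z \<noteq> x})"
  then obtain T r where T: "finite T" "T \<subseteq> mon ` {z. z \<noteq> x}" "mon x = (\<Sum>f\<in>T. fps_const (r f) * f)"
    unfolding fpsv.span_explicit by blast
  from T(2) obtain A where A: "A \<subseteq> {z. z \<noteq> x}" "inj_on mon A" "T = mon ` A"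
    unfolding subset_image_inj by blast
  have fin: "finite A" using T(1) A(2,3) finite_image_iff by metis
  have x: "x \<notin> A" using A(1) by blast
  have "(\<Sum>y\<in>A. fps_const (if y = x then - 1 else r (mon y)) * mon y) = (\<Sum>y\<in>A. fps_const (r (mon y)) * mon y)"
    using x by (intro sum.cong refl) auto
  also have "\<dots> = mon x" unfolding T(3) A(3) using A(2) by (simp add: sum.reindex)
  finally have "(\<Sum>y\<in>insert x A. fps_const (if y = x then - 1 else r (mon y)) * mon y) = 0"
    by (simp only: sum.insert[OF fin x] if_True) (simp flip: fps_const_neg)
  from mon_sum_eq_0[OF _ this, of x] fin show False by simp
qed

text \<open>The forms of degree less than n in E_2, with no restriction on E_4 and E_6.\<close>

abbreviation below :: "nat \<Rightarrow> complex fps set" where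
  "below n \<equiv> fpsv.span (mon ` {x. fst x < n})"

lemma eisen_mult_mon:
  "eisen 1 * mon x = mon (Suc (fst x), snd x)" "eisen 2 * mon x = mon (fst x, Suc (fst (snd x)), snd (snd x))"
  by (simp_all add: mon_def case_prod_unfold mult_ac)

lemma below_mult:
  assumes "f \<in> below n"
  shows "eisen 1 * f \<in> below (Suc n)" "eisen 2 * f \<in> below n"
proof -
  have "eisen 1 * mon x \<in> below (Suc n)" if "fst x < n" for x
    using that unfolding eisen_mult_mon by (intro fpsv.span_base imageI) simp
  then show "eisen 1 * f \<in> below (Suc n)" by (intro span_mon_mult[OF assms]) simp
  have "eisen 2 * mon x \<in> below n" if "fst x < n" for x
    using that unfolding eisen_mult_mon by (intro fpsv.span_base imageI) simp
  then show "eisen 2 * f \<in> below n" by (intro span_mon_mult[OF assms]) simp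
qed

lemma below_of_nat: "f \<in> below n \<Longrightarrow> of_nat m * f \<in> below n"
  using fpsv.span_scale[of f _ "of_nat m"] by (simp add: fps_of_nat)

text \<open>Lower terms are measured by the degree in E_2 alone; they may contain any powers of E_4
  and E_6.\<close>

definition leading :: "complex fps \<Rightarrow> nat \<times> nat \<times> nat \<Rightarrow> bool" where
  "leading f x \<longleftrightarrow> (\<exists>c. c \<noteq> 0 \<and> f - fps_const c * mon x \<in> below (fst x))"

lemma leading_below: "leading f x \<Longrightarrow> f \<in> below (Suc (fst x))"
proof -
  assume "leading f x"
  then obtain c where c: "f - fps_const c * mon x \<in> below (fst x)" unfolding leading_def by blast
  have "below (fst x) \<subseteq> below (Suc (fst x))" by (intro fpsv.span_mono image_mono) auto
  moreover have "fps_const c * mon x \<in> below (Suc (fst x))"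
    by (intro fpsv.span_scale fpsv.span_base) simp
  ultimately have "(f - fps_const c * mon x) + fps_const c * mon x \<in> below (Suc (fst x))"
    using c by (intro fpsv.span_add) auto
  then show ?thesis by simp
qed

text \<open>Without a[-1] the remaining letters do not contract with each other, so the value is
  exactly a multiple of E_4^s E_6^t, with factors -6 (2i+1) and 30 (2i+1) that never vanish.\<close>

lemma leading_chi_0:
  assumes "form a a = 1"
  shows "leading (chi (bword a 0 (2 * s) (2 * t))) (0, s, t)"
proof -
  have t: "\<exists>c. c \<noteq> 0 \<and> chi (bword a 0 0 (2 * t)) = fps_const c * mon (0, 0, t)"
  proof (induction t)
    case 0
    show ?case by (intro exI[of _ 1]) (simp add: bword_simps chi_vac mon_simps)
  next
    case (Suc t)
    then obtain c where c: "c \<noteq> 0" "chi (bword a 0 0 (2 * t)) = fps_const c * mon (0, 0, t)" by blast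
    have "chi (bword a 0 0 (2 * Suc t)) = of_nat (2 * t + 1) * (fps_const 30 * eisen 3) * (fps_const c * mon (0, 0, t))"
      using chi_bword(3)[OF assms, of "2 * t + 1"] c(2) by simp
    also have "\<dots> = fps_const (of_nat (2 * t + 1) * 30 * c) * (mon (0, 0, 1) * mon (0, 0, t))"
      by (simp only: mon_simps fps_const_mult[symmetric] fps_of_nat mult_ac)
    finally have "chi (bword a 0 0 (2 * Suc t)) = fps_const (of_nat (2 * t + 1) * 30 * c) * mon (0, 0, Suc t)"
      unfolding mon_mult by simp
    moreover have "of_nat (2 * t + 1) * 30 * c \<noteq> 0" using c(1) by (simp only: mult_eq_0_iff of_nat_eq_0_iff) simp
    ultimately show ?case by blast
  qed
  have "\<exists>c. c \<noteq> 0 \<and> chi (bword a 0 (2 * s) (2 * t)) = fps_const c * mon (0, s, t)"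
  proof (induction s)
    case 0
    show ?case using t by simp
  next
    case (Suc s)
    then obtain c where c: "c \<noteq> 0" "chi (bword a 0 (2 * s) (2 * t)) = fps_const c * mon (0, s, t)" by blast
    have "chi (bword a 0 (2 * Suc s) (2 * t)) = of_nat (2 * s + 1) * (fps_const (- 6) * eisen 2) * (fps_const c * mon (0, s, t))"
      using chi_bword(2)[OF assms, of "2 * s + 1"] c(2) by simp
    also have "\<dots> = fps_const (of_nat (2 * s + 1) * (- 6) * c) * (mon (0, 1, 0) * mon (0, s, t))"
      by (simp only: mon_simps fps_const_mult[symmetric] fps_of_nat mult_ac)
    finally have "chi (bword a 0 (2 * Suc s) (2 * t)) = fps_const (of_nat (2 * s + 1) * (- 6) * c) * mon (0, Suc s, t)"
      unfolding mon_mult by simp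
    moreover have "of_nat (2 * s + 1) * (- 6) * c \<noteq> 0" using c(1) by (simp only: mult_eq_0_iff of_nat_eq_0_iff) simp
    ultimately show ?case by blast
  qed
  then show ?thesis unfolding leading_def by (auto intro: fpsv.span_zero)
qed

text \<open>
  For even exponents the recursion for \<open>a[-1]\<close> also passes through vectors with two odd exponents;
  these only contribute terms of lower degree in \<open>E\<^sub>2\<close>.
\<close>

lemma leading_chi_bword:
  assumes "form a a = 1"
  shows "leading (chi (bword a (2 * r) (2 * s) (2 * t))) (r, s, t)"
    and "chi (bword a (2 * r + 1) (2 * s) (2 * t + 1)) \<in> below (Suc r)"
proof -
  have "\<forall>t. leading (chi (bword a (2 * r) (2 * s) (2 * t))) (r, s, t) \<and>
      chi (bword a (2 * r + 1) (2 * s) (2 * t + 1)) \<in> below (Suc r)"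
  proof (induction r)
    case 0
    have "chi (bword a 1 (2 * s) (2 * t + 1)) \<in> below 1" for t
    proof -
      have "chi (bword a 1 (2 * s) (2 * t + 1)) = of_nat (2 * t + 1) * (fps_const 3 * (eisen 2 * chi (bword a 0 (2 * s) (2 * t))))"
        using chi_bword(1)[OF assms, of 0 "2 * s" "2 * t + 1"] by (simp add: mult.assoc)
      moreover have "eisen 2 * chi (bword a 0 (2 * s) (2 * t)) \<in> below 1"
        using below_mult(2)[OF leading_below[OF leading_chi_0[OF assms, of s t]]] by simp
      ultimately show ?thesis by (simp only: below_of_nat fpsv.span_scale)
    qed
    then show ?case using leading_chi_0[OF assms] by simp
  next
    case (Suc r)
    have E: "leading (chi (bword a (2 * Suc r) (2 * s) (2 * t))) (Suc r, s, t)" for t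
    proof -
      obtain c where c: "c \<noteq> 0" "chi (bword a (2 * r) (2 * s) (2 * t)) - fps_const c * mon (r, s, t) \<in> below r"
        using Suc unfolding leading_def by auto
      let ?f = "chi (bword a (2 * r) (2 * s) (2 * t)) - fps_const c * mon (r, s, t)"
      let ?g = "chi (bword a (2 * r + 1) (2 * s) (2 * t - 1))"
      have "chi (bword a (2 * Suc r) (2 * s) (2 * t)) =
          of_nat (2 * r + 1) * eisen 1 * chi (bword a (2 * r) (2 * s) (2 * t)) +
          of_nat (2 * t) * (fps_const 3 * eisen 2) * ?g"
        using chi_bword(1)[OF assms, of "2 * r + 1" "2 * s" "2 * t"] by simp
      also have "chi (bword a (2 * r) (2 * s) (2 * t)) = ?f + fps_const c * mon (r, s, t)" by simp
      finally have 1: "chi (bword a (2 * Suc r) (2 * s) (2 * t)) =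
          of_nat (2 * r + 1) * eisen 1 * (?f + fps_const c * mon (r, s, t)) +
          of_nat (2 * t) * (fps_const 3 * eisen 2) * ?g" .
      have 2: "mon (Suc r, s, t) = mon (1, 0, 0) * mon (r, s, t)" unfolding mon_mult by simp
      have 3: "chi (bword a (2 * Suc r) (2 * s) (2 * t)) - fps_const (of_nat (2 * r + 1) * c) * mon (Suc r, s, t) =
          of_nat (2 * r + 1) * (eisen 1 * ?f) + of_nat (2 * t) * (fps_const 3 * (eisen 2 * ?g))"
        unfolding 1 2 mon_simps fps_const_mult[symmetric] fps_of_nat by (simp only: algebra_simps)
      \<comment> \<open>For t = 0 the truncated exponent 2 t - 1 is harmless because of the factor 2
        t. Otherwise it is odd, and the second half of the induction hypothesis bounds the degree in
        E_2.\<close>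
      have "of_nat (2 * t) * (fps_const 3 * (eisen 2 * ?g)) \<in> below (Suc r)"
      proof (cases t)
        case 0
        then show ?thesis by (simp add: fpsv.span_zero)
      next
        case (Suc t')
        then have "?g \<in> below (Suc r)" using Suc.IH[rule_format, of t'] by simp
        then show ?thesis by (intro below_of_nat fpsv.span_scale below_mult)
      qed
      moreover have "of_nat (2 * r + 1) * (eisen 1 * ?f) \<in> below (Suc r)"
        using c(2) by (intro below_of_nat below_mult)
      ultimately have "chi (bword a (2 * Suc r) (2 * s) (2 * t)) - fps_const (of_nat (2 * r + 1) * c) * mon (Suc r, s, t) \<in> below (Suc r)"
        unfolding 3 by (rule fpsv.span_add[rotated])
      moreover have "of_nat (2 * r + 1) * c \<noteq> 0" using c(1) by (simp only: mult_eq_0_iff of_nat_eq_0_iff) simp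
      ultimately show ?thesis unfolding leading_def fst_conv by blast
    qed
    have "chi (bword a (2 * Suc r + 1) (2 * s) (2 * t + 1)) \<in> below (Suc (Suc r))" for t
    proof -
      have 1: "chi (bword a (2 * Suc r + 1) (2 * s) (2 * t + 1)) =
          of_nat (2 * Suc r) * (eisen 1 * chi (bword a (2 * r + 1) (2 * s) (2 * t + 1))) +
          of_nat (2 * t + 1) * (fps_const 3 * (eisen 2 * chi (bword a (2 * Suc r) (2 * s) (2 * t))))"
        using chi_bword(1)[OF assms, of "2 * Suc r" "2 * s" "2 * t + 1"] by (simp add: mult.assoc)
      have "eisen 1 * chi (bword a (2 * r + 1) (2 * s) (2 * t + 1)) \<in> below (Suc (Suc r))"
        using Suc by (intro below_mult) blast
      moreover have "eisen 2 * chi (bword a (2 * Suc r) (2 * s) (2 * t)) \<in> below (Suc (Suc r))"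
        using leading_below[OF E[of t]] by (intro below_mult) simp
      ultimately show ?thesis
        unfolding 1 by (intro fpsv.span_add below_of_nat fpsv.span_scale)
    qed
    with E show ?case by blast
  qed
  then show "leading (chi (bword a (2 * r) (2 * s) (2 * t))) (r, s, t)"
    "chi (bword a (2 * r + 1) (2 * s) (2 * t + 1)) \<in> below (Suc r)" by blast+
qed

definition wvec :: "'h::quad_space \<Rightarrow> nat \<times> nat \<times> nat \<Rightarrow> 'h boson" where
  "wvec a = (\<lambda>(r, s, t). bword a (2 * r) (2 * s) (2 * t))"

lemma W_space_eq: "W_space a = cvs.span (range (wvec a))"
proof -
  have "{(hbracket a (- 1) ^^ (2 * r)) ((hbracket a (- 2) ^^ (2 * s)) ((hbracket a (- 3) ^^ (2 * t)) vac)) | r s t. True}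
      = range (wvec a)"
    unfolding hbracket_word_eq wvec_def by (auto simp: image_def)
  then show ?thesis by (simp add: W_space_def)
qed

lemma leading_wvec: "form a a = 1 \<Longrightarrow> leading (chi (wvec a x)) x"
  using leading_chi_bword(1)[of a "fst x" "fst (snd x)" "snd (snd x)"] by (simp add: wvec_def case_prod_unfold)

lemma chi_W_in_span:
  assumes "form a a = 1" "v \<in> W_space a"
  shows "chi v \<in> fpsv.span (range mon)"
  using assms(2) unfolding W_space_eq
proof (induction rule: cvs.span_induct_alt)
  case base
  show ?case by (simp add: chi_zero fpsv.span_zero)
next
  case (step c v w)
  then obtain x where x: "v = wvec a x" by blast
  have "chi v \<in> below (Suc (fst x))" unfolding x by (rule leading_below[OF leading_wvec[OF assms(1)]])
  moreover have "below (Suc (fst x)) \<subseteq> fpsv.span (range mon)" by (intro fpsv.span_mono image_mono) simp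
  ultimately show ?case unfolding chi_add chi_scale using step by (intro fpsv.span_add fpsv.span_scale) auto
qed

lemma subspace_chi_W: "fpsv.subspace (chi ` W_space a)"
  unfolding fpsv.subspace_def
proof (intro conjI ballI allI)
  show "0 \<in> chi ` W_space a"
    by (rule image_eqI[of _ _ 0]) (simp_all add: chi_zero W_space_def cvs.span_zero)
next
  fix f g assume "f \<in> chi ` W_space a" "g \<in> chi ` W_space a"
  then obtain v w where "f = chi v" "g = chi w" "v \<in> W_space a" "w \<in> W_space a" by blast
  then show "f + g \<in> chi ` W_space a"
    by (intro image_eqI[of _ _ "v + w"]) (simp_all add: chi_add W_space_def cvs.span_add)
next
  fix c f assume "f \<in> chi ` W_space a"
  then obtain v where "f = chi v" "v \<in> W_space a" by blast
  then show "fps_const c * f \<in> chi ` W_space a"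
    by (intro image_eqI[of _ _ "c *\<^sub>C v"]) (simp_all add: chi_scale W_space_def cvs.span_scale)
qed

text \<open>Triangular inversion: the value on \<open>wvec a x\<close> is a nonzero multiple of the
  monomial plus terms of smaller degree in E_2, which are in the image by induction.\<close>

lemma mon_in_chi_W:
  assumes "form a a = 1"
  shows "mon x \<in> chi ` W_space a"
proof (induction "fst x" arbitrary: x rule: less_induct)
  case less
  have b: "below (fst x) \<subseteq> chi ` W_space a"
    by (rule fpsv.span_minimal[OF _ subspace_chi_W]) (use less in auto)
  obtain c where c: "c \<noteq> 0" "chi (wvec a x) - fps_const c * mon x \<in> below (fst x)"
    using leading_wvec[OF assms] unfolding leading_def by blast
  have "chi (wvec a x) \<in> chi ` W_space a"
    unfolding W_space_eq by (intro imageI cvs.span_base) simp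
  moreover have "chi (wvec a x) - fps_const c * mon x \<in> chi ` W_space a" using b c(2) by blast
  ultimately have "fps_const (inverse c) * (chi (wvec a x) - (chi (wvec a x) - fps_const c * mon x)) \<in> chi ` W_space a"
    by (rule fpsv.subspace_scale[OF subspace_chi_W fpsv.subspace_diff[OF subspace_chi_W]])
  moreover have "fps_const (inverse c) * (chi (wvec a x) - (chi (wvec a x) - fps_const c * mon x)) = mon x"
    using c(1) by (simp add: mult.assoc[symmetric])
  ultimately show ?case by (rule back_subst[of "\<lambda>f. f \<in> _"])
qed

lemma chi_W_eq:
  assumes "form a a = 1"
  shows "chi ` W_space a = fpsv.span (range mon)"
proof (rule antisym)
  show "chi ` W_space a \<subseteq> fpsv.span (range mon)" using chi_W_in_span[OF assms] by blast
  show "fpsv.span (range mon) \<subseteq> chi ` W_space a"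
    by (rule fpsv.span_minimal[OF _ subspace_chi_W]) (use mon_in_chi_W[OF assms] in blast)
qed

text \<open>In a nontrivial combination, an index x of maximal degree in E_2 among the nonzero
  coefficients is chosen. Its monomial arises from no other summand, so it would lie in the span of
  the remaining monomials.\<close>

lemma chi_W_eq_0:
  assumes "form a a = 1" "v \<in> W_space a" "chi v = 0"
  shows "v = 0"
proof (rule ccontr)
  assume "v \<noteq> 0"
  from assms(2) obtain T u where T: "finite T" "T \<subseteq> range (wvec a)" "v = (\<Sum>w\<in>T. u w *\<^sub>C w)"
    unfolding W_space_eq cvs.span_explicit by blast
  from T(2) obtain B where B: "inj_on (wvec a) B" "T = wvec a ` B"
    unfolding subset_image_inj by blast
  have finB: "finite B" using T(1) B finite_image_iff by metis
  \<comment> \<open>Zero coefficients are discarded first, so that the coefficient at the maximal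
    index is invertible.\<close>
  define A where "A = {x \<in> B. u (wvec a x) \<noteq> 0}"
  have finA: "finite A" using finB by (simp add: A_def)
  have "v = (\<Sum>x\<in>B. u (wvec a x) *\<^sub>C wvec a x)"
    unfolding T(3) B(2) using B(1) by (simp add: sum.reindex)
  also have "\<dots> = (\<Sum>x\<in>A. u (wvec a x) *\<^sub>C wvec a x)"
    using finB by (intro sum.mono_neutral_right) (auto simp: A_def)
  finally have v: "v = (\<Sum>x\<in>A. u (wvec a x) *\<^sub>C wvec a x)" .
  with \<open>v \<noteq> 0\<close> have "A \<noteq> {}" by auto
  then have "Max (fst ` A) \<in> fst ` A" using finA by (intro Max_in) auto
  then obtain x where x: "x \<in> A" "fst x = Max (fst ` A)" by auto
  have max: "fst y \<le> fst x" if "y \<in> A" for y unfolding x(2) using finA that by (intro Max_ge) auto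
  let ?U = "fpsv.span (mon ` {z. z \<noteq> x})"
  obtain c where c: "c \<noteq> 0" "chi (wvec a x) - fps_const c * mon x \<in> below (fst x)"
    using leading_wvec[OF assms(1)] unfolding leading_def by blast
  have bx: "below (fst x) \<subseteq> ?U" by (intro fpsv.span_mono image_mono) auto
  \<comment> \<open>The monomial \<open>mon y\<close> differs from \<open>mon x\<close>, and all
    lower terms have degree in E_2 less than that of y, hence less than that of x.\<close>
  have other: "chi (wvec a y) \<in> ?U" if "y \<in> A - {x}" for y
  proof -
    obtain d where d: "chi (wvec a y) - fps_const d * mon y \<in> below (fst y)"
      using leading_wvec[OF assms(1)] unfolding leading_def by blast
    have "below (fst y) \<subseteq> ?U" using max[of y] that by (intro fpsv.span_mono image_mono) auto
    moreover have "fps_const d * mon y \<in> ?U" using that by (intro fpsv.span_scale fpsv.span_base) auto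
    ultimately have "(chi (wvec a y) - fps_const d * mon y) + fps_const d * mon y \<in> ?U"
      using d by (intro fpsv.span_add) auto
    then show ?thesis by simp
  qed
  let ?u = "u (wvec a x)" and ?rest = "\<Sum>y\<in>A - {x}. fps_const (u (wvec a y)) * chi (wvec a y)"
  have "0 = (\<Sum>y\<in>A. fps_const (u (wvec a y)) * chi (wvec a y))"
    using assms(3) unfolding v chi_sum chi_scale ..
  also have "\<dots> = fps_const ?u * chi (wvec a x) + ?rest"
    by (rule sum.remove[OF finA x(1)])
  finally have "fps_const (?u * c) * mon x = - (fps_const ?u * (chi (wvec a x) - fps_const c * mon x)) - ?rest"
    unfolding fps_const_mult[symmetric] by (simp add: algebra_simps eq_neg_iff_add_eq_0)
  also have "\<dots> \<in> ?U"
    by (rule fpsv.span_diff[OF fpsv.span_neg[OF fpsv.span_scale[OF subsetD[OF bx c(2)]]]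
          fpsv.span_sum[OF fpsv.span_scale[OF other]]])
  finally have "fps_const (inverse (?u * c)) * (fps_const (?u * c) * mon x) \<in> ?U"
    by (rule fpsv.span_scale)
  moreover have "fps_const (inverse (?u * c)) * (fps_const (?u * c) * mon x) = mon x"
  proof -
    have "?u * c \<noteq> 0" using x(1) c(1) by (simp add: A_def)
    then have "fps_const (inverse (?u * c)) * fps_const (?u * c) = 1" by (simp add: field_simps)
    then show ?thesis by (simp only: mult.assoc[symmetric, of "fps_const (inverse (?u * c))"] mult_1_left)
  qed
  ultimately have "mon x \<in> ?U" by (rule back_subst[of "\<lambda>f. f \<in> _"])
  then show False using mon_notin_span[of x] by blast
qed

lemma span_mon_closed:
  assumes "f \<in> fpsv.span (range mon)" "g \<in> fpsv.span (range mon)"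
  shows "f * g \<in> fpsv.span (range mon)"
proof (rule span_mon_mult[OF assms(2)])
  fix x
  have "mon x * f \<in> fpsv.span (range mon)"
  proof (rule span_mon_mult[OF assms(1)])
    fix y
    show "mon x * mon y \<in> fpsv.span (range mon)"
      by (cases x, cases y) (auto simp: mon_mult intro: fpsv.span_base)
  qed
  then show "f * mon x \<in> fpsv.span (range mon)" by (simp add: mult.commute)
qed

lemma q_series_mon: "q_series (mon (i, j, k)) = eisenstein 1 ^ i * eisenstein 2 ^ j * eisenstein 3 ^ k"
  by (simp add: mon_def q_series_mult q_series_power q_series_eisen)

lemma quasimodular_power: "f \<in> quasimodular \<Longrightarrow> f ^ n \<in> quasimodular"
proof (induction n)
  case 0
  show ?case using quasimodular.const[of 1] by simp
qed (simp add: quasimodular.mult)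

lemma quasimodular_eq: "quasimodular = q_series ` fpsv.span (range mon)"
proof (rule antisym)
  have mon: "q_series (mon (i, j, k)) \<in> q_series ` fpsv.span (range mon)" for i j k
    by (intro imageI fpsv.span_base) simp
  show "quasimodular \<subseteq> q_series ` fpsv.span (range mon)"
  proof
    fix f assume "f \<in> quasimodular"
    then show "f \<in> q_series ` fpsv.span (range mon)"
    proof induction
      case (const c)
      have "fps_const c * mon (0, 0, 0) \<in> fpsv.span (range mon)" by (intro fpsv.span_scale fpsv.span_base) simp
      then have "q_series (fps_const c * mon (0, 0, 0)) \<in> q_series ` fpsv.span (range mon)" by (rule imageI)
      then show ?case by (simp add: mon_simps q_series_const)
    next
      case E2
      then show ?case using mon[of 1 0 0] by (simp add: q_series_mon)
    next
      case E4
      then show ?case using mon[of 0 1 0] by (simp add: q_series_mon)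
    next
      case E6
      then show ?case using mon[of 0 0 1] by (simp add: q_series_mon)
    next
      case (add f g)
      then obtain f' g' where "f = q_series f'" "g = q_series g'" "f' \<in> fpsv.span (range mon)" "g' \<in> fpsv.span (range mon)"
        by blast
      then show ?case by (intro image_eqI[of _ _ "f' + g'"]) (simp_all add: q_series_add fpsv.span_add)
    next
      case (mult f g)
      then obtain f' g' where "f = q_series f'" "g = q_series g'" "f' \<in> fpsv.span (range mon)" "g' \<in> fpsv.span (range mon)"
        by blast
      then show ?case by (intro image_eqI[of _ _ "f' * g'"]) (simp_all add: q_series_mult span_mon_closed)
    qed
  qed
  show "q_series ` fpsv.span (range mon) \<subseteq> quasimodular"
  proof clarify
    fix f assume "f \<in> fpsv.span (range mon)"
    then show "q_series f \<in> quasimodular"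
    proof (induction rule: fpsv.span_induct_alt)
      case base
      show ?case using quasimodular.const[of 0] q_series_const[of 0] by simp
    next
      case (step c x y)
      then obtain i j k where "x = mon (i, j, k)" by (metis imageE prod_cases3)
      with step(2) show ?case
        unfolding q_series_add q_series_mult q_series_const
        by (simp add: q_series_mon quasimodular.intros(1,3-6) quasimodular.E2[unfolded One_nat_def] quasimodular_power)
    qed
  qed
qed

theorem mainTheorem2:
  fixes a :: "'h::quad_space" and d :: nat
  assumes "cvs.dim (UNIV :: 'h set) = d" and "d \<ge> 1"
    and "form a a = 1"
  defines "\<Phi> \<equiv> (\<lambda>v :: 'h boson. inverse (trace_fun (vac :: 'h boson)) * trace_fun v)"
  shows "(\<forall>v. \<Phi> v = eta ^ d * trace_fun v) \<and>
    Vector_Spaces.linear (*\<^sub>C) (\<lambda>c f. fls_const c * f) \<Phi> \<and>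
    bij_betw \<Phi> (W_space a) quasimodular"
proof -
  have chi: "eta ^ d * trace_fun v = q_series (chi v)" for v :: "'h boson"
    using eta_power_trace_fun[of v] assms(1) by (simp add: chi_def)
  \<comment> \<open>The value 1 at the vacuum identifies the inverse of the character with
    \<eta>^d.\<close>
  have "eta ^ d * trace_fun (vac :: 'h boson) = 1"
    unfolding chi chi_vac by (rule q_series_1)
  then have "inverse (trace_fun (vac :: 'h boson)) = eta ^ d"
    by (intro inverse_unique) (simp only: mult.commute)
  then have 1: "\<Phi> v = eta ^ d * trace_fun v" for v by (simp add: \<Phi>_def)
  then have \<Phi>: "\<Phi> v = q_series (chi v)" for v by (simp add: chi)
  have add: "\<Phi> (v + w) = \<Phi> v + \<Phi> w" for v w by (simp add: \<Phi> chi_add q_series_add)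
  have scale: "\<Phi> (c *\<^sub>C v) = fls_const c * \<Phi> v" for c v
    unfolding \<Phi> chi_scale q_series_mult q_series_const ..
  interpret fls: vector_space "\<lambda>c f. fls_const (c :: complex) * f"
    by unfold_locales (simp_all add: algebra_simps fls_plus_const[symmetric] fls_const_mult_const[symmetric]
      del: fls_plus_const fls_const_mult_const)
  interpret \<Phi>: Vector_Spaces.linear "(*\<^sub>C)" "\<lambda>c f. fls_const (c :: complex) * f" \<Phi>
    by unfold_locales (rule add scale)+
  have "inj_on \<Phi> (W_space a)"
  proof (rule inj_onI)
    fix v w assume "v \<in> W_space a" "w \<in> W_space a" "\<Phi> v = \<Phi> w"
    then have "v - w \<in> W_space a" "q_series (chi (v - w)) = q_series 0"
      using \<Phi>.diff[of v w] q_series_const[of 0] unfolding \<Phi>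
      by (auto simp: W_space_def intro: cvs.span_diff)
    then have "chi (v - w) = 0" using q_series_inj by blast
    with \<open>v - w \<in> W_space a\<close> have "v - w = 0" by (rule chi_W_eq_0[OF assms(3)])
    then show "v = w" by simp
  qed
  moreover have "\<Phi> ` W_space a = quasimodular"
  proof -
    have "\<Phi> ` W_space a = q_series ` chi ` W_space a" unfolding image_image by (rule image_cong[OF refl \<Phi>])
    also have "\<dots> = quasimodular" by (simp add: chi_W_eq[OF assms(3)] quasimodular_eq)
    finally show ?thesis .
  qed
  ultimately show ?thesis using 1 \<Phi>.linear_axioms by (simp add: bij_betw_def)
qed

end
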